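(* Let $f\in\mathcal{L}^1_+$ and $x\ge 0$. Define, for $t\ge 0$, $$N_t^{h_0,f}=h_0(X_t)f(L_t)+\int_0^{+\infty}f(L_t+u)\,du,\qquad M_t^{h_0,f}=N_t^{h_0,f}+\pi_0\int_0^t f(L_u)\,du .$$ Then $N^{h_0,f}$ is a $\mathbb{P}_x$-supermartingale, $M^{h_0,f}$ is a $\mathbb{P}_x$-martingale (both with respect to $(\mathcal{F}_t)$), and for any $t>0$ and any bounded adapted process $(F_t)$, $$H(q)\,\mathbb{P}_x\left[F_t f(L_{\mathbf{e}_q});\,t<\mathbf{e}_q\right]\xrightarrow[q\downarrow 0]{}\mathbb{P}_x\left[F_tN_t^{h_0,f}\right]\quad\text{and}\quad H(q)\,\mathbb{P}_x\left[F_tf(L_{\mathbf{e}_q})\right]\xrightarrow[q\downarrow 0]{}\mathbb{P}_x\left[F_tM_t^{h_0,f}\right].$$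
   Context: Let $m:[0,\infty)\to[0,\infty)$ be right-continuous, strictly increasing, with $m(0)=0$. Let $X$ be the generalized one-dimensional diffusion (in the sense of Watanabe) on $[0,\infty)$ with scale function $s(x)=x$ and speed measure $dm$ (local generator $\frac{d}{dm}\frac{d}{dx}$), for which $0$ is regular-reflecting; $\infty$ is not reached. $\mathbb{P}_x$ is its law started at $x$; $\mathbb{P}_x[\cdot]$ also denotes expectation and $\mathbb{P}_x[Y;A]=\mathbb{P}_x[Y1_A]$. For $q>0$ let $\phi_q,\psi_q$ solve $\phi_q(x)=1+q\int_0^x dy\int_{(0,y]}\phi_q(z)\,dm(z)$ and $\psi_q(x)=x+q\int_0^x dy\int_{(0,y]}\psi_q(z)\,dm(z)$. The resolvent density of $X$ with respect to $dm$ is $r_q(x,y)=r_q(y,x)=H(q)\phi_q(x)\left(\phi_q(y)-\psi_q(y)/H(q)\right)$, $0\le x\le y$, where $H(q)=r_q(0,0)=\lim_{x\to\infty}\psi_q(x)/\phi_q(x)$. $L=(L_t)_{t\ge0}$ is the local time of $X$ at $0$, normalized by $\mathbb{P}_x[\int_0^\infty e^{-qt}dL_t]=r_q(x,0)$. Set $m(\infty)=\lim_{x\to\infty}m(x)$, $\pi_0=1/m(\infty)$ (so $\pi_0=0$ if $m(\infty)=\infty$), and $h_0(x)=x-\pi_0\int_0^x m(y)\,dy$. $\mathcal{F}^0_t=\sigma(X_s:s\le t)$ and $\mathcal{F}_t=\mathcal{F}^0_{t+}$; adaptedness is with respect to $(\mathcal{F}_t)$. $\mathcal{L}^1_+$ is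 the set of non-negative (measurable) functions $f$ on $[0,\infty)$ with $\int_0^\infty f(u)\,du<\infty$. $\mathbf{e}$ is a standard exponential random variable independent of $X$ (defined on the same probability space), and $\mathbf{e}_q=\mathbf{e}/q$. *)

theory Defs
  imports "HOL-Probability.Probability"
begin

section \<open>Speed measure, Krein-Feller equation and resolvent density\<close>

definition speed_function :: "(real \<Rightarrow> real) \<Rightarrow> bool" where
  "speed_function m \<longleftrightarrow>
     strict_mono_on {0..} m \<and> m 0 = 0 \<and> (\<forall>x\<ge>0. continuous (at_right x) m)"

text \<open>Stieltjes measure \<open>dg\<close> on the half-line of a nondecreasing right-continuous function \<open>g\<close>
  on \<open>[0,\<infinity>)\<close>. Extending \<open>g\<close> by \<open>g 0\<close> to the left of the origin means that \<open>dg\<close> charges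
  neither the negative half-line nor the point \<open>0\<close>.\<close>

definition half_line_measure :: "(real \<Rightarrow> real) \<Rightarrow> real measure" where
  "half_line_measure g = interval_measure (\<lambda>x. g (max 0 x))"

text \<open>Continuity on \<open>[0,\<infinity>)\<close> makes the (total) integrals below genuine ones.\<close>

definition krein_feller_solution ::
    "(real \<Rightarrow> real) \<Rightarrow> real \<Rightarrow> real \<Rightarrow> real \<Rightarrow> (real \<Rightarrow> real) \<Rightarrow> bool" where
  "krein_feller_solution m q a b u \<longleftrightarrow>
     continuous_on {0..} u \<and>
     (\<forall>x\<ge>0. u x = a + b * x
        + q * (LINT y:{0..x}|lborel. (LINT z:{0<..y}|half_line_measure m. u z)))"

definition H_fun :: "(real \<Rightarrow> real \<Rightarrow> real) \<Rightarrow> (real \<Rightarrow> real \<Rightarrow> real) \<Rightarrow> real \<Rightarrow> real" where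
  "H_fun \<phi> \<psi> q = Lim at_top (\<lambda>x. \<psi> q x / \<phi> q x)"

definition resolvent_density ::
    "(real \<Rightarrow> real \<Rightarrow> real) \<Rightarrow> (real \<Rightarrow> real \<Rightarrow> real) \<Rightarrow> real \<Rightarrow> real \<Rightarrow> real \<Rightarrow> real" where
  "resolvent_density \<phi> \<psi> q x y =
     H_fun \<phi> \<psi> q * \<phi> q (min x y) * (\<phi> q (max x y) - \<psi> q (max x y) / H_fun \<phi> \<psi> q)"

text \<open>The total mass \<open>m(\<infinity>)\<close> is an extended real, so \<open>1 / \<infinity> = 0\<close> covers the infinite case.\<close>

definition pi0 :: "(real \<Rightarrow> real) \<Rightarrow> real" where
  "pi0 m = real_of_ereal (1 / Lim at_top (\<lambda>x. ereal (m x)))"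

definition h0 :: "(real \<Rightarrow> real) \<Rightarrow> real \<Rightarrow> real" where
  "h0 m x = x - pi0 m * (LINT y:{0..x}|lborel. m y)"


section \<open>Filtrations and martingales indexed by \<open>[0,\<infinity>)\<close>\<close>

definition process_sigma :: "'w set \<Rightarrow> (real \<Rightarrow> 'w \<Rightarrow> real) \<Rightarrow> real set \<Rightarrow> 'w measure" where
  "process_sigma \<Omega> X I = sigma \<Omega> {X s -` B \<inter> \<Omega> | s B. s \<in> I \<and> B \<in> sets borel}"

text \<open>\<open>\<F>\<^sub>t = \<F>\<^sup>0\<^sub>t\<^sub>+\<close>, not completed; for \<open>t < 0\<close> this is the trivial \<open>\<sigma>\<close>-algebra.\<close>

definition right_filtration :: "'w set \<Rightarrow> (real \<Rightarrow> 'w \<Rightarrow> real) \<Rightarrow> real \<Rightarrow> 'w measure" where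
  "right_filtration \<Omega> X t = sigma \<Omega> (\<Inter>s\<in>{t<..}. sets (process_sigma \<Omega> X {0..s}))"

definition adapted :: "(real \<Rightarrow> 'w measure) \<Rightarrow> (real \<Rightarrow> 'w \<Rightarrow> real) \<Rightarrow> bool" where
  "adapted F Y \<longleftrightarrow> (\<forall>t\<ge>0. Y t \<in> borel_measurable (F t))"

definition martingale ::
    "'w measure \<Rightarrow> (real \<Rightarrow> 'w measure) \<Rightarrow> (real \<Rightarrow> 'w \<Rightarrow> real) \<Rightarrow> bool" where
  "martingale Q F Y \<longleftrightarrow>
     adapted F Y \<and> (\<forall>t\<ge>0. integrable Q (Y t)) \<and>
     (\<forall>s t. 0 \<le> s \<and> s \<le> t \<longrightarrow> (AE \<omega> in Q. real_cond_exp Q (F s) (Y t) \<omega> = Y s \<omega>))"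

definition supermartingale ::
    "'w measure \<Rightarrow> (real \<Rightarrow> 'w measure) \<Rightarrow> (real \<Rightarrow> 'w \<Rightarrow> real) \<Rightarrow> bool" where
  "supermartingale Q F Y \<longleftrightarrow>
     adapted F Y \<and> (\<forall>t\<ge>0. integrable Q (Y t)) \<and>
     (\<forall>s t. 0 \<le> s \<and> s \<le> t \<longrightarrow> (AE \<omega> in Q. real_cond_exp Q (F s) (Y t) \<omega> \<le> Y s \<omega>))"


section \<open>The diffusion and its local time at the origin\<close>

definition hitting_time :: "(real \<Rightarrow> 'w \<Rightarrow> real) \<Rightarrow> real \<Rightarrow> 'w \<Rightarrow> ennreal" where
  "hitting_time X a \<omega> = (INF t\<in>{t. 0 \<le> t \<and> X t \<omega> = a}. ennreal t)"

text \<open>A diffusion on \<open>[0,\<infinity>)\<close>: a continuous strong Markov family \<open>(P\<^sub>x)\<close>, with shifts \<open>\<theta>\<^sub>t\<close>, on a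
  measurable space \<open>M\<close> that may carry further randomness. Because \<open>m\<close> is strictly increasing,
  the speed measure has full support and the paths are continuous. Stopping times are finite;
  the case of general ones follows by truncation.\<close>

locale diffusion_family =
  fixes M :: "'w measure" and P :: "real \<Rightarrow> 'w measure"
    and X :: "real \<Rightarrow> 'w \<Rightarrow> real" and \<theta> :: "real \<Rightarrow> 'w \<Rightarrow> 'w"
  assumes prob_space_P: "x \<ge> 0 \<Longrightarrow> prob_space (P x)"
    and sets_P: "x \<ge> 0 \<Longrightarrow> sets (P x) = sets M"
    and X_measurable: "t \<ge> 0 \<Longrightarrow> X t \<in> borel_measurable M"
    and X_nonneg: "t \<ge> 0 \<Longrightarrow> \<omega> \<in> space M \<Longrightarrow> X t \<omega> \<ge> 0"
    and X_continuous: "\<omega> \<in> space M \<Longrightarrow> continuous_on {0..} (\<lambda>t. X t \<omega>)"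
    and X_start: "x \<ge> 0 \<Longrightarrow> AE \<omega> in P x. X 0 \<omega> = x"
    and shift_space: "t \<ge> 0 \<Longrightarrow> \<omega> \<in> space M \<Longrightarrow> \<theta> t \<omega> \<in> space M"
    and shift: "s \<ge> 0 \<Longrightarrow> t \<ge> 0 \<Longrightarrow> \<omega> \<in> space M \<Longrightarrow> X s (\<theta> t \<omega>) = X (t + s) \<omega>"
    and P_kernel: "A \<in> sets (process_sigma (space M) X {0..}) \<Longrightarrow>
      (\<lambda>x. measure (P x) A) \<in> borel_measurable (restrict_space borel {0..})"
    and strong_Markov: "x \<ge> 0 \<Longrightarrow> stopping_time (right_filtration (space M) X) T \<Longrightarrow>
      (\<And>\<omega>. \<omega> \<in> space M \<Longrightarrow> T \<omega> \<ge> 0) \<Longrightarrow>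
      A \<in> sets (process_sigma (space M) X {0..}) \<Longrightarrow>
      AE \<omega> in P x.
        real_cond_exp (P x)
          (filtration.pre_sigma (space M) (right_filtration (space M) X) T)
          (\<lambda>\<omega>. indicator A (\<theta> (T \<omega>) \<omega>)) \<omega>
        = measure (P (X (T \<omega>) \<omega>)) A"

text \<open>Scale function \<open>s(x) = x\<close>, speed measure \<open>dm\<close>, and \<open>0\<close> regular-reflecting. The exit law from
  an interval defines the scale function and the mean exit times define the speed measure, with
  the Green kernel of \<open>d/dm d/dx\<close> normalized without a factor \<open>1/2\<close> (so \<open>m(x) = 2x\<close> is reflecting
  Brownian motion). The Green kernel \<open>b - max x y\<close> of \<open>[0,b)\<close> is that of the boundary condition
  \<open>u'(0+) = 0\<close>; as \<open>dm\<close> has no mass at \<open>0\<close>, the reflection is instantaneous.\<close>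

locale reflecting_diffusion = diffusion_family M P X \<theta>
  for M :: "'w measure" and P X \<theta> +
  fixes m :: "real \<Rightarrow> real"
  assumes scale: "0 \<le> a \<Longrightarrow> a < x \<Longrightarrow> x < b \<Longrightarrow>
      measure (P x) {\<omega> \<in> space M. hitting_time X b \<omega> < hitting_time X a \<omega>} = (x - a) / (b - a)"
    and speed: "0 \<le> a \<Longrightarrow> a < x \<Longrightarrow> x < b \<Longrightarrow>
      (\<integral>\<^sup>+\<omega>. min (hitting_time X a \<omega>) (hitting_time X b \<omega>) \<partial>P x) =
      (\<integral>\<^sup>+y\<in>{a<..<b}. ennreal ((min x y - a) * (b - max x y) / (b - a)) \<partial>half_line_measure m)"
    and reflecting: "0 \<le> x \<Longrightarrow> x < b \<Longrightarrow>
      (\<integral>\<^sup>+\<omega>. hitting_time X b \<omega> \<partial>P x) =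
      (\<integral>\<^sup>+y\<in>{0..<b}. ennreal (b - max x y) \<partial>half_line_measure m)"

text \<open>The continuous additive functional carried by the zero set of \<open>X\<close>, normalized by its
  \<open>q\<close>-potentials \<open>r q x 0\<close>. Since the filtration is not completed, path regularity is required
  on the whole space.\<close>

locale local_time_at_zero = diffusion_family M P X \<theta>
  for M :: "'w measure" and P X \<theta> +
  fixes r :: "real \<Rightarrow> real \<Rightarrow> real \<Rightarrow> real" and L :: "real \<Rightarrow> 'w \<Rightarrow> real"
  assumes L_adapted: "adapted (right_filtration (space M) X) L"
    and L_zero: "\<omega> \<in> space M \<Longrightarrow> L 0 \<omega> = 0"
    and L_mono: "\<omega> \<in> space M \<Longrightarrow> mono_on {0..} (\<lambda>t. L t \<omega>)"
    and L_continuous: "\<omega> \<in> space M \<Longrightarrow> continuous_on {0..} (\<lambda>t. L t \<omega>)"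
    and L_additive: "x \<ge> 0 \<Longrightarrow> s \<ge> 0 \<Longrightarrow> t \<ge> 0 \<Longrightarrow>
      AE \<omega> in P x. L (t + s) \<omega> = L t \<omega> + L s (\<theta> t \<omega>)"
    and L_support: "x \<ge> 0 \<Longrightarrow>
      AE \<omega> in P x. AE t in half_line_measure (\<lambda>t. L t \<omega>). X t \<omega> = 0"
    and L_potential: "x \<ge> 0 \<Longrightarrow> q > 0 \<Longrightarrow>
      (\<integral>\<^sup>+\<omega>. (\<integral>\<^sup>+t\<in>{0..}. ennreal (exp (- q * t)) \<partial>half_line_measure (\<lambda>t. L t \<omega>)) \<partial>P x) =
      ennreal (r q x 0)"


section \<open>The penalization processes\<close>

definition N_proc :: "(real \<Rightarrow> real) \<Rightarrow> (real \<Rightarrow> real) \<Rightarrow> (real \<Rightarrow> 'w \<Rightarrow> real) \<Rightarrow>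
    (real \<Rightarrow> 'w \<Rightarrow> real) \<Rightarrow> real \<Rightarrow> 'w \<Rightarrow> real" where
  "N_proc m f X L t \<omega> =
     h0 m (X t \<omega>) * f (L t \<omega>) + (LINT u:{0..}|lborel. f (L t \<omega> + u))"

definition M_proc :: "(real \<Rightarrow> real) \<Rightarrow> (real \<Rightarrow> real) \<Rightarrow> (real \<Rightarrow> 'w \<Rightarrow> real) \<Rightarrow>
    (real \<Rightarrow> 'w \<Rightarrow> real) \<Rightarrow> real \<Rightarrow> 'w \<Rightarrow> real" where
  "M_proc m f X L t \<omega> =
     N_proc m f X L t \<omega> + pi0 m * (LINT u:{0..t}|lborel. f (L u \<omega>))"

end

theory Submission
  imports Defs
begin

text \<open>Both limits come from one explicit formula. Put \<open>\<rho>\<^sub>q(y) = r\<^sub>q(y,0)\<close> and \<open>h\<^sub>q = H(q) - \<rho>\<^sub>q\<close>, and let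
  \<open>e\<^sub>q\<close> be an exponential time of rate \<open>q\<close> independent of \<open>X\<close>. Under \<open>P\<^sub>y\<close> the local time at \<open>e\<^sub>q\<close> has an
  atom of mass \<open>1 - \<rho>\<^sub>q(y)/H(q)\<close> at \<open>0\<close> and is otherwise exponential with mean \<open>H(q)\<close>
  (\<open>law_of_local_time_at_clock\<close>). Therefore
  \<open>H(q) P\<^sub>y[f(l + L(e\<^sub>q))] = h\<^sub>q(y) f(l) + (\<rho>\<^sub>q(y)/H(q)) \<integral> exp(-u/H(q)) f(l+u) du =: K\<^sub>q(y,l)\<close>,
  and as \<open>q\<close> decreases to \<open>0\<close> this tends to \<open>h\<^sub>0(y) f(l) + \<integral> f(l+u) du\<close>.

  The exponential time is memoryless, so the Markov property at \<open>t\<close> turns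
  \<open>H(q) P\<^sub>x[F\<^sub>t f(L(e\<^sub>q)); t < e\<^sub>q]\<close> into \<open>exp(-qt) P\<^sub>x[F\<^sub>t K\<^sub>q(X\<^sub>t,L\<^sub>t)]\<close>, which converges to \<open>P\<^sub>x[F\<^sub>t N\<^sub>t]\<close>
  by dominated convergence (\<open>limit_after\<close>). On \<open>e\<^sub>q \<le> t\<close> there remains
  \<open>q H(q) P\<^sub>x[F\<^sub>t \<integral>\<^sub>0\<^sup>t exp(-qu) f(L\<^sub>u) du]\<close>, and \<open>q H(q)\<close> tends to \<open>\<pi>\<^sub>0\<close>; adding the two parts gives the
  second limit (\<open>limit_at_clock\<close>). If \<open>A\<close> belongs to the \<open>\<sigma>\<close>-algebra of time \<open>s \<le> t\<close>, then
  \<open>H(q) P\<^sub>x[1\<^sub>A f(L(e\<^sub>q))]\<close> converges both to \<open>P\<^sub>x[1\<^sub>A M\<^sub>s]\<close> and to \<open>P\<^sub>x[1\<^sub>A M\<^sub>t]\<close>: \<open>M\<close> is a martingale, and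
  \<open>N\<close>, which is \<open>M\<close> minus an increasing process, is a supermartingale.

  The argument rests on three further ideas.

  \<^item> All the asymptotics in \<open>q\<close> follow from conservation of mass, \<open>q \<integral> \<rho>\<^sub>q dm = 1\<close>. In terms of the
    Krein-Feller equation, \<open>\<rho>\<^sub>q\<close> is a nonnegative solution whose slope at \<open>y\<close>, which is
    \<open>- 1 + q \<integral> \<rho>\<^sub>q dm\<close> over \<open>(0,y]\<close>, rises from \<open>-1\<close> to \<open>0\<close> (\<open>rho_slope_nonpos\<close>,
    \<open>rho_slope_tendsto_0\<close>). It gives the limits of \<open>H(q)\<close>, \<open>q H(q)\<close> and \<open>h\<^sub>q\<close>,
    and also the bound \<open>h\<^sub>q \<le> 2 h\<^sub>0\<close> for small \<open>q\<close> behind the domination (\<open>h_dominated\<close>).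

  \<^item> The law of \<open>L(e\<^sub>q)\<close> is found from its mean excess over a level \<open>u\<close>. When \<open>L\<close> passes \<open>u\<close>, the process
    \<open>X\<close> is at \<open>0\<close>, and the local time still to come has the same mean \<open>H(q)\<close> for every \<open>u\<close>:
    \<open>P\<^sub>y[(L(e\<^sub>q) - u)\<^sup>+] = H(q) P\<^sub>y[L(e\<^sub>q) > u]\<close> (\<open>excess_identity\<close>). This is a differential equation for
    the tail of the law (\<open>tail_eq_of_mean_excess\<close>). The passage time is random; its indicator is
    spread over a window of length \<open>1/n\<close>, the Markov property is applied at the fixed times of the
    window, and then \<open>n\<close> tends to infinity.

  \<^item> \<open>N\<^sub>t\<close> is integrable although \<open>f\<close> may be unbounded: Fatou's lemma bounds its mean by the limit
    of \<open>K\<^sub>q(x,0)\<close> (\<open>N0_integrable\<close>).\<close>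

section \<open>Stieltjes measures on the half-line\<close>

lemma half_line_extension:
  fixes g :: "real \<Rightarrow> real"
  assumes mono: "mono_on {0..} g" and rc: "\<And>x. x \<ge> 0 \<Longrightarrow> continuous (at_right x) g"
  shows half_line_extension_mono: "x \<le> y \<Longrightarrow> g (max 0 x) \<le> g (max 0 y)"
    and half_line_extension_right_cont: "continuous (at_right a) (\<lambda>x. g (max 0 x))"
proof -
  show "x \<le> y \<Longrightarrow> g (max 0 x) \<le> g (max 0 y)"
    using mono by (intro mono_onD[OF mono]) auto
  show "continuous (at_right a) (\<lambda>x. g (max 0 x))"
  proof (cases "a \<ge> 0")
    case True
    have "((\<lambda>x. g (max 0 x)) \<longlongrightarrow> g a) (at_right a)"
      using rc[OF True] unfolding continuous_within
      by (rule Lim_transform_eventually) (use True in \<open>auto simp: eventually_at_right_less eventually_at_filter\<close>)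
    then show ?thesis using True by (simp add: continuous_within)
  next
    case False
    have "eventually (\<lambda>x. x < 0) (at_right a)"
      using False by (intro eventually_at_rightI[of a 0]) auto
    then have "((\<lambda>x. g (max 0 x)) \<longlongrightarrow> g 0) (at_right a)"
      by (intro tendsto_eventually) (auto elim!: eventually_mono)
    then show ?thesis using False by (simp add: continuous_within)
  qed
qed

lemma sets_half_line_measure [simp, measurable_cong]: "sets (half_line_measure g) = sets borel"
  by (simp add: half_line_measure_def)

lemma space_half_line_measure [simp]: "space (half_line_measure g) = UNIV"
  by (simp add: half_line_measure_def)

lemma sigma_finite_half_line_measure:
  assumes "mono_on {0..} g" and "\<And>x. x \<ge> 0 \<Longrightarrow> continuous (at_right x) g"
  shows "sigma_finite_measure (half_line_measure g)"
  unfolding half_line_measure_def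
  by (intro sigma_finite_interval_measure half_line_extension_mono[OF assms] half_line_extension_right_cont[OF assms])

lemma emeasure_half_line_measure_Ioc:
  assumes "mono_on {0..} g" and "\<And>x. x \<ge> 0 \<Longrightarrow> continuous (at_right x) g"
    and "a \<le> b"
  shows "emeasure (half_line_measure g) {a<..b} = ennreal (g (max 0 b) - g (max 0 a))"
  unfolding half_line_measure_def
  by (intro emeasure_interval_measure_Ioc half_line_extension_mono[OF assms(1,2)] half_line_extension_right_cont[OF assms(1,2)] assms)

lemma set_integrable_const:
  fixes c :: real
  assumes "A \<in> sets N" "emeasure N A < \<infinity>"
  shows "set_integrable N A (\<lambda>_. c)"
  unfolding set_integrable_def using assms by (auto intro!: integrable_mult_left integrable_real_indicator)

lemma set_integrable_const_Icc:
  fixes c x y :: real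
  shows "set_integrable lborel {x..y} (\<lambda>_. c)"
  by (rule set_integrable_const) (auto simp: emeasure_lborel_Icc_eq)

section \<open>Solutions of the Krein-Feller equation\<close>

text \<open>The right derivative of a solution. The equation is used in the form that \<open>u\<close> is the integral of
  this function; \<open>u\<close> itself need not be differentiable where \<open>dm\<close> has an atom.\<close>

definition kf_slope :: "(real \<Rightarrow> real) \<Rightarrow> real \<Rightarrow> real \<Rightarrow> (real \<Rightarrow> real) \<Rightarrow> real \<Rightarrow> real" where
  "kf_slope m q b u y = b + q * (LINT z:{0<..y}|half_line_measure m. u z)"

locale speed_measure =
  fixes m :: "real \<Rightarrow> real"
  assumes m: "speed_function m"
begin

lemma m_mono: "mono_on {0..} m"
  using m by (auto simp: speed_function_def strict_mono_on_imp_mono_on)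

lemma m_le: "0 \<le> x \<Longrightarrow> x \<le> y \<Longrightarrow> m x \<le> m y"
  using m_mono by (auto simp: mono_on_def)

lemma m_less: "0 \<le> x \<Longrightarrow> x < y \<Longrightarrow> m x < m y"
  using m by (auto simp: speed_function_def strict_mono_on_def)

lemma m_rc: "x \<ge> 0 \<Longrightarrow> continuous (at_right x) m"
  using m by (auto simp: speed_function_def)

lemma m_0 [simp]: "m 0 = 0"
  using m by (auto simp: speed_function_def)

lemma m_nonneg: "0 \<le> x \<Longrightarrow> 0 \<le> m x"
  using m_le[of 0 x] by simp

lemma m_measurable: "(\<lambda>x. m (max 0 x)) \<in> borel_measurable borel"
  by (intro borel_measurable_mono monoI m_le) auto

lemma m_set_integrable: "0 \<le> x \<Longrightarrow> set_integrable lborel {0..x} m"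
  unfolding set_integrable_def
proof (rule Bochner_Integration.integrable_bound[where f = "\<lambda>y. m x * indicator {0..x} y"])
  assume "0 \<le> x"
  have "(\<lambda>y. indicator {0..x} y *\<^sub>R m y) = (\<lambda>y. indicator {0..x} y *\<^sub>R m (max 0 y))"
    by (auto simp: indicator_def)
  then show "(\<lambda>y. indicator {0..x} y *\<^sub>R m y) \<in> borel_measurable lborel"
    using m_measurable by simp
  show "AE y in lborel. norm (indicator {0..x} y *\<^sub>R m y) \<le> norm (m x * indicator {0..x} y)"
    using m_le[of _ x] m_nonneg by (auto simp: indicator_def)
qed (auto intro!: integrable_real_mult_indicator)

lemma m_finite:
  shows "emeasure (half_line_measure m) {x<..y} < \<infinity>"
  using emeasure_half_line_measure_Ioc[OF m_mono m_rc, of x y] by (cases "x \<le> y") auto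

lemma m_finite': "emeasure (half_line_measure m) {x<..y} \<noteq> \<top>"
  using m_finite[of x y] by auto

lemma const_integrable: "set_integrable (half_line_measure m) {x<..y} (\<lambda>_. c::real)"
  using m_finite by (intro set_integrable_const) auto

lemma measure_m: "0 \<le> x \<Longrightarrow> x \<le> y \<Longrightarrow> measure (half_line_measure m) {x<..y} = m y - m x"
  using emeasure_half_line_measure_Ioc[OF m_mono m_rc, of x y] m_le[of x y] by (simp add: measure_def)

end

locale krein_feller = speed_measure +
  fixes q a b :: real and u :: "real \<Rightarrow> real"
  assumes q: "q > 0" and sol: "krein_feller_solution m q a b u"
begin

abbreviation "\<mu> \<equiv> half_line_measure m"
abbreviation "slope \<equiv> kf_slope m q b u"

lemma cont: "continuous_on {0..} u"
  using sol by (simp add: krein_feller_solution_def)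

lemma u_measurable: "(\<lambda>x. u (max 0 x)) \<in> borel_measurable borel"
  by (intro borel_measurable_continuous_onI continuous_on_compose2[OF cont] continuous_intros) auto

lemma bounded: obtains K where "K \<ge> 0" "\<And>z. 0 \<le> z \<Longrightarrow> z \<le> x \<Longrightarrow> \<bar>u z\<bar> \<le> K"
proof -
  have "compact (u ` {0..x})"
    by (intro compact_continuous_image continuous_on_subset[OF cont]) auto
  then have "bounded (u ` {0..x})" by (rule compact_imp_bounded)
  then obtain K where "\<And>z. z \<in> {0..x} \<Longrightarrow> norm (u z) \<le> K" unfolding bounded_iff by blast
  then have "max 0 K \<ge> 0" "\<And>z. 0 \<le> z \<Longrightarrow> z \<le> x \<Longrightarrow> \<bar>u z\<bar> \<le> max 0 K"
    by (auto simp: le_max_iff_disj)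
  then show ?thesis by (rule that)
qed

lemma u_integrable: "0 \<le> x \<Longrightarrow> set_integrable \<mu> {x<..y} u"
proof -
  assume x: "0 \<le> x"
  obtain K where K: "K \<ge> 0" "\<And>z. 0 \<le> z \<Longrightarrow> z \<le> y \<Longrightarrow> \<bar>u z\<bar> \<le> K" using bounded[of y] by blast
  show ?thesis unfolding set_integrable_def
  proof (rule Bochner_Integration.integrable_bound[where f = "\<lambda>z. K * indicator {x<..y} z"])
    show "integrable \<mu> (\<lambda>z. K * indicator {x<..y} z)"
      using m_finite by (intro integrable_mult_right integrable_real_indicator) auto
    have "(\<lambda>z. indicator {x<..y} z *\<^sub>R u z) = (\<lambda>z. indicator {x<..y} z *\<^sub>R u (max 0 z))"
      using x by (auto simp: indicator_def)
    then show "(\<lambda>z. indicator {x<..y} z *\<^sub>R u z) \<in> borel_measurable \<mu>"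
      using u_measurable by simp
    show "AE z in \<mu>. norm (indicator {x<..y} z *\<^sub>R u z) \<le> norm (K * indicator {x<..y} z)"
      using x K by (auto simp: indicator_def)
  qed
qed

lemma slope_0: "slope 0 = b" by (simp add: kf_slope_def set_lebesgue_integral_def)

lemma slope_diff:
  assumes "0 \<le> x" "x \<le> y"
  shows "slope y = slope x + q * (LINT z:{x<..y}|\<mu>. u z)"
proof -
  have "(LINT z:{0<..x} \<union> {x<..y}|\<mu>. u z) = (LINT z:{0<..x}|\<mu>. u z) + (LINT z:{x<..y}|\<mu>. u z)"
    by (rule set_integral_Un) (use assms u_integrable in auto)
  moreover have "{0<..x} \<union> {x<..y} = {0<..y}" using assms by auto
  ultimately show ?thesis by (simp add: kf_slope_def algebra_simps)
qed

lemma slope_measurable: "(\<lambda>y. slope y) \<in> borel_measurable borel"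
proof -
  interpret sigma_finite_measure \<mu>
    by (rule sigma_finite_half_line_measure[OF m_mono m_rc])
  have [measurable]: "(\<lambda>x. u (max 0 x)) \<in> borel_measurable borel" by (rule u_measurable)
  have eq: "(LINT z:{0<..y}|\<mu>. u z) = (LINT z|\<mu>. (if 0 < z \<and> z \<le> y then u (max 0 z) else 0))" for y
    unfolding set_lebesgue_integral_def by (intro Bochner_Integration.integral_cong) (auto simp: indicator_def)
  have "(\<lambda>(y, z). (if 0 < z \<and> z \<le> y then u (max 0 z) else 0)) \<in> borel_measurable (borel \<Otimes>\<^sub>M \<mu>)"
    by measurable
  then have "(\<lambda>y. LINT z|\<mu>. (if 0 < z \<and> z \<le> y then u (max 0 z) else 0)) \<in> borel_measurable borel"
    by (rule borel_measurable_lebesgue_integral)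
  then show ?thesis unfolding kf_slope_def eq by simp
qed

lemma slope_bounded: assumes "0 \<le> x" obtains K where "\<And>y. 0 \<le> y \<Longrightarrow> y \<le> x \<Longrightarrow> \<bar>slope y\<bar> \<le> K"
proof -
  obtain K where K: "K \<ge> 0" "\<And>z. 0 \<le> z \<Longrightarrow> z \<le> x \<Longrightarrow> \<bar>u z\<bar> \<le> K" using bounded[of x] by blast
  have "\<bar>slope y\<bar> \<le> \<bar>b\<bar> + q * (K * m x)" if y: "0 \<le> y" "y \<le> x" for y
  proof -
    have "\<bar>LINT z:{0<..y}|\<mu>. u z\<bar> \<le> (LINT z:{0<..y}|\<mu>. K)"
      unfolding set_lebesgue_integral_def
    proof (rule order_trans[OF integral_abs_bound], rule integral_mono)
      show "integrable \<mu> (\<lambda>z. \<bar>indicator {0<..y} z *\<^sub>R u z\<bar>)"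
        using u_integrable[of 0 y] unfolding set_integrable_def by (intro integrable_abs) auto
      show "integrable \<mu> (\<lambda>z. indicator {0<..y} z *\<^sub>R K)"
        using const_integrable[of 0 y K] unfolding set_integrable_def .
    qed (use y K in \<open>auto simp: indicator_def\<close>)
    also have "\<dots> = K * m y" using measure_m[of 0 y] m_finite' y by (subst set_integral_const) auto
    also have "\<dots> \<le> K * m x" using y K m_le by (intro mult_left_mono) auto
    finally have "\<bar>q * (LINT z:{0<..y}|\<mu>. u z)\<bar> \<le> q * (K * m x)"
      using q by (simp add: abs_mult)
    then show ?thesis unfolding kf_slope_def by linarith
  qed
  then show ?thesis by (rule that)
qed

lemma slope_integrable: assumes "0 \<le> x" shows "set_integrable lborel {x..y} slope"
proof (cases "x \<le> y")
  case True
  obtain K where K: "\<And>z. 0 \<le> z \<Longrightarrow> z \<le> y \<Longrightarrow> \<bar>slope z\<bar> \<le> K"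
    using slope_bounded[of y] assms True by force
  show ?thesis unfolding set_integrable_def
  proof (rule Bochner_Integration.integrable_bound[where f = "\<lambda>z. K * indicator {x..y} z"])
    show "(\<lambda>z. indicator {x..y} z *\<^sub>R slope z) \<in> borel_measurable lborel"
      using slope_measurable by simp
    show "AE z in lborel. norm (indicator {x..y} z *\<^sub>R slope z) \<le> norm (K * indicator {x..y} z)"
    proof (rule AE_I2)
      fix z
      show "norm (indicator {x..y} z *\<^sub>R slope z) \<le> norm (K * indicator {x..y} z)"
        using assms K[of z] by (auto simp: indicator_def)
    qed
    show "integrable lborel (\<lambda>z. K * indicator {x..y} z)"
      using set_integrable_const_Icc[of x y K] by (simp add: set_integrable_def mult.commute)
  qed
qed (simp add: set_integrable_def)

lemma u_eq: assumes "0 \<le> x" shows "u x = a + (LINT y:{0..x}|lborel. slope y)"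
proof -
  have c: "set_integrable lborel {0..x} (\<lambda>_. b)"
    by (rule set_integrable_const_Icc)
  have i: "set_integrable lborel {0..x} (\<lambda>y. q * (LINT z:{0<..y}|\<mu>. u z))"
    using set_integral_diff(1)[OF slope_integrable[of 0 x] c] by (simp add: kf_slope_def)
  have "(LINT y:{0..x}|lborel. slope y) = (LINT y:{0..x}|lborel. b) + (LINT y:{0..x}|lborel. q * (LINT z:{0<..y}|\<mu>. u z))"
    unfolding kf_slope_def by (rule set_integral_add) (use i c in auto)
  also have "\<dots> = b * x + q * (LINT y:{0..x}|lborel. (LINT z:{0<..y}|\<mu>. u z))"
    using assms by (simp add: set_integral_const)
  finally show ?thesis using sol assms by (simp add: krein_feller_solution_def)
qed

lemma u_0: "u 0 = a"
proof -
  have "AE y in lborel. indicator {0..0::real} y *\<^sub>R slope y = 0"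
    using AE_lborel_singleton[of "0::real"] by eventually_elim auto
  then have "(LINT y:{0..0}|lborel. slope y) = 0"
    unfolding set_lebesgue_integral_def by (rule integral_eq_zero_AE)
  then show ?thesis using u_eq[of 0] by simp
qed

lemma u_diff:
  assumes "0 \<le> x" "x \<le> y"
  shows "u y = u x + (LINT z:{x..y}|lborel. slope z)"
proof -
  have "(LINT z:{0..x} \<union> {x<..y}|lborel. slope z) = (LINT z:{0..x}|lborel. slope z) + (LINT z:{x<..y}|lborel. slope z)"
    by (rule set_integral_Un)
      (use assms slope_integrable set_integrable_subset[OF slope_integrable[of x y], of "{x<..y}"] in \<open>auto simp: subset_eq\<close>)
  moreover have "{0..x} \<union> {x<..y} = {0..y}" using assms by auto
  moreover have "(LINT z:{x<..y}|lborel. slope z) = (LINT z:{x..y}|lborel. slope z)"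
    unfolding set_lebesgue_integral_def
    by (intro integral_cong_AE) (use slope_measurable AE_lborel_singleton[of x] in \<open>auto simp: indicator_def elim!: AE_mp\<close>)
  ultimately show ?thesis using u_eq[of x] u_eq[of y] assms by simp
qed

lemma growth_ge:
  assumes "0 \<le> x" "x \<le> y" and "\<And>z. x \<le> z \<Longrightarrow> z \<le> y \<Longrightarrow> d \<le> slope z"
  shows "u x + d * (y - x) \<le> u y"
proof -
  have "(LINT z:{x..y}|lborel. d) \<le> (LINT z:{x..y}|lborel. slope z)"
    by (rule set_integral_mono) (use assms slope_integrable in \<open>auto intro!: set_integrable_const_Icc\<close>)
  then show ?thesis using u_diff[OF assms(1,2)] assms by (simp add: set_integral_const mult.commute)
qed

lemma growth_le:
  assumes "0 \<le> x" "x \<le> y" and "\<And>z. x \<le> z \<Longrightarrow> z \<le> y \<Longrightarrow> slope z \<le> d"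
  shows "u y \<le> u x + d * (y - x)"
proof -
  have "(LINT z:{x..y}|lborel. slope z) \<le> (LINT z:{x..y}|lborel. d)"
    by (rule set_integral_mono) (use assms slope_integrable in \<open>auto intro!: set_integrable_const_Icc\<close>)
  then show ?thesis using u_diff[OF assms(1,2)] assms by (simp add: set_integral_const mult.commute)
qed

lemma slope_ge:
  assumes "0 \<le> x" "x \<le> y" and "\<And>z. x \<le> z \<Longrightarrow> z \<le> y \<Longrightarrow> d \<le> u z"
  shows "slope x + q * (d * (m y - m x)) \<le> slope y"
proof -
  have "(LINT z:{x<..y}|\<mu>. d) \<le> (LINT z:{x<..y}|\<mu>. u z)"
    by (rule set_integral_mono)
      (use assms u_integrable const_integrable in auto)
  moreover have "(LINT z:{x<..y}|\<mu>. d) = d * (m y - m x)"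
    using assms m_finite' by (subst set_integral_const) (auto simp: measure_m)
  ultimately show ?thesis using slope_diff[OF assms(1,2)] q by (simp add: mult_left_mono)
qed

lemma slope_le:
  assumes "0 \<le> x" "x \<le> y" and "\<And>z. x \<le> z \<Longrightarrow> z \<le> y \<Longrightarrow> u z \<le> d"
  shows "slope y \<le> slope x + q * (d * (m y - m x))"
proof -
  have "(LINT z:{x<..y}|\<mu>. u z) \<le> (LINT z:{x<..y}|\<mu>. d)"
    by (rule set_integral_mono)
      (use assms u_integrable const_integrable in auto)
  moreover have "(LINT z:{x<..y}|\<mu>. d) = d * (m y - m x)"
    using assms m_finite' by (subst set_integral_const) (auto simp: measure_m)
  ultimately show ?thesis using slope_diff[OF assms(1,2)] q by (simp add: mult_left_mono)
qed

text \<open>A negative minimum \<open>-k\<close> of \<open>u\<close> on \<open>[x,y]\<close> keeps the slope above \<open>- k q m(y)\<close>, so that \<open>u\<close> can fall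
  by at most \<open>k (y - x) q m(y)\<close>, which is less than \<open>k\<close> when the interval is short.\<close>

lemma nonneg_step:
  assumes "0 \<le> x" "x \<le> y" "u x \<ge> 0" "slope x \<ge> 0" and small: "(y - x) * (q * m y) < 1"
    and z: "x \<le> z" "z \<le> y"
  shows "u z \<ge> 0"
proof (rule ccontr)
  assume neg: "\<not> u z \<ge> 0"
  have "\<exists>w\<in>{x..y}. \<forall>v\<in>{x..y}. u w \<le> u v"
    by (rule continuous_attains_inf) (use assms in \<open>auto intro!: continuous_on_subset[OF cont]\<close>)
  then obtain w where w: "x \<le> w" "w \<le> y" "\<And>v. x \<le> v \<Longrightarrow> v \<le> y \<Longrightarrow> u w \<le> u v" by auto
  have uw: "u w < 0" using w(3)[of z] z neg by linarith
  have "u w * (q * m y) \<le> slope v" if v: "x \<le> v" "v \<le> w" for v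
  proof -
    have "slope x + q * (u w * (m v - m x)) \<le> slope v"
      by (rule slope_ge) (use v w assms in auto)
    moreover have "m v - m x \<le> m y" using m_le[of v y] m_nonneg[of x] assms v w by linarith
    then have "q * (u w * (m v - m x)) \<ge> q * (u w * m y)"
      using uw q by (intro mult_left_mono mult_left_mono_neg) auto
    ultimately show ?thesis using assms by (simp add: mult.left_commute)
  qed
  then have "u x + (u w * (q * m y)) * (w - x) \<le> u w"
    using w assms by (intro growth_ge) auto
  then have "u w * ((q * m y) * (w - x)) \<le> u w" using assms by (simp add: mult.assoc)
  then have "(q * m y) * (w - x) \<ge> 1" using uw by (simp add: mult_le_cancel_left1)
  moreover have "(q * m y) * (w - x) \<le> (q * m y) * (y - x)"
    using w q m_nonneg[of y] assms by (intro mult_left_mono) auto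
  ultimately show False using small by (simp add: mult.commute)
qed

text \<open>The maximum principle: to the right of a point where value and slope are nonnegative, \<open>u\<close> stays
  nonnegative, and hence increases with nondecreasing slope.\<close>

lemma nonneg:
  assumes x: "0 \<le> x" "u x \<ge> 0" "slope x \<ge> 0" and y: "x \<le> y"
  shows "u y \<ge> 0"
proof -
  \<comment> \<open>A step short enough for \<open>nonneg_step\<close> everywhere on \<open>[x,y]\<close>.\<close>
  define d where "d = 1 / (q * m y + 1)"
  have qm: "q * m y \<ge> 0" using q m_nonneg[of y] x y by simp
  have d: "d > 0" "d * (q * m y) < 1" using qm by (auto simp: d_def field_simps)
  have "\<forall>z. x \<le> z \<and> z \<le> y \<and> z \<le> x + real n * d \<longrightarrow> u z \<ge> 0" for n
  proof (induction n)
    case 0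
    then show ?case using x by (auto dest: antisym)
  next
    case (Suc n)
    define v where "v = min y (x + real n * d)"
    have v: "x \<le> v" "v \<le> y" using d y by (auto simp: v_def)
    have uv: "u z \<ge> 0" if "x \<le> z" "z \<le> v" for z using Suc.IH that by (auto simp: v_def)
    have sv: "slope v \<ge> 0" using slope_ge[of x v 0] x v uv by auto
    show ?case
    proof (intro allI impI)
      fix z assume z: "x \<le> z \<and> z \<le> y \<and> z \<le> x + real (Suc n) * d"
      show "u z \<ge> 0"
      proof (cases "z \<le> v")
        case False
        then have "z - v \<le> d" using z by (auto simp: v_def algebra_simps split: if_splits)
        moreover have "q * m z \<le> q * m y" using q m_le z x by (intro mult_left_mono) auto
        moreover have "q * m z \<ge> 0" using q m_nonneg z x by auto
        ultimately have "(z - v) * (q * m z) \<le> d * (q * m y)" using d(1) by (meson mult_mono less_imp_le)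
        then have "(z - v) * (q * m z) < 1" using d by linarith
        then show ?thesis using False v x uv[of v] sv by (intro nonneg_step[of v z z]) auto
      qed (use uv z in auto)
    qed
  qed
  moreover obtain n where "y \<le> x + real n * d"
    using reals_Archimedean3[OF d(1)] by (metis add.commute add_increasing2 diff_le_eq less_imp_le x(1) order.trans diff_add_cancel le_add_same_cancel2 add_left_mono)
  ultimately show ?thesis using y by blast
qed

lemma slope_mono:
  assumes x: "0 \<le> x" "u x \<ge> 0" "slope x \<ge> 0" and y: "x \<le> y" "y \<le> z"
  shows "slope y \<le> slope z"
  using slope_ge[of y z 0] nonneg[OF x] assms by auto

lemma increasing:
  assumes x: "0 \<le> x" "u x \<ge> 0" "slope x \<ge> 0" and y: "x \<le> y" "y \<le> z"
  shows "u y \<le> u z"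
proof -
  have "0 \<le> slope v" if "y \<le> v" for v
    using slope_mono[OF x, of x v] x y that by auto
  then show ?thesis using growth_ge[of y z 0] x y by simp
qed

end

lemma krein_feller_lincomb:
  assumes "krein_feller m q a b u" "krein_feller m q a' b' v"
  shows "krein_feller m q (c * a + d * a') (c * b + d * b') (\<lambda>x. c * u x + d * v x)"
    and "kf_slope m q (c * b + d * b') (\<lambda>x. c * u x + d * v x) y = c * kf_slope m q b u y + d * kf_slope m q b' v y"
proof -
  interpret u: krein_feller m q a b u by fact
  interpret v: krein_feller m q a' b' v by fact
  have *: "kf_slope m q (c * b + d * b') (\<lambda>x. c * u x + d * v x) y = c * kf_slope m q b u y + d * kf_slope m q b' v y" for y
    unfolding kf_slope_def
    by (subst set_integral_add) (use u.u_integrable[of 0] v.u_integrable[of 0] in \<open>auto simp: algebra_simps intro!: set_integrable_mult_right\<close>)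
  then show "kf_slope m q (c * b + d * b') (\<lambda>x. c * u x + d * v x) y = c * kf_slope m q b u y + d * kf_slope m q b' v y" .
  have "krein_feller_solution m q (c * a + d * a') (c * b + d * b') (\<lambda>x. c * u x + d * v x)"
    unfolding krein_feller_solution_def
  proof (intro conjI allI impI)
    show "continuous_on {0..} (\<lambda>x. c * u x + d * v x)"
      by (intro continuous_intros u.cont v.cont)
    fix x :: real assume x: "x \<ge> 0"
    let ?w = "\<lambda>x. c * u x + d * v x"
    have i: "set_integrable lborel {0..x} (kf_slope m q (c * b + d * b') ?w)"
      unfolding * by (intro set_integral_add set_integrable_mult_right) (use u.slope_integrable v.slope_integrable in auto)
    have "(LINT y:{0..x}|lborel. kf_slope m q (c * b + d * b') ?w y)
      = c * (LINT y:{0..x}|lborel. kf_slope m q b u y) + d * (LINT y:{0..x}|lborel. kf_slope m q b' v y)"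
      unfolding * by (subst set_integral_add) (use u.slope_integrable v.slope_integrable in \<open>auto intro!: set_integrable_mult_right\<close>)
    moreover have "(LINT y:{0..x}|lborel. kf_slope m q (c * b + d * b') ?w y)
       = (c * b + d * b') * x + (LINT y:{0..x}|lborel. kf_slope m q (c * b + d * b') ?w y - (c * b + d * b'))"
      by (subst set_integral_diff) (use i x set_integrable_const_Icc in \<open>auto simp: set_integral_const algebra_simps\<close>)
    moreover have "(LINT y:{0..x}|lborel. kf_slope m q (c * b + d * b') ?w y - (c * b + d * b'))
       = q * (LINT y:{0..x}|lborel. (LINT z:{0<..y}|half_line_measure m. ?w z))"
      by (simp add: kf_slope_def)
    ultimately show "?w x = c * a + d * a' + (c * b + d * b') * x
        + q * (LINT y:{0..x}|lborel. (LINT z:{0<..y}|half_line_measure m. ?w z))"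
      using u.u_eq[OF x] v.u_eq[OF x] by (simp add: algebra_simps)
  qed
  then show "krein_feller m q (c * a + d * a') (c * b + d * b') (\<lambda>x. c * u x + d * v x)"
    by unfold_locales (rule u.q)
qed


section \<open>The Weyl coefficient \<open>H\<close> and the potential of the local time\<close>

locale krein_feller_resolvent = speed_measure +
  fixes \<phi> \<psi> :: "real \<Rightarrow> real \<Rightarrow> real"
  assumes phi: "\<And>q. q > 0 \<Longrightarrow> krein_feller_solution m q 1 0 (\<phi> q)"
    and psi: "\<And>q. q > 0 \<Longrightarrow> krein_feller_solution m q 0 1 (\<psi> q)"
begin

lemma kf_phi: "q > 0 \<Longrightarrow> krein_feller m q 1 0 (\<phi> q)"
  using m phi by unfold_locales

lemma kf_psi: "q > 0 \<Longrightarrow> krein_feller m q 0 1 (\<psi> q)"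
  using m psi by unfold_locales

text \<open>The solution with value \<open>c\<close> and slope \<open>-1\<close> at \<open>0\<close>. It is written as a linear combination with
  coefficient \<open>- 1\<close> so that \<open>krein_feller_lincomb\<close> applies verbatim.\<close>

abbreviation "w q c x \<equiv> c * \<phi> q x + (- 1) * \<psi> q x"
abbreviation "ws q c \<equiv> kf_slope m q (-1) (w q c)"

lemma kf_w: "q > 0 \<Longrightarrow> krein_feller m q c (-1) (w q c)"
  using krein_feller_lincomb(1)[OF kf_phi kf_psi, of q c "-1"] by simp

lemma phi_0: "q > 0 \<Longrightarrow> \<phi> q 0 = 1" and psi_0: "q > 0 \<Longrightarrow> \<psi> q 0 = 0"
  using krein_feller.u_0[OF kf_phi] krein_feller.u_0[OF kf_psi] by auto

lemma phi_mono: "q > 0 \<Longrightarrow> 0 \<le> x \<Longrightarrow> x \<le> y \<Longrightarrow> \<phi> q x \<le> \<phi> q y"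
  using krein_feller.increasing[OF kf_phi, of q 0 x y] krein_feller.slope_0[OF kf_phi, of q] by (simp add: phi_0)

lemma psi_mono: "q > 0 \<Longrightarrow> 0 \<le> x \<Longrightarrow> x \<le> y \<Longrightarrow> \<psi> q x \<le> \<psi> q y"
  using krein_feller.increasing[OF kf_psi, of q 0 x y] krein_feller.slope_0[OF kf_psi, of q] by (simp add: psi_0)

lemma phi_ge_1: "q > 0 \<Longrightarrow> 0 \<le> x \<Longrightarrow> 1 \<le> \<phi> q x"
  using phi_mono[of q 0 x] by (simp add: phi_0)

lemma psi_ge: "q > 0 \<Longrightarrow> 0 \<le> x \<Longrightarrow> x \<le> \<psi> q x"
  using krein_feller.growth_ge[OF kf_psi, of q 0 x 1] krein_feller.slope_mono[OF kf_psi, of q 0 0] krein_feller.slope_0[OF kf_psi, of q]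
  by (simp add: psi_0)

text \<open>Suppose that the ratio is smaller at \<open>y\<close> than at \<open>x\<close> and let \<open>c\<close> be its value at \<open>y\<close>. Then
  \<open>c \<phi> - \<psi>\<close> is nonnegative at \<open>0\<close> and negative at \<open>x\<close>; it has a zero before \<open>x\<close>, with negative slope by
  the maximum principle. Applied to \<open>\<psi> - c \<phi>\<close> from this zero on, the same principle shows that the
  function cannot return to zero at \<open>y\<close>.\<close>

lemma ratio_mono:
  assumes q: "q > 0" and x: "0 \<le> x" "x \<le> y"
  shows "\<psi> q x / \<phi> q x \<le> \<psi> q y / \<phi> q y"
proof (rule ccontr)
  assume less: "\<not> \<psi> q x / \<phi> q x \<le> \<psi> q y / \<phi> q y"
  define c where "c = \<psi> q y / \<phi> q y"
  have c: "w q c y = 0" "c \<ge> 0"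
    using phi_ge_1[of q y] psi_ge[of q y] q x by (auto simp: c_def)
  have wx: "w q c x < 0"
    using less phi_ge_1[of q x] q x by (simp add: c_def field_simps)
  interpret w: krein_feller m q c "-1" "w q c" by (rule kf_w[OF q])
  have "\<exists>z\<ge>0. z \<le> x \<and> w q c z = 0"
  proof (rule IVT2')
    show "continuous_on {0..x} (w q c)" by (rule continuous_on_subset[OF w.cont]) auto
  qed (use wx x c w.u_0 in auto)
  then obtain z where z: "0 \<le> z" "z \<le> x" "w q c z = 0" by auto
  have neg: "ws q c z < 0"
    using w.nonneg[of z x] z wx by (cases "ws q c z < 0") auto
  interpret v: krein_feller m q "-c" 1 "\<lambda>x. (-1) * w q c x + 0 * w q c x"
    using krein_feller_lincomb(1)[OF w.krein_feller_axioms w.krein_feller_axioms, of "-1" 0] by simp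
  have vs: "v.slope y = - ws q c y" for y
    using krein_feller_lincomb(2)[OF w.krein_feller_axioms w.krein_feller_axioms, of "-1" 0] by simp
  show False
    using v.increasing[of z x y] vs[of z] neg z x wx c by simp
qed

text \<open>For large \<open>c\<close> the solution \<open>c \<phi> - \<psi>\<close> is still so large on \<open>[0,1]\<close> that the mass of \<open>dm\<close> there lifts
  its slope from \<open>-1\<close> to a nonnegative value at \<open>1\<close>; by the maximum principle it stays nonnegative.\<close>

lemma ratio_bounded:
  assumes q: "q > 0"
  obtains c where "\<And>x. 0 \<le> x \<Longrightarrow> \<psi> q x / \<phi> q x \<le> c"
proof -
  have m1: "m 1 > 0" using m_less[of 0 1] by simp
  \<comment> \<open>The second summand times \<open>q m(1)\<close> is the increase by \<open>1\<close> that the slope needs.\<close>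
  define c where "c = \<psi> q 1 + 1 / (q * m 1)"
  have c: "c \<ge> 0" "c \<ge> \<psi> q 1" using q m1 psi_ge[of q 1] by (auto simp: c_def)
  interpret w: krein_feller m q c "-1" "w q c" by (rule kf_w[OF q])
  have ge: "1 / (q * m 1) \<le> w q c z" if "0 \<le> z" "z \<le> 1" for z
  proof -
    have "c * 1 \<le> c * \<phi> q z" using phi_ge_1[OF q] that c by (intro mult_left_mono) auto
    then show ?thesis using psi_mono[OF q, of z 1] that by (simp add: c_def)
  qed
  have "ws q c 0 + q * (1 / (q * m 1) * (m 1 - m 0)) \<le> ws q c 1"
    by (rule w.slope_ge) (use ge in auto)
  then have "ws q c 1 \<ge> 0" using q m1 w.slope_0 by simp
  moreover have pos1: "w q c 1 \<ge> 0" by (rule order_trans[OF _ ge]) (use q m1 in auto)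
  ultimately have "w q c x \<ge> 0" if "x \<ge> 1" for x using w.nonneg[of 1 x] that by auto
  moreover have "w q c x \<ge> 0" if "0 \<le> x" "x \<le> 1" for x
    by (rule order_trans[OF _ ge]) (use q m1 that in auto)
  ultimately have w: "w q c x \<ge> 0" if "0 \<le> x" for x using that by (cases "x \<ge> 1") auto
  have "\<psi> q x / \<phi> q x \<le> c" if "0 \<le> x" for x
    using w[OF that] phi_ge_1[OF q that] by (simp add: field_simps)
  then show ?thesis by (rule that)
qed

abbreviation "H \<equiv> H_fun \<phi> \<psi>"

text \<open>The limit that defines \<open>H\<close> exists because the ratio is bounded and monotone; it is also the
  supremum of the ratio.\<close>

lemma Weyl_coefficient:
  assumes q: "q > 0"
  shows ratio_tendsto_H: "((\<lambda>x. \<psi> q x / \<phi> q x) \<longlongrightarrow> H q) at_top"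
    and ratio_le_H: "\<And>x. 0 \<le> x \<Longrightarrow> \<psi> q x / \<phi> q x \<le> H q"
    and H_pos: "H q > 0"
proof -
  let ?R = "\<lambda>x. \<psi> q (max 0 x) / \<phi> q (max 0 x)"
  obtain c where c: "\<And>x. 0 \<le> x \<Longrightarrow> \<psi> q x / \<phi> q x \<le> c" using ratio_bounded[OF q] by blast
  have mono: "mono ?R" by (intro monoI ratio_mono[OF q]) auto
  have bdd: "bdd_above (range ?R)" by (intro bdd_aboveI[of _ c]) (auto intro: c)
  have "((\<lambda>x. ?R x) \<longlongrightarrow> (SUP x. ?R x)) at_top"
  proof (rule order_tendstoI)
    fix l assume "l < (SUP x. ?R x)"
    then obtain x where "l < ?R x" using less_cSUP_iff[OF _ bdd] by auto
    then show "\<forall>\<^sub>F x in at_top. l < ?R x"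
      using mono by (intro eventually_mono[OF eventually_ge_at_top[of x]]) (auto dest: monoD intro: less_le_trans)
  next
    fix l assume l: "(SUP x. ?R x) < l"
    then show "\<forall>\<^sub>F x in at_top. ?R x < l"
      using cSUP_upper[OF _ bdd] by (intro always_eventually allI) (meson UNIV_I le_less_trans)
  qed
  moreover have "\<forall>\<^sub>F x in at_top. ?R x = \<psi> q x / \<phi> q x"
    by (intro eventually_mono[OF eventually_ge_at_top[of 0]]) auto
  ultimately have lim: "((\<lambda>x. \<psi> q x / \<phi> q x) \<longlongrightarrow> (SUP x. ?R x)) at_top"
    by (rule Lim_transform_eventually)
  then have eq: "H q = (SUP x. ?R x)"
    unfolding H_fun_def by (intro tendsto_Lim) auto
  show "((\<lambda>x. \<psi> q x / \<phi> q x) \<longlongrightarrow> H q) at_top" using lim eq by simp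
  show le: "\<psi> q x / \<phi> q x \<le> H q" if "0 \<le> x" for x
    using cSUP_upper[OF _ bdd, of x] that unfolding eq by (simp add: max_def)
  have "0 < \<psi> q 1 / \<phi> q 1" using psi_ge[OF q, of 1] phi_ge_1[OF q, of 1] by simp
  then show "H q > 0" using le[of 1] by simp
qed

text \<open>The function \<open>x \<mapsto> r\<^sub>q(x,0)\<close> and its slope.\<close>

abbreviation "\<rho> q \<equiv> w q (H q)"
abbreviation "\<rho>s q \<equiv> ws q (H q)"

lemma resolvent_density_eq: "q > 0 \<Longrightarrow> 0 \<le> x \<Longrightarrow> resolvent_density \<phi> \<psi> q x 0 = \<rho> q x"
  using H_pos[of q] by (simp add: resolvent_density_def phi_0 min_def max_def field_simps)

lemma rho_nonneg: "q > 0 \<Longrightarrow> 0 \<le> x \<Longrightarrow> 0 \<le> \<rho> q x"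
  using ratio_le_H[of q x] phi_ge_1[of q x] by (simp add: field_simps)

text \<open>If \<open>\<rho>\<close> had a positive slope somewhere, its value and its slope would both be positive one unit
  further on, and both would survive replacing \<open>H(q)\<close> by a slightly smaller \<open>c\<close>. By the maximum
  principle \<open>\<psi>/\<phi> \<le> c\<close> from there on, although the limit of \<open>\<psi>/\<phi>\<close> is \<open>H(q)\<close>.\<close>

lemma rho_slope_nonpos:
  assumes q: "q > 0" and x: "0 \<le> x"
  shows "\<rho>s q x \<le> 0"
proof (rule ccontr)
  assume d: "\<not> \<rho>s q x \<le> 0"
  interpret r: krein_feller m q "H q" "-1" "\<rho> q" by (rule kf_w[OF q])
  let ?y = "x + 1" let ?d = "\<rho>s q x"
  have d: "?d > 0" using d by simp
  have sl: "?d \<le> \<rho>s q z" if "x \<le> z" for z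
    using r.slope_mono[of x x z] d x that rho_nonneg[OF q x] by auto
  have "\<rho> q x + ?d * (?y - x) \<le> \<rho> q ?y" by (rule r.growth_ge) (use x sl in auto)
  then have ry: "?d \<le> \<rho> q ?y" using rho_nonneg[OF q x] by simp
  have ps: "kf_slope m q 0 (\<phi> q) ?y \<ge> 0"
    using krein_feller.slope_mono[OF kf_phi[OF q], of 0 0 ?y] krein_feller.slope_0[OF kf_phi[OF q]] x phi_0[OF q] by auto
  define k where "k = \<phi> q ?y + kf_slope m q 0 (\<phi> q) ?y"
  have k: "k > 0" "\<phi> q ?y \<le> k" "kf_slope m q 0 (\<phi> q) ?y \<le> k" using ps phi_ge_1[OF q, of ?y] x by (auto simp: k_def)
  \<comment> \<open>\<open>k\<close> bounds the value and the slope of \<open>\<phi>\<close> at \<open>?y\<close>, so \<open>\<rho>\<close> and its slope lose at most \<open>?d\<close> there.\<close>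
  define c where "c = H q - ?d / k"
  have ws: "ws q c z = c * kf_slope m q 0 (\<phi> q) z - kf_slope m q 1 (\<psi> q) z" for c z
    using krein_feller_lincomb(2)[OF kf_phi[OF q] kf_psi[OF q], of c "-1"] by simp
  interpret w: krein_feller m q c "-1" "w q c" by (rule kf_w[OF q])
  have "(?d / k) * \<phi> q ?y \<le> (?d / k) * k" by (rule mult_left_mono) (use d k in auto)
  then have wy: "w q c ?y \<ge> 0" using ry k by (simp add: c_def algebra_simps) have "(?d / k) * kf_slope m q 0 (\<phi> q) ?y \<le> (?d / k) * k" by (rule mult_left_mono) (use d k in auto)
  moreover have "ws q c ?y = \<rho>s q ?y - ?d / k * kf_slope m q 0 (\<phi> q) ?y"
  proof -
    obtain D where D: "D = ?d" by simp
    show ?thesis unfolding D[symmetric] ws c_def by (simp add: algebra_simps)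
  qed
  ultimately have "ws q c ?y \<ge> 0" using sl[of ?y] k by simp
  then have nn: "w q c z \<ge> 0" if "z \<ge> ?y" for z
    using w.nonneg[of ?y z] wy that x by auto
  have "\<psi> q z / \<phi> q z \<le> c" if "z \<ge> ?y" for z
    using nn[OF that] phi_ge_1[OF q, of z] x that by (simp add: field_simps)
  then have "H q \<le> c"
    by (intro tendsto_upperbound[OF ratio_tendsto_H[OF q]] eventually_mono[OF eventually_ge_at_top[of ?y]]) auto
  moreover have "?d / k > 0" using d k by simp
  ultimately show False by (simp add: c_def)
qed

lemma rho_slope_mono: "q > 0 \<Longrightarrow> 0 \<le> x \<Longrightarrow> x \<le> y \<Longrightarrow> \<rho>s q x \<le> \<rho>s q y"
  using krein_feller.slope_ge[OF kf_w, of q x y 0 "H q"] rho_nonneg[of q] by auto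

lemma rho_0: "q > 0 \<Longrightarrow> \<rho> q 0 = H q"
  by (simp add: phi_0 psi_0)

lemma rho_slope_ge: "q > 0 \<Longrightarrow> 0 \<le> x \<Longrightarrow> -1 \<le> \<rho>s q x"
  using rho_slope_mono[of q 0 x] krein_feller.slope_0[OF kf_w, of q "H q"] by simp

lemma rho_antimono: "q > 0 \<Longrightarrow> 0 \<le> x \<Longrightarrow> x \<le> y \<Longrightarrow> \<rho> q y \<le> \<rho> q x"
  using krein_feller.growth_le[OF kf_w, of q x y "H q" 0] rho_slope_nonpos[of q] by simp

lemma rho_le_H: "q > 0 \<Longrightarrow> 0 \<le> x \<Longrightarrow> \<rho> q x \<le> H q"
  using rho_antimono[of q 0 x] rho_0 by simp

lemma rho_ge: "q > 0 \<Longrightarrow> 0 \<le> x \<Longrightarrow> H q - x \<le> \<rho> q x"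
  using krein_feller.growth_ge[OF kf_w, of q 0 x "-1" "H q"] rho_slope_ge[of q] rho_0 by simp

lemma rho_slope_lower: "q > 0 \<Longrightarrow> 0 \<le> y \<Longrightarrow> - 1 + q * ((H q - y) * m y) \<le> \<rho>s q y"
proof -
  assume q: "q > 0" and y: "0 \<le> y"
  have "H q - y \<le> \<rho> q z" if "0 \<le> z" "z \<le> y" for z using rho_ge[OF q that(1)] that by linarith
  then show ?thesis
    using krein_feller.slope_ge[OF kf_w[OF q], of 0 y "H q - y" "H q"] krein_feller.slope_0[OF kf_w[OF q], of "H q"] y by simp
qed

lemma rho_slope_upper: "q > 0 \<Longrightarrow> 0 \<le> y \<Longrightarrow> y \<le> z \<Longrightarrow> \<rho>s q z \<le> \<rho>s q y + q * (H q * (m z - m y))"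
  using krein_feller.slope_le[OF kf_w, of q y z "H q" "H q"] rho_le_H[of q] by auto

text \<open>The slope of \<open>\<rho>\<close> at \<open>y\<close> is \<open>- 1 + q \<integral> \<rho> dm\<close> over \<open>(0,y]\<close>, so this is conservation of mass,
  \<open>q \<integral> \<rho> dm = 1\<close>. If it failed, \<open>\<rho>\<close> would fall at a fixed rate and become negative.\<close>

lemma rho_slope_tendsto_0:
  assumes q: "q > 0" and e: "e > 0"
  obtains y where "0 \<le> y" "- e < \<rho>s q y"
proof -
  have "\<exists>y\<ge>0. - e < \<rho>s q y"
  proof (rule ccontr)
    assume "\<not> ?thesis"
    then have le: "\<rho>s q y \<le> - e" if "y \<ge> 0" for y using that by force
    define x where "x = (H q + 1) / e"
    have x: "x \<ge> 0" using H_pos[OF q] e by (simp add: x_def)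
    have "\<rho> q x \<le> \<rho> q 0 + (- e) * (x - 0)"
      by (rule krein_feller.growth_le[OF kf_w[OF q]]) (use x le in auto)
    moreover have "e * x = H q + 1" using e by (simp add: x_def)
    ultimately show False using rho_nonneg[OF q x] rho_0[OF q] by simp
  qed
  then show ?thesis using that by blast
qed

text \<open>From \<open>0 \<le> \<rho>(x)\<close>, with the slope bounded by \<open>\<rho> \<le> H(q)\<close>. The bound tends to \<open>x\<close> as \<open>q\<close> tends to \<open>0\<close>,
  and \<open>x\<close> is arbitrary.\<close>

lemma H_lower:
  assumes q: "q > 0" and x: "0 \<le> x" shows "x \<le> H q * (1 + q * (m x * x))"
proof -
  have "\<rho> q x \<le> \<rho> q 0 + (-1 + q * (H q * m x)) * (x - 0)"
  proof (rule krein_feller.growth_le[OF kf_w[OF q]])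
    fix z assume z: "0 \<le> z" "z \<le> x"
    have "q * (H q * (m z - m 0)) \<le> q * (H q * m x)"
      using m_le[of z x] z q H_pos[OF q] by (intro mult_left_mono) auto
    then show "\<rho>s q z \<le> - 1 + q * (H q * m x)"
      using rho_slope_upper[OF q _ z(1)] krein_feller.slope_0[OF kf_w[OF q], of "H q"] by force
  qed (use x in auto)
  then show ?thesis using rho_nonneg[OF q x] rho_0[OF q] by (simp add: algebra_simps)
qed

lemma H_at_top: "filterlim H at_top (at_right 0)"
  unfolding filterlim_at_top
proof
  fix Z :: real
  define x where "x = 2 * max Z 1"
  have x: "x > 0" "Z \<le> x / 2" by (auto simp: x_def)
  have "((\<lambda>q. 1 + q * (m x * x)) \<longlongrightarrow> 1 + 0 * (m x * x)) (at_right 0)"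
    by (intro tendsto_intros)
  then have "\<forall>\<^sub>F q in at_right 0. 1 + q * (m x * x) < 2"
    by (auto dest!: order_tendstoD(2)[of _ _ _ 2])
  moreover note eventually_at_right_less[of "0::real"]
  ultimately show "\<forall>\<^sub>F q in at_right 0. Z \<le> H q"
  proof eventually_elim
    case (elim q)
    have "x \<le> H q * (1 + q * (m x * x))" by (rule H_lower) (use elim x in auto)
    also have "\<dots> \<le> H q * 2" using elim H_pos[of q] by (intro mult_left_mono) auto
    finally show ?case using x by simp
  qed
qed

subsection \<open>The limit of \<open>q H(q)\<close>\<close>

abbreviation "p0 \<equiv> pi0 m"

text \<open>Inequalities between reals that express \<open>\<pi>\<^sub>0 = 1 / m(\<infinity>)\<close> and cover the case \<open>m(\<infinity>) = \<infinity>\<close>.\<close>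

lemma pi0_cases:
  shows pi0_nonneg: "0 \<le> p0"
    and pi0_le: "\<And>y. 0 < y \<Longrightarrow> p0 * m y \<le> 1"
    and pi0_gt: "\<And>c. p0 < c \<Longrightarrow> \<exists>y>0. 1 / m y < c"
proof -
  let ?m = "\<lambda>x. ereal (m (max 0 x))"
  have "(?m \<longlongrightarrow> (SUP x. ?m x)) at_top"
  proof (rule order_tendstoI)
    fix l assume "l < (SUP x. ?m x)"
    then obtain x where "l < ?m x" by (auto simp: less_SUP_iff)
    then show "\<forall>\<^sub>F x in at_top. l < ?m x"
    proof (intro eventually_mono[OF eventually_ge_at_top[of x]])
      fix z assume "l < ?m x" "x \<le> z"
      then show "l < ?m z" using m_le[of "max 0 x" "max 0 z"] by (auto elim!: less_le_trans)
    qed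
  next
    fix l assume "(SUP x. ?m x) < l"
    then show "\<forall>\<^sub>F x in at_top. ?m x < l"
      by (intro always_eventually allI) (meson SUP_upper UNIV_I le_less_trans)
  qed
  moreover have "\<forall>\<^sub>F x in at_top. ?m x = ereal (m x)"
    by (intro eventually_mono[OF eventually_ge_at_top[of 0]]) auto
  ultimately have lim: "((\<lambda>x. ereal (m x)) \<longlongrightarrow> (SUP x. ?m x)) at_top"
    by (rule Lim_transform_eventually)
  then have L: "Lim at_top (\<lambda>x. ereal (m x)) = (SUP x. ?m x)" by (intro tendsto_Lim) auto
  define s where "s = (SUP x. ?m x)"
  have p: "p0 = real_of_ereal (1 / s)" by (simp add: pi0_def L s_def)
  have up: "ereal (m y) \<le> s" if "0 \<le> y" for y
    unfolding s_def using that by (intro SUP_upper2[of y]) auto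
  have m1: "0 < m 1" using m_less[of 0 1] by simp
  then have s0: "0 < s" using up[of 1] by (auto elim: less_le_trans[rotated])
  have ex: "\<exists>y>0. c < m y" if c: "ereal c < s" for c
  proof -
    obtain x where "c < m (max 0 x)" using c unfolding s_def less_SUP_iff by auto
    moreover have "m (max 0 x) \<le> m (max 1 x)" by (rule m_le) auto
    ultimately have "c < m (max 1 x)" by linarith
    then show ?thesis by (intro exI[of _ "max 1 x"]) auto
  qed
  show "0 \<le> p0" using s0 by (cases s) (auto simp: p divide_ereal_def)
  show "p0 * m y \<le> 1" if "0 < y" for y
    using up[of y] that s0 by (cases s) (auto simp: p divide_ereal_def field_simps)
  show "\<exists>y>0. 1 / m y < c" if "p0 < c" for c
  proof -
    have c: "c > 0" using that \<open>0 \<le> p0\<close> by simp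
    have "ereal (1 / c) < s"
      using that c s0 by (cases s) (auto simp: p divide_ereal_def field_simps)
    then obtain y where "y > 0" "1 / c < m y" using ex by blast
    then show ?thesis using c m_less[of 0 y] by (intro exI[of _ y]) (auto simp: field_simps)
  qed
qed

text \<open>The mass \<open>q \<integral> \<rho> dm\<close> over \<open>(0,y]\<close> is at most \<open>1\<close>, and \<open>\<rho> \<ge> H(q) - y\<close> there.\<close>

lemma qH_upper:
  assumes q: "q > 0" and y: "y > 0" shows "q * H q \<le> 1 / m y + q * y"
proof -
  have my: "m y > 0" using m_less[of 0 y] y by simp
  have "q * ((H q - y) * m y) \<le> 1"
    using rho_slope_lower[OF q, of y] rho_slope_nonpos[OF q, of y] y by simp
  then have "(q * H q - q * y) * m y \<le> 1" by (simp add: algebra_simps)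
  then have "q * H q - q * y \<le> 1 / m y" using my by (simp add: pos_le_divide_eq)
  then show ?thesis by simp
qed

text \<open>The total mass \<open>q \<integral> \<rho> dm = 1\<close> is at most \<open>q H(q) m(\<infinity>)\<close>.\<close>

lemma qH_lower:
  assumes q: "q > 0" shows "p0 \<le> q * H q"
proof (cases "p0 = 0")
  case True then show ?thesis using q H_pos[OF q] by simp
next
  case False
  then have p: "p0 > 0" using pi0_nonneg by simp
  show ?thesis
  proof (rule field_le_epsilon)
    fix e :: real assume e: "e > 0"
    have "e / (p0 + 1) > 0" using e p by simp
    then obtain y where y: "0 \<le> y" "- (e / (p0 + 1)) < \<rho>s q y" using rho_slope_tendsto_0[OF q] by blast
    have "\<rho>s q (y + 1) \<le> -1 + q * (H q * m (y + 1))"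
      using rho_slope_upper[OF q, of 0 "y+1"] krein_feller.slope_0[OF kf_w[OF q], of "H q"] y by simp
    then have "1 - e / (p0 + 1) \<le> q * H q * m (y + 1)"
      using y rho_slope_mono[OF q, of y "y+1"] by (simp add: algebra_simps)
    then have "p0 * (1 - e / (p0 + 1)) \<le> p0 * (q * H q * m (y + 1))" using p by (intro mult_left_mono) auto
    also have "\<dots> = q * H q * (p0 * m (y + 1))" by simp
    also have "\<dots> \<le> q * H q * 1" using pi0_le[of "y+1"] y q H_pos[OF q] by (intro mult_left_mono) auto
    finally have "p0 - p0 * (e / (p0 + 1)) \<le> q * H q" by (simp add: algebra_simps)
    moreover have "p0 * (e / (p0 + 1)) \<le> e" using p e by (simp add: field_simps)
    ultimately show "p0 \<le> q * H q + e" by linarith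
  qed
qed

lemma qH_tendsto: "((\<lambda>q. q * H q) \<longlongrightarrow> p0) (at_right 0)"
proof (rule order_tendstoI)
  fix l assume "l < p0"
  then show "\<forall>\<^sub>F q in at_right 0. l < q * H q"
    using eventually_at_right_less[of "0::real"] by (auto elim!: eventually_mono intro: less_le_trans[OF _ qH_lower])
next
  fix l assume "p0 < l"
  then obtain y where y: "y > 0" "1 / m y < l" using pi0_gt by blast
  have "((\<lambda>q. 1 / m y + q * y) \<longlongrightarrow> 1 / m y + 0 * y) (at_right 0)" by (intro tendsto_intros)
  then have "\<forall>\<^sub>F q in at_right 0. 1 / m y + q * y < l"
    using y by (auto dest!: order_tendstoD(2)[of _ _ _ l])
  then show "\<forall>\<^sub>F q in at_right 0. q * H q < l"
    using eventually_at_right_less[of "0::real"] by eventually_elim (use y in \<open>auto intro: le_less_trans[OF qH_upper]\<close>)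
qed

subsection \<open>Convergence to \<open>h0\<close>\<close>

abbreviation "h q x \<equiv> H q - \<rho> q x"

lemma h_eq: "q > 0 \<Longrightarrow> 0 \<le> x \<Longrightarrow> h q x = (LINT y:{0..x}|lborel. - \<rho>s q y)"
  using krein_feller.u_eq[OF kf_w, of q x "H q"] by (simp add: set_lebesgue_integral_def)

lemma h_le: "q > 0 \<Longrightarrow> 0 \<le> x \<Longrightarrow> h q x \<le> x" and h_nonneg: "q > 0 \<Longrightarrow> 0 \<le> x \<Longrightarrow> 0 \<le> h q x"
  using rho_ge[of q x] rho_le_H[of q x] by simp_all

abbreviation "I x \<equiv> (LINT y:{0..x}|lborel. m y)"

text \<open>In the slope \<open>- 1 + q \<integral> \<rho> dm\<close> the integrand lies between \<open>H(q) - x\<close> and \<open>H(q)\<close>.\<close>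

lemma h_bounds:
  assumes q: "q > 0" and x: "0 \<le> x"
  shows "x - q * H q * I x \<le> h q x" "h q x \<le> x - q * (H q - x) * I x"
proof -
  interpret r: krein_feller m q "H q" "-1" "\<rho> q" by (rule kf_w[OF q])
  have ir: "set_integrable lborel {0..x} (\<lambda>y. - \<rho>s q y)"
    using r.slope_integrable[of 0 x] by (simp add: set_integrable_def)
  have e: "set_integrable lborel {0..x} (\<lambda>y. 1 - c * m y)" "(LINT y:{0..x}|lborel. 1 - c * m y) = x - c * I x" for c
    using x set_integral_diff[OF set_integrable_const_Icc[of 0 x 1] set_integrable_mult_right[of c, OF m_set_integrable[OF x]]]
    by (auto simp: set_integral_const)
  have "(LINT y:{0..x}|lborel. 1 - (q * H q) * m y) \<le> (LINT y:{0..x}|lborel. - \<rho>s q y)"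
    by (rule set_integral_mono[OF e(1) ir])
      (use rho_slope_upper[OF q, of 0] r.slope_0 in \<open>force simp: algebra_simps\<close>)
  then show "x - q * H q * I x \<le> h q x" using h_eq[OF q x] e by simp
  have "(LINT y:{0..x}|lborel. - \<rho>s q y) \<le> (LINT y:{0..x}|lborel. 1 - (q * (H q - x)) * m y)"
  proof (rule set_integral_mono[OF ir e(1)])
    fix y assume y: "y \<in> {0..x}"
    have "q * ((H q - x) * m y) \<le> q * ((H q - y) * m y)"
      using y m_nonneg[of y] q by (intro mult_left_mono mult_right_mono) auto
    then show "- \<rho>s q y \<le> 1 - (q * (H q - x)) * m y"
      using rho_slope_lower[OF q, of y] y by (simp add: algebra_simps)
  qed
  then show "h q x \<le> x - q * (H q - x) * I x" using h_eq[OF q x] e by simp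
qed

lemma h_tendsto:
  assumes x: "0 \<le> x"
  shows "((\<lambda>q. h q x) \<longlongrightarrow> h0 m x) (at_right 0)"
proof (rule tendsto_sandwich)
  show "\<forall>\<^sub>F q in at_right 0. x - q * H q * I x \<le> h q x"
    using eventually_at_right_less[of "0::real"] by eventually_elim (use h_bounds x in auto)
  show "\<forall>\<^sub>F q in at_right 0. h q x \<le> x - q * (H q - x) * I x"
    using eventually_at_right_less[of "0::real"] by eventually_elim (use h_bounds x in auto)
  show "((\<lambda>q. x - q * H q * I x) \<longlongrightarrow> h0 m x) (at_right 0)"
    unfolding h0_def by (intro tendsto_intros qH_tendsto)
  have "((\<lambda>q. x - (q * H q - q * x) * I x) \<longlongrightarrow> x - (p0 - 0 * x) * I x) (at_right 0)"
    by (intro tendsto_intros qH_tendsto)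
  then show "((\<lambda>q. x - q * (H q - x) * I x) \<longlongrightarrow> h0 m x) (at_right 0)"
    by (simp add: h0_def algebra_simps)
qed

lemma h0_nonneg: "0 \<le> x \<Longrightarrow> 0 \<le> h0 m x"
proof (rule tendsto_lowerbound[OF h_tendsto])
  assume x: "0 \<le> x"
  from eventually_at_right_less[of "0::real"] show "\<forall>\<^sub>F q in at_right 0. 0 \<le> h q x" by eventually_elim (use h_nonneg x in auto)
qed auto

text \<open>If \<open>\<pi>\<^sub>0 = 0\<close>, then \<open>h\<^sub>0(x) = x\<close>, and \<open>h\<^sub>q(x) \<le> x\<close> because the slope of \<open>\<rho>\<close> is at least \<open>-1\<close>. If
  \<open>\<pi>\<^sub>0 > 0\<close>, conservation of mass makes minus the slope at \<open>y\<close> equal to \<open>q \<integral> \<rho> dm\<close> over \<open>(y,\<infinity>)\<close>, which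
  is at most \<open>q H(q) (m(\<infinity>) - m(y))\<close>; here \<open>q H(q) < 2 \<pi>\<^sub>0\<close> for small \<open>q\<close>, and the integral of
  \<open>2 \<pi>\<^sub>0 (m(\<infinity>) - m(y))\<close> over \<open>[0,x]\<close> is \<open>2 h\<^sub>0(x)\<close>.\<close>

lemma h_dominated: "\<forall>\<^sub>F q in at_right 0. \<forall>x\<ge>0. h q x \<le> 2 * h0 m x"
proof (cases "p0 = 0")
  case True
  show ?thesis
    using eventually_at_right_less[of "0::real"]
  proof eventually_elim
    case (elim q)
    then show ?case using True h_le[OF elim] by (force simp: h0_def)
  qed
next
  case False
  then have p: "p0 > 0" using pi0_nonneg by simp
  have "\<forall>\<^sub>F q in at_right 0. q * H q < 2 * p0"
    using qH_tendsto p by (intro order_tendstoD(2)[of _ p0]) auto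
  then show ?thesis using eventually_at_right_less[of "0::real"]
  proof eventually_elim
    case (elim q)
    note q = elim(2)
    interpret r: krein_feller m q "H q" "-1" "\<rho> q" by (rule kf_w[OF q])
    have key: "- \<rho>s q y \<le> 2 - (2 * p0) * m y" if y: "0 \<le> y" for y
    proof (rule field_le_epsilon)
      fix e :: real assume e: "e > 0"
      obtain z where z: "0 \<le> z" "- e < \<rho>s q z" using rho_slope_tendsto_0[OF q e] by blast
      define v where "v = y + z + 1"
      have v: "0 < v" "y \<le> v" "z \<le> v" using y z by (auto simp: v_def)
      have "- e < \<rho>s q v" using rho_slope_mono[OF q z(1) v(3)] z by simp
      also have "\<rho>s q v \<le> \<rho>s q y + q * (H q * (m v - m y))" by (rule rho_slope_upper) (use q y v in auto)
      also have "q * (H q * (m v - m y)) \<le> (2 * p0) * (m v - m y)"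
        using elim m_le[OF y v(2)] by (simp add: mult_right_mono flip: mult.assoc)
      also have "\<dots> \<le> 2 - (2 * p0) * m y" using pi0_le[OF v(1)] by (simp add: algebra_simps)
      finally show "- \<rho>s q y \<le> 2 - (2 * p0) * m y + e" by simp
    qed
    show ?case
    proof (intro allI impI)
      fix x :: real assume x: "x \<ge> 0"
      have ir: "set_integrable lborel {0..x} (\<lambda>y. - \<rho>s q y)"
        using r.slope_integrable[of 0 x] by (simp add: set_integrable_def)
      have e: "set_integrable lborel {0..x} (\<lambda>y. 2 - (2 * p0) * m y)"
           "(LINT y:{0..x}|lborel. 2 - (2 * p0) * m y) = 2 * x - (2 * p0) * I x"
        using x set_integral_diff[OF set_integrable_const_Icc[of 0 x 2] set_integrable_mult_right[of "2 * p0", OF m_set_integrable[OF x]]]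
        by (auto simp: set_integral_const)
      have "h q x \<le> 2 * x - (2 * p0) * I x"
        unfolding h_eq[OF q x] e(2)[symmetric] by (rule set_integral_mono[OF ir e(1)]) (use key in auto)
      then show "h q x \<le> 2 * h0 m x" by (simp add: h0_def algebra_simps)
    qed
  qed
qed

lemma rho_ratio_tendsto:
  assumes x: "0 \<le> x" shows "((\<lambda>q. \<rho> q x / H q) \<longlongrightarrow> 1) (at_right 0)"
proof (rule tendsto_sandwich)
  show "\<forall>\<^sub>F q in at_right 0. 1 - x * inverse (H q) \<le> \<rho> q x / H q"
    using eventually_at_right_less[of "0::real"]
  proof eventually_elim
    case (elim q)
    have "(H q - x) / H q \<le> \<rho> q x / H q"
      using rho_ge[OF elim x] H_pos[OF elim] by (intro divide_right_mono) auto
    moreover have "(H q - x) / H q = 1 - x * inverse (H q)" using H_pos[OF elim] by (simp add: field_simps)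
    ultimately show ?case by simp
  qed
  show "\<forall>\<^sub>F q in at_right 0. \<rho> q x / H q \<le> 1"
    using eventually_at_right_less[of "0::real"] by eventually_elim (use rho_le_H x H_pos in \<open>auto simp: field_simps\<close>)
  have "((\<lambda>q. 1 - x * inverse (H q)) \<longlongrightarrow> 1 - x * 0) (at_right 0)"
    by (intro tendsto_diff tendsto_mult tendsto_const tendsto_inverse_0_at_top H_at_top)
  then show "((\<lambda>q. 1 - x * inverse (H q)) \<longlongrightarrow> 1) (at_right 0)" by simp
qed simp

end

section \<open>Exponential clocks\<close>

definition clock :: "real \<Rightarrow> real measure" where
  "clock q = density lborel (exponential_density q)"

lemma sets_clock [simp, measurable_cong]: "sets (clock q) = sets borel"
  and space_clock [simp]: "space (clock q) = UNIV"
  by (simp_all add: clock_def)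

lemma prob_space_clock: "q > 0 \<Longrightarrow> prob_space (clock q)"
  unfolding clock_def by (rule prob_space_exponential_density)

lemma nn_integral_clock:
  assumes [measurable]: "g \<in> borel_measurable borel" and q: "q > 0"
  shows "(\<integral>\<^sup>+r. g r \<partial>clock q) = (\<integral>\<^sup>+r\<in>{0..}. ennreal (q * exp (- q * r)) * g r \<partial>lborel)"
proof -
  have "(\<integral>\<^sup>+r. g r \<partial>clock q) = (\<integral>\<^sup>+r. ennreal (exponential_density q r) * g r \<partial>lborel)"
    unfolding clock_def by (rule nn_integral_density) auto
  also have "\<dots> = (\<integral>\<^sup>+r\<in>{0..}. ennreal (q * exp (- q * r)) * g r \<partial>lborel)"
    by (intro nn_integral_cong) (auto simp: exponential_density_def indicator_def mult.commute)
  finally show ?thesis .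
qed

lemma AE_clock: "q > 0 \<Longrightarrow> AE r in clock q. 0 \<le> r"
  unfolding clock_def by (subst AE_density) (auto simp: exponential_density_def)

text \<open>Memorylessness: given that it exceeds \<open>t\<close>, the clock restarts at \<open>t\<close>.\<close>

lemma clock_shift:
  assumes [measurable]: "g \<in> borel_measurable borel" and q: "q > 0" and t: "t \<ge> 0"
  shows "(\<integral>\<^sup>+r\<in>{t..}. g r \<partial>clock q) = ennreal (exp (- q * t)) * (\<integral>\<^sup>+s. g (t + s) \<partial>clock q)"
proof -
  have "(\<integral>\<^sup>+r\<in>{t..}. g r \<partial>clock q) = (\<integral>\<^sup>+r. ennreal (exponential_density q r) * (g r * indicator {t..} r) \<partial>lborel)"
    unfolding clock_def by (rule nn_integral_density) auto
  also have "\<dots> = (\<integral>\<^sup>+s. ennreal (exponential_density q (t + 1 * s)) * (g (t + 1 * s) * indicator {t..} (t + 1 * s)) \<partial>lborel)"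
    by (subst nn_integral_real_affine[where c = 1 and t = t]) auto
  also have "\<dots> = (\<integral>\<^sup>+s. ennreal (exp (- q * t)) * (ennreal (exponential_density q s) * g (t + s)) \<partial>lborel)"
  proof (intro nn_integral_cong)
    fix s :: real
    have "exp (- (t + s) * q) = exp (- q * t) * exp (- s * q)" by (simp add: algebra_simps flip: exp_add)
    then have "s \<ge> 0 \<Longrightarrow> exponential_density q (t + s) = exp (- q * t) * exponential_density q s"
      using t by (simp add: exponential_density_def)
    then have "s \<ge> 0 \<Longrightarrow> ennreal (exponential_density q (t + s)) = ennreal (exp (- q * t)) * ennreal (exponential_density q s)"
      using q by (simp add: ennreal_mult exponential_density_nonneg)
    moreover have "s < 0 \<Longrightarrow> exponential_density q s = 0" by (simp add: exponential_density_def)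
    ultimately show "ennreal (exponential_density q (t + 1 * s)) * (g (t + 1 * s) * indicator {t..} (t + 1 * s)) =
        ennreal (exp (- q * t)) * (ennreal (exponential_density q s) * g (t + s))"
      by (cases "s \<ge> 0") (auto simp: indicator_def mult.assoc)
  qed
  also have "\<dots> = ennreal (exp (- q * t)) * (\<integral>\<^sup>+s. ennreal (exponential_density q s) * g (t + s) \<partial>lborel)"
    by (rule nn_integral_cmult) auto
  also have "(\<integral>\<^sup>+s. ennreal (exponential_density q s) * g (t + s) \<partial>lborel) = (\<integral>\<^sup>+s. g (t + s) \<partial>clock q)"
    unfolding clock_def by (rule nn_integral_density[symmetric]) auto
  finally show ?thesis .
qed

lemma clock_tail:
  assumes q: "q > 0" and t: "t \<ge> 0"
  shows "emeasure (clock q) {t..} = ennreal (exp (- q * t))"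
proof -
  interpret prob_space "clock q" by (rule prob_space_clock[OF q])
  show ?thesis using clock_shift[of "\<lambda>_. 1", OF _ q t] emeasure_space_1 by simp
qed

lemma clock_null: "emeasure (clock q) {t} = 0"
proof -
  have "emeasure (clock q) {t} = (\<integral>\<^sup>+r. ennreal (exponential_density q r) * indicator {t} r \<partial>lborel)"
    unfolding clock_def by (subst emeasure_density) auto
  also have "\<dots> = 0" by (subst nn_integral_indicator_singleton) auto
  finally show ?thesis .
qed

lemma clock_tail':
  assumes q: "q > 0" and t: "t \<ge> 0"
  shows "emeasure (clock q) {t<..} = ennreal (exp (- q * t))"
proof -
  have "{t..} = {t} \<union> {t<..}" by auto
  then have "emeasure (clock q) {t..} = emeasure (clock q) {t} + emeasure (clock q) {t<..}"
    by (simp only: , subst plus_emeasure) auto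
  then show ?thesis using clock_tail[OF q t] clock_null by simp
qed

text \<open>Since \<open>exp(-qt)\<close> is the probability that the clock rings after \<open>t\<close>, Tonelli's theorem turns the
  Laplace transform of \<open>dg\<close> into the mean of \<open>g\<close> at the clock.\<close>

lemma Laplace_Stieltjes_by_clock:
  assumes mono: "mono_on {0..} g" and cont: "continuous_on {0..} g" and g0: "g 0 = 0" and q: "q > 0"
  shows "(\<integral>\<^sup>+t\<in>{0..}. ennreal (exp (- q * t)) \<partial>half_line_measure g) = (\<integral>\<^sup>+r. ennreal (g (max 0 r)) \<partial>clock q)"
proof -
  have rc: "\<And>x. x \<ge> 0 \<Longrightarrow> continuous (at_right x) g"
    using cont by (auto simp: continuous_on_eq_continuous_within intro: continuous_within_subset)
  let ?N = "half_line_measure g"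
  interpret N: sigma_finite_measure ?N by (rule sigma_finite_half_line_measure[OF mono rc])
  interpret C: prob_space "clock q" by (rule prob_space_clock[OF q])
  interpret NC: pair_sigma_finite ?N "clock q" ..
  have nul: "emeasure ?N {..0} = 0"
  proof -
    have "emeasure ?N {- real n<..0} = 0" for n
      by (subst emeasure_half_line_measure_Ioc[OF mono rc]) auto
    then have "emeasure ?N (\<Union>n. {- real n<..0}) = 0"
      by (intro emeasure_UN_eq_0) auto
    moreover have "(\<Union>n. {- real n<..0}) = {..0}"
    proof safe
      fix x :: real assume "x \<le> 0"
      obtain n where "- x < real n" using reals_Archimedean2 by blast
      with \<open>x \<le> 0\<close> show "x \<in> (\<Union>n. {- real n<..0})" by (intro UN_I[of n]) auto
    qed auto
    ultimately show ?thesis by simp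
  qed
  have Ioc: "emeasure ?N {..r} = ennreal (g (max 0 r))" if "r \<ge> 0" for r
  proof -
    have "{..r} = {..0} \<union> {0<..r}" using that by auto
    then have "emeasure ?N {..r} = emeasure ?N {..0} + emeasure ?N {0<..r}"
      by (simp only: , subst plus_emeasure) auto
    then show ?thesis using nul emeasure_half_line_measure_Ioc[OF mono rc that] g0 by simp
  qed
  have "(\<integral>\<^sup>+t\<in>{0..}. ennreal (exp (- q * t)) \<partial>?N) = (\<integral>\<^sup>+t\<in>{0..}. emeasure (clock q) {t..} \<partial>?N)"
    using q by (intro nn_integral_cong) (auto simp: indicator_def clock_tail)
  also have "\<dots> = (\<integral>\<^sup>+t. (\<integral>\<^sup>+r. indicator {0..} t * indicator {t..} r \<partial>clock q) \<partial>?N)"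
    by (intro nn_integral_cong) (subst nn_integral_cmult, auto simp: mult.commute)
  also have "\<dots> = (\<integral>\<^sup>+r. (\<integral>\<^sup>+t. indicator {0..} t * indicator {t..} r \<partial>?N) \<partial>clock q)"
  proof (rule NC.Fubini'[symmetric])
    have eq: "(\<lambda>(t, r). indicator {0..} t * indicator {t..} r :: ennreal) = (\<lambda>(t, r). if 0 \<le> t \<and> t \<le> r then 1 else 0)"
      by (auto simp: indicator_def fun_eq_iff)
    show "(\<lambda>(t, r). indicator {0..} t * indicator {t..} r :: ennreal) \<in> borel_measurable (?N \<Otimes>\<^sub>M clock q)"
      unfolding eq by measurable
  qed
  also have "\<dots> = (\<integral>\<^sup>+r. ennreal (g (max 0 r)) \<partial>clock q)"
  proof (rule nn_integral_cong_AE)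
    have AEpos: "AE t in ?N. 0 < t"
      by (rule AE_I[where N = "{..0}"]) (use nul in auto)
    show "AE r in clock q. (\<integral>\<^sup>+t. indicator {0..} t * indicator {t..} r \<partial>?N) = ennreal (g (max 0 r))"
      using AE_clock[OF q]
    proof eventually_elim
      case (elim r)
      have "(\<integral>\<^sup>+t. indicator {0..} t * indicator {t..} r \<partial>?N) = (\<integral>\<^sup>+t. indicator {..r} t \<partial>?N)"
        by (rule nn_integral_cong_AE, use AEpos in eventually_elim) (auto simp: indicator_def)
      then show ?case using Ioc[OF elim] by simp
    qed
  qed
  finally show ?thesis .
qed

section \<open>Joint measurability of continuous processes\<close>

text \<open>The time argument is approximated by multiples of \<open>1/(n+1)\<close>, for which there are only countably
  many random variables to compose with.\<close>

lemma measurable_continuous_process: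
  fixes Y :: "real \<Rightarrow> 'w \<Rightarrow> real"
  assumes [measurable]: "\<And>r. Y r \<in> borel_measurable G"
    and cont: "\<And>\<omega>. \<omega> \<in> space G \<Longrightarrow> continuous_on UNIV (\<lambda>r. Y r \<omega>)"
  shows "(\<lambda>(r, \<omega>). Y r \<omega>) \<in> borel_measurable (borel \<Otimes>\<^sub>M G)"
proof (rule borel_measurable_LIMSEQ_real)
  let ?a = "\<lambda>n r::real. real_of_int \<lfloor>real (Suc n) * r\<rfloor> / real (Suc n)"
  show "(\<lambda>(r, \<omega>). Y (?a n r) \<omega>) \<in> borel_measurable (borel \<Otimes>\<^sub>M G)" for n
  proof -
    have "(\<lambda>z. Y (real_of_int \<lfloor>real (Suc n) * fst z\<rfloor> / real (Suc n)) (snd z)) \<in> borel_measurable (borel \<Otimes>\<^sub>M G)"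
      by (rule measurable_compose_countable[where f = "\<lambda>i z. Y (real_of_int i / real (Suc n)) (snd z)"]) measurable
    then show ?thesis by (simp add: case_prod_beta')
  qed
  fix z :: "real \<times> 'w" assume z: "z \<in> space (borel \<Otimes>\<^sub>M G)"
  obtain r \<omega> where rw: "z = (r, \<omega>)" "\<omega> \<in> space G" using z by (auto simp: space_pair_measure)
  have "(\<lambda>n. ?a n r) \<longlonglongrightarrow> r"
  proof (rule tendsto_sandwich)
    show "\<forall>\<^sub>F n in sequentially. r - 1 / real (Suc n) \<le> ?a n r"
    proof (intro always_eventually allI)
      fix n
      have "(real (Suc n) * r - 1) / real (Suc n) \<le> ?a n r"
        by (intro divide_right_mono) linarith+
      then show "r - 1 / real (Suc n) \<le> ?a n r" by (simp add: diff_divide_distrib)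
    qed
    show "\<forall>\<^sub>F n in sequentially. ?a n r \<le> r"
    proof (intro always_eventually allI)
      fix n
      have "?a n r \<le> (real (Suc n) * r) / real (Suc n)"
        by (intro divide_right_mono) linarith+
      then show "?a n r \<le> r" by simp
    qed
    have "(\<lambda>n. r - 1 / real (Suc n)) \<longlonglongrightarrow> r - 0"
      using lim_1_over_n[THEN LIMSEQ_Suc] by (intro tendsto_intros) 
    then show "(\<lambda>n. r - 1 / real (Suc n)) \<longlonglongrightarrow> r" by simp
  qed simp
  then have "(\<lambda>n. Y (?a n r) \<omega>) \<longlonglongrightarrow> Y r \<omega>"
    by (rule continuous_on_tendsto_compose[OF cont[OF rw(2)]]) auto
  then show "(\<lambda>n. (\<lambda>(r, \<omega>). Y (?a n r) \<omega>) z) \<longlonglongrightarrow> (\<lambda>(r, \<omega>). Y r \<omega>) z"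
    by (simp add: rw)
qed

section \<open>The Markov property\<close>

context diffusion_family
begin

abbreviation "\<Omega> \<equiv> space M"
abbreviation "S \<equiv> process_sigma \<Omega> X {0..}"
abbreviation "F \<equiv> right_filtration \<Omega> X"

lemma process_sigma_closed: "{X s -` B \<inter> \<Omega> | s B. s \<in> I \<and> B \<in> sets borel} \<subseteq> Pow \<Omega>"
  by auto

lemma space_process_sigma [simp]: "space (process_sigma \<Omega> X I) = \<Omega>"
  unfolding process_sigma_def by (rule space_measure_of[OF process_sigma_closed])

lemma sets_process_sigma: "sets (process_sigma \<Omega> X I) = sigma_sets \<Omega> {X s -` B \<inter> \<Omega> | s B. s \<in> I \<and> B \<in> sets borel}"
  unfolding process_sigma_def by (rule sets_measure_of[OF process_sigma_closed])

lemma process_sigma_mono: "I \<subseteq> J \<Longrightarrow> sets (process_sigma \<Omega> X I) \<subseteq> sets (process_sigma \<Omega> X J)"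
  unfolding sets_process_sigma by (intro sigma_sets_mono') auto

lemma S_subset_M: "sets S \<subseteq> sets M"
  unfolding sets_process_sigma
  by (rule sets.sigma_sets_subset) (auto intro: measurable_sets[OF X_measurable])

lemma right_filtration_closed: "(\<Inter>s\<in>{t<..}. sets (process_sigma \<Omega> X {0..s})) \<subseteq> Pow \<Omega>"
  using sets.space_closed[of "process_sigma \<Omega> X {0..t+1}"] by fastforce

lemma space_F [simp]: "space (F t) = \<Omega>"
  unfolding right_filtration_def by (rule space_measure_of[OF right_filtration_closed])

lemma sets_F: "sets (F t) = sigma_sets \<Omega> (\<Inter>s\<in>{t<..}. sets (process_sigma \<Omega> X {0..s}))"
  unfolding right_filtration_def by (rule sets_measure_of[OF right_filtration_closed])

lemma F_mono: "s \<le> t \<Longrightarrow> sets (F s) \<subseteq> sets (F t)"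
  unfolding sets_F by (intro sigma_sets_mono') auto

lemma F_subset_S: "sets (F t) \<subseteq> sets S"
proof -
  have "(\<Inter>s\<in>{t<..}. sets (process_sigma \<Omega> X {0..s})) \<subseteq> sets (process_sigma \<Omega> X {0..t+1})" by auto
  also have "\<dots> \<subseteq> sets S" by (rule process_sigma_mono) auto
  finally show ?thesis unfolding sets_F using sets.sigma_sets_subset[of _ S] by simp
qed

lemma F_subset_M: "sets (F t) \<subseteq> sets M"
  using F_subset_S S_subset_M by blast

lemma filtration_F: "filtration \<Omega> F"
  by unfold_locales (simp_all add: F_mono)

lemma measurable_F_S: "f \<in> F t \<rightarrow>\<^sub>M N \<Longrightarrow> f \<in> S \<rightarrow>\<^sub>M N"
  using F_subset_S[of t] by (auto simp: measurable_def)

lemma measurable_S_M: "f \<in> S \<rightarrow>\<^sub>M N \<Longrightarrow> f \<in> M \<rightarrow>\<^sub>M N"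
  using S_subset_M by (auto simp: measurable_def)

lemma measurable_F_M: "f \<in> F t \<rightarrow>\<^sub>M N \<Longrightarrow> f \<in> M \<rightarrow>\<^sub>M N"
  by (intro measurable_S_M measurable_F_S)

lemma measurable_F_F: "f \<in> F s \<rightarrow>\<^sub>M N \<Longrightarrow> s \<le> t \<Longrightarrow> f \<in> F t \<rightarrow>\<^sub>M N"
  using F_mono[of s t] by (auto simp: measurable_def)

lemma space_P [simp]: "x \<ge> 0 \<Longrightarrow> space (P x) = \<Omega>"
  using sets_P sets_eq_imp_space_eq by blast

lemma subalgebra_F: "x \<ge> 0 \<Longrightarrow> subalgebra (P x) (F t)"
  using F_subset_M sets_P by (auto simp: subalgebra_def)

lemma X_F: "t \<ge> 0 \<Longrightarrow> X t \<in> borel_measurable (F t)"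
proof (rule measurableI)
  fix B :: "real set" assume t: "t \<ge> 0" and B: "B \<in> sets borel"
  have "X t -` B \<inter> \<Omega> \<in> sets (process_sigma \<Omega> X {0..s})" if "s > t" for s
    unfolding sets_process_sigma
    by (intro sigma_sets.Basic, rule CollectI, intro exI[of _ t] exI[of _ B]) (use t B that in auto)
  then show "X t -` B \<inter> space (F t) \<in> sets (F t)"
    unfolding sets_F by (auto intro!: sigma_sets.Basic)
qed auto

lemma X_S: "t \<ge> 0 \<Longrightarrow> X t \<in> borel_measurable S"
  by (rule measurable_F_S[OF X_F])

lemma shift_measurable: "t \<ge> 0 \<Longrightarrow> \<theta> t \<in> S \<rightarrow>\<^sub>M S"
proof -
  assume t: "t \<ge> 0"
  have "\<theta> t \<in> S \<rightarrow>\<^sub>M sigma \<Omega> {X s -` B \<inter> \<Omega> | s B. s \<in> {0..} \<and> B \<in> sets borel}"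
  proof (rule measurable_sigma_sets[OF _ process_sigma_closed])
    show "sets (sigma \<Omega> {X s -` B \<inter> \<Omega> | s B. s \<in> {0..} \<and> B \<in> sets borel}) = sigma_sets \<Omega> {X s -` B \<inter> \<Omega> | s B. s \<in> {0..} \<and> B \<in> sets borel}"
      by (rule sets_measure_of[OF process_sigma_closed])
    show "\<theta> t \<in> space S \<rightarrow> \<Omega>" using shift_space[OF t] by auto
    fix A assume "A \<in> {X s -` B \<inter> \<Omega> | s B. s \<in> {0..} \<and> B \<in> sets borel}"
    then obtain s B where A: "A = X s -` B \<inter> \<Omega>" "s \<ge> 0" "B \<in> sets borel" by auto
    have "\<theta> t -` A \<inter> space S = X (t + s) -` B \<inter> space S"
      using A shift[OF A(2) t] shift_space[OF t] by auto
    also have "\<dots> \<in> sets S" by (rule measurable_sets[OF X_S]) (use A t in auto)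
    finally show "\<theta> t -` A \<inter> space S \<in> sets S" .
  qed
  then show ?thesis unfolding process_sigma_def .
qed

text \<open>The strong Markov property at the constant time \<open>t\<close>, whose \<open>\<sigma>\<close>-algebra of the past is \<open>\<F>\<^sub>t\<close>.\<close>

lemma emeasure_Markov:
  assumes x: "x \<ge> 0" and t: "t \<ge> 0" and A: "A \<in> sets (F t)" and B: "B \<in> sets S"
  shows "emeasure (P x) (A \<inter> (\<theta> t -` B \<inter> \<Omega>)) = (\<integral>\<^sup>+\<omega>\<in>A. emeasure (P (X t \<omega>)) B \<partial>P x)"
proof -
  interpret P: prob_space "P x" by (rule prob_space_P[OF x])
  let ?T = "\<lambda>_::'w. t"
  have T: "stopping_time F ?T" by (rule stopping_time_const)
  interpret filtration \<Omega> F by (rule filtration_F)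
  have pre: "sets (pre_sigma ?T) = sets (F t)"
  proof -
    have "(\<forall>s. {\<omega> \<in> A. t \<le> s} \<in> sets (F s)) \<longleftrightarrow> A \<in> sets (F t)" for A
    proof
      assume "\<forall>s. {\<omega> \<in> A. t \<le> s} \<in> sets (F s)"
      from spec[OF this, of t] show "A \<in> sets (F t)" by simp
    next
      assume A: "A \<in> sets (F t)"
      show "\<forall>s. {\<omega> \<in> A. t \<le> s} \<in> sets (F s)"
      proof
        fix s show "{\<omega> \<in> A. t \<le> s} \<in> sets (F s)"
          using A F_mono[of t s] by (cases "t \<le> s") auto
      qed
    qed
    then show ?thesis unfolding sets_pre_sigma[OF T] by blast
  qed
  have sub: "subalgebra (P x) (pre_sigma ?T)"
    unfolding subalgebra_def pre sets_P[OF x] space_pre_sigma space_P[OF x] using F_subset_M by blast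
  interpret finite_measure_subalgebra "P x" "pre_sigma ?T"
    by unfold_locales (rule sub)
  let ?C = "\<theta> t -` B \<inter> \<Omega>"
  have C: "?C \<in> sets (P x)"
    using measurable_sets[OF shift_measurable[OF t] B] S_subset_M sets_P[OF x] by auto
  have A': "A \<in> sets (P x)" using A F_subset_M sets_P[OF x] by auto
  have "AE \<omega> in P x. real_cond_exp (P x) (pre_sigma ?T) (\<lambda>\<omega>. indicator B (\<theta> t \<omega>)) \<omega> = measure (P (X t \<omega>)) B"
    using strong_Markov[OF x T _ B] t by simp
  have ind: "integrable (P x) (\<lambda>\<omega>. indicator B (\<theta> t \<omega>) :: real)"
  proof -
    have "integrable (P x) (indicator ?C :: _ \<Rightarrow> real)" using C by (intro integrable_real_indicator) (auto simp: P.emeasure_eq_measure)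
    then show ?thesis
      by (rule Bochner_Integration.integrable_cong[THEN iffD1, rotated 2]) (use x in \<open>auto simp: indicator_def\<close>)
  qed
  have int: "(\<integral>\<omega>\<in>A. indicator B (\<theta> t \<omega>) \<partial>P x) = (\<integral>\<omega>\<in>A. real_cond_exp (P x) (pre_sigma ?T) (\<lambda>\<omega>. indicator B (\<theta> t \<omega>)) \<omega> \<partial>P x)"
    by (rule real_cond_exp_intA[OF ind]) (use A pre in auto)
  have Xm: "X t \<in> P x \<rightarrow>\<^sub>M restrict_space borel {0..}"
    using X_measurable[OF t] X_nonneg[OF t] x sets_P[OF x]
    by (intro measurable_restrict_space2) (auto cong: measurable_cong_sets)
  have Km: "(\<lambda>\<omega>. measure (P (X t \<omega>)) B) \<in> borel_measurable (P x)"
    using measurable_compose[OF Xm P_kernel[OF B]] .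
  have le1: "measure (P (X t \<omega>)) B \<le> 1" if "\<omega> \<in> \<Omega>" for \<omega>
    using prob_space.prob_le_1[OF prob_space_P[OF X_nonneg[OF t that]]] .
  have Ki: "integrable (P x) (\<lambda>\<omega>. indicator A \<omega> * measure (P (X t \<omega>)) B)"
    using le1 Km A' x by (intro P.integrable_const_bound[where B = 1]) (auto simp: indicator_def)
  have "emeasure (P x) (A \<inter> ?C) = ennreal (\<integral>\<omega>\<in>A. indicator B (\<theta> t \<omega>) \<partial>P x)"
  proof -
    have "(\<integral>\<omega>\<in>A. indicator B (\<theta> t \<omega>) \<partial>P x) = (\<integral>\<omega>. indicator (A \<inter> ?C) \<omega> \<partial>P x)"
      unfolding set_lebesgue_integral_def by (intro Bochner_Integration.integral_cong) (use x in \<open>auto simp: indicator_def\<close>)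
    also have "\<dots> = P.prob (A \<inter> ?C)" using A' C by simp
    finally show ?thesis by (simp only: P.emeasure_eq_measure)
  qed
  also have "(\<integral>\<omega>\<in>A. indicator B (\<theta> t \<omega>) \<partial>P x) = (\<integral>\<omega>. indicator A \<omega> * measure (P (X t \<omega>)) B \<partial>P x)"
    unfolding int unfolding set_lebesgue_integral_def
  proof (rule integral_cong_AE)
    show "AE \<omega> in P x. indicator A \<omega> *\<^sub>R real_cond_exp (P x) (pre_sigma ?T) (\<lambda>\<omega>. indicator B (\<theta> t \<omega>)) \<omega> =
        indicator A \<omega> * measure (P (X t \<omega>)) B"
      using strong_Markov[OF x T _ B] t by (auto elim: AE_mp)
  qed (use A' Km in auto)
  also have "ennreal \<dots> = (\<integral>\<^sup>+\<omega>. ennreal (indicator A \<omega> * measure (P (X t \<omega>)) B) \<partial>P x)"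
    using Ki by (intro nn_integral_eq_integral[symmetric]) auto
  also have "\<dots> = (\<integral>\<^sup>+\<omega>\<in>A. emeasure (P (X t \<omega>)) B \<partial>P x)"
  proof (intro nn_integral_cong)
    fix \<omega> assume "\<omega> \<in> space (P x)"
    then interpret Q: prob_space "P (X t \<omega>)" using X_nonneg[OF t] x by (intro prob_space_P) auto
    show "ennreal (indicator A \<omega> * measure (P (X t \<omega>)) B) = emeasure (P (X t \<omega>)) B * indicator A \<omega>"
      by (auto simp: indicator_def Q.emeasure_eq_measure)
  qed
  finally show ?thesis .
qed

text \<open>The law of the path, as a probability kernel; clamping the starting point at \<open>0\<close> makes it total.\<close>

definition law :: "real \<Rightarrow> 'w measure" where
  "law y = distr (P (max 0 y)) S (\<lambda>\<omega>. \<omega>)"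

lemma id_P_S: "y \<ge> 0 \<Longrightarrow> (\<lambda>\<omega>. \<omega>) \<in> P y \<rightarrow>\<^sub>M S"
  using S_subset_M sets_P[of y] by (auto simp: measurable_def)

lemma sets_law [simp, measurable_cong]: "sets (law y) = sets S"
  and space_law [simp]: "space (law y) = \<Omega>"
  by (simp_all add: law_def)

lemma prob_space_law: "prob_space (law y)"
  unfolding law_def by (rule prob_space.prob_space_distr[OF prob_space_P id_P_S]) auto

lemma emeasure_law: "y \<ge> 0 \<Longrightarrow> B \<in> sets S \<Longrightarrow> emeasure (law y) B = emeasure (P y) B"
  unfolding law_def using sets.sets_into_space[of B S]
  by (subst emeasure_distr[OF id_P_S]) (auto simp: Int_absorb2)

lemma nn_integral_law: "y \<ge> 0 \<Longrightarrow> g \<in> borel_measurable S \<Longrightarrow> (\<integral>\<^sup>+\<omega>. g \<omega> \<partial>law y) = (\<integral>\<^sup>+\<omega>. g \<omega> \<partial>P y)"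
  unfolding law_def by (subst nn_integral_distr[OF id_P_S]) auto

lemma law_measurable [measurable]: "law \<in> borel \<rightarrow>\<^sub>M subprob_algebra S"
proof (rule measurable_subprob_algebra)
  fix A assume A: "A \<in> sets S"
  have "(\<lambda>y. max 0 y) \<in> borel \<rightarrow>\<^sub>M restrict_space borel {0::real..}"
    by (intro measurable_restrict_space2) auto
  from measurable_compose[OF this P_kernel[OF A]]
  have "(\<lambda>y. ennreal (measure (P (max 0 y)) A)) \<in> borel_measurable borel" by measurable
  moreover have "emeasure (law y) A = ennreal (measure (P (max 0 y)) A)" for y
  proof -
    interpret prob_space "P (max 0 y)" by (rule prob_space_P) auto
    have "law y = law (max 0 y)" by (simp add: law_def)
    then show ?thesis using emeasure_law[OF _ A, of "max 0 y"] by (simp add: emeasure_eq_measure)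
  qed
  ultimately show "(\<lambda>y. emeasure (law y) A) \<in> borel_measurable borel" by simp
qed (auto intro: prob_space_imp_subprob_space prob_space_law)

text \<open>Here the functional of the future may depend on the past as well. Both sides integrate \<open>W\<close> with
  respect to a probability measure on pairs (past, future); the two measures agree on rectangles
  by the Markov property for events, and rectangles generate the product \<open>\<sigma>\<close>-algebra.\<close>

lemma nn_integral_Markov:
  assumes x: "x \<ge> 0" and t: "t \<ge> 0" and W: "(\<lambda>(\<omega>, \<omega>'). W \<omega> \<omega>') \<in> borel_measurable (F t \<Otimes>\<^sub>M S)"
  shows "(\<integral>\<^sup>+\<omega>. W \<omega> (\<theta> t \<omega>) \<partial>P x) = (\<integral>\<^sup>+\<omega>. (\<integral>\<^sup>+\<omega>'. W \<omega> \<omega>' \<partial>law (X t \<omega>)) \<partial>P x)"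
proof -
  interpret P: prob_space "P x" by (rule prob_space_P[OF x])
  let ?Z = "F t \<Otimes>\<^sub>M S"
  have idF: "(\<lambda>\<omega>. \<omega>) \<in> P x \<rightarrow>\<^sub>M F t"
    using F_subset_M sets_P[OF x] x by (auto simp: measurable_def)
  have th: "\<theta> t \<in> P x \<rightarrow>\<^sub>M S"
    using measurable_S_M[OF shift_measurable[OF t]] sets_P[OF x] by (auto cong: measurable_cong_sets)
  have [measurable]: "X t \<in> borel_measurable (F t)" by (rule X_F[OF t])
  have pm: "(\<lambda>\<omega>. (\<omega>, \<theta> t \<omega>)) \<in> P x \<rightarrow>\<^sub>M ?Z" using idF th by (rule measurable_Pair)
  define \<mu>1 where "\<mu>1 = distr (P x) ?Z (\<lambda>\<omega>. (\<omega>, \<theta> t \<omega>))"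
  define K where "K \<omega> = distr (law (X t \<omega>)) ?Z (Pair \<omega>)" for \<omega>
  have Kid: "K \<in> F t \<rightarrow>\<^sub>M subprob_algebra ?Z"
    unfolding K_def by (rule measurable_distr2[where M = S]) measurable
  have KP: "K \<in> P x \<rightarrow>\<^sub>M subprob_algebra ?Z"
    using measurable_compose[OF idF Kid] by simp
  define \<mu>2 where "\<mu>2 = P x \<bind> K"
  have s1: "sets \<mu>1 = sets ?Z" by (simp add: \<mu>1_def)
  have s2: "sets \<mu>2 = sets ?Z"
    unfolding \<mu>2_def using KP P.not_empty by (intro sets_bind) (auto dest: measurable_space simp: space_subprob_algebra)
  have KI: "(\<integral>\<^sup>+z. g z \<partial>K \<omega>) = (\<integral>\<^sup>+\<omega>'. g (\<omega>, \<omega>') \<partial>law (X t \<omega>))"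
    if "g \<in> borel_measurable ?Z" "\<omega> \<in> \<Omega>" for g \<omega>
    unfolding K_def using that by (subst nn_integral_distr) (auto intro!: measurable_Pair)
  have eq: "\<mu>1 = \<mu>2"
  proof (rule measure_eqI_generator_eq[where E = "{a \<times> b | a b. a \<in> sets (F t) \<and> b \<in> sets S}"
        and \<Omega> = "\<Omega> \<times> \<Omega>" and A = "\<lambda>_. \<Omega> \<times> \<Omega>"])
    show "Int_stable {a \<times> b | a b. a \<in> sets (F t) \<and> b \<in> sets S}"
      by (rule Int_stable_pair_measure_generator)
    show "{a \<times> b | a b. a \<in> sets (F t) \<and> b \<in> sets S} \<subseteq> Pow (\<Omega> \<times> \<Omega>)"
      using sets.sets_into_space[of _ "F t"] sets.sets_into_space[of _ S] by fastforce
    show "sets \<mu>1 = sigma_sets (\<Omega> \<times> \<Omega>) {a \<times> b | a b. a \<in> sets (F t) \<and> b \<in> sets S}"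
      "sets \<mu>2 = sigma_sets (\<Omega> \<times> \<Omega>) {a \<times> b | a b. a \<in> sets (F t) \<and> b \<in> sets S}"
      by (simp_all add: s1 s2 sets_pair_measure)
    show "range (\<lambda>_::nat. \<Omega> \<times> \<Omega>) \<subseteq> {a \<times> b | a b. a \<in> sets (F t) \<and> b \<in> sets S}"
      using sets.top[of "F t"] sets.top[of S] by force
    show "(\<Union>i::nat. \<Omega> \<times> \<Omega>) = \<Omega> \<times> \<Omega>" by simp
    interpret p1: prob_space \<mu>1 unfolding \<mu>1_def by (rule P.prob_space_distr[OF pm])
    show "emeasure \<mu>1 (\<Omega> \<times> \<Omega>) \<noteq> \<infinity>" by simp
    fix Y assume "Y \<in> {a \<times> b | a b. a \<in> sets (F t) \<and> b \<in> sets S}"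
    then obtain A B where Y: "Y = A \<times> B" "A \<in> sets (F t)" "B \<in> sets S" by auto
    then have YZ: "Y \<in> sets ?Z" by auto
    have "emeasure \<mu>1 Y = emeasure (P x) ((\<lambda>\<omega>. (\<omega>, \<theta> t \<omega>)) -` Y \<inter> space (P x))"
      unfolding \<mu>1_def by (rule emeasure_distr[OF pm YZ])
    also have "(\<lambda>\<omega>. (\<omega>, \<theta> t \<omega>)) -` Y \<inter> space (P x) = A \<inter> (\<theta> t -` B \<inter> \<Omega>)" using Y x by auto
    also have "emeasure (P x) \<dots> = (\<integral>\<^sup>+\<omega>\<in>A. emeasure (P (X t \<omega>)) B \<partial>P x)"
      by (rule emeasure_Markov[OF x t Y(2,3)])
    also have "\<dots> = (\<integral>\<^sup>+\<omega>. emeasure (K \<omega>) Y \<partial>P x)"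
    proof (rule nn_integral_cong)
      fix \<omega> assume "\<omega> \<in> space (P x)"
      then have w: "\<omega> \<in> \<Omega>" using x by simp
      have "emeasure (K \<omega>) Y = (\<integral>\<^sup>+z. indicator Y z \<partial>K \<omega>)" using YZ by (simp add: K_def)
      also have "\<dots> = (\<integral>\<^sup>+\<omega>'. indicator A \<omega> * indicator B \<omega>' \<partial>law (X t \<omega>))"
        by (subst KI[OF borel_measurable_indicator[OF YZ] w]) (simp add: Y indicator_times)
      also have "\<dots> = indicator A \<omega> * emeasure (law (X t \<omega>)) B"
        using Y by (subst nn_integral_cmult) auto
      finally show "emeasure (P (X t \<omega>)) B * indicator A \<omega> = emeasure (K \<omega>) Y"
        using emeasure_law[OF X_nonneg[OF t w] Y(3)] by (simp add: mult.commute)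
    qed
    also have "\<dots> = emeasure \<mu>2 Y"
      unfolding \<mu>2_def by (rule emeasure_bind[OF P.not_empty KP YZ, symmetric])
    finally show "emeasure \<mu>1 Y = emeasure \<mu>2 Y" .
  qed
  have "(\<integral>\<^sup>+\<omega>. W \<omega> (\<theta> t \<omega>) \<partial>P x) = (\<integral>\<^sup>+z. (\<lambda>(\<omega>, \<omega>'). W \<omega> \<omega>') z \<partial>\<mu>1)"
    unfolding \<mu>1_def by (subst nn_integral_distr[OF pm]) (use W in auto)
  also have "\<dots> = (\<integral>\<^sup>+\<omega>. (\<integral>\<^sup>+z. (\<lambda>(\<omega>, \<omega>'). W \<omega> \<omega>') z \<partial>K \<omega>) \<partial>P x)"
    unfolding eq \<mu>2_def by (rule nn_integral_bind[OF W KP])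
  also have "\<dots> = (\<integral>\<^sup>+\<omega>. (\<integral>\<^sup>+\<omega>'. W \<omega> \<omega>' \<partial>law (X t \<omega>)) \<partial>P x)"
    by (intro nn_integral_cong) (use KI[OF W] x in auto)
  finally show ?thesis .
qed

end

section \<open>Characterisation of the exponential law by its mean excess\<close>

text \<open>The layer-cake formula for the positive part of \<open>x - u\<close>.\<close>

lemma nn_integral_excess:
  fixes \<nu> :: "real measure"
  assumes "prob_space \<nu>" and s: "sets \<nu> = sets borel"
  shows "(\<integral>\<^sup>+x. ennreal (x - u) \<partial>\<nu>) = (\<integral>\<^sup>+w\<in>{u..}. emeasure \<nu> {w<..} \<partial>lborel)"
proof -
  note s[measurable_cong]
  have sp: "space \<nu> = UNIV" using sets_eq_imp_space_eq[OF s] by simp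
  interpret prob_space \<nu> by fact
  interpret pair_sigma_finite \<nu> lborel ..
  have "(\<integral>\<^sup>+x. ennreal (x - u) \<partial>\<nu>) = (\<integral>\<^sup>+x. (\<integral>\<^sup>+w. (if u \<le> w \<and> w < x then 1 else 0) \<partial>lborel) \<partial>\<nu>)"
  proof (rule nn_integral_cong)
    fix x
    have "(\<integral>\<^sup>+w. (if u \<le> w \<and> w < x then 1 else 0) \<partial>lborel) = (\<integral>\<^sup>+w. indicator {u..<x} w \<partial>lborel)"
      by (intro nn_integral_cong) (auto simp: indicator_def)
    then show "ennreal (x - u) = (\<integral>\<^sup>+w. (if u \<le> w \<and> w < x then 1 else 0) \<partial>lborel)"
      by (cases "u \<le> x") (auto simp: ennreal_neg)
  qed
  also have "\<dots> = (\<integral>\<^sup>+w. (\<integral>\<^sup>+x. (if u \<le> w \<and> w < x then 1 else 0) \<partial>\<nu>) \<partial>lborel)"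
    by (rule Fubini'[symmetric]) measurable
  also have "\<dots> = (\<integral>\<^sup>+w\<in>{u..}. emeasure \<nu> {w<..} \<partial>lborel)"
  proof (rule nn_integral_cong)
    fix w
    have "(\<integral>\<^sup>+x. (if u \<le> w \<and> w < x then 1 else 0) \<partial>\<nu>) = (\<integral>\<^sup>+x. indicator {u..} w * indicator {w<..} x \<partial>\<nu>)"
      by (intro nn_integral_cong) (auto simp: indicator_def)
    also have "\<dots> = indicator {u..} w * emeasure \<nu> {w<..}"
      by (subst nn_integral_cmult) (auto simp: s)
    finally show "(\<integral>\<^sup>+x. (if u \<le> w \<and> w < x then 1 else 0) \<partial>\<nu>) = emeasure \<nu> {w<..} * indicator {u..} w"
      by (simp add: mult.commute)
  qed
  finally show ?thesis .
qed

text \<open>Let \<open>\<alpha>\<close> be the tail of \<open>\<nu>\<close>. By the layer-cake formula the mean excess over \<open>w\<close> is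
  \<open>\<rho> - \<integral>\<^sub>0\<^sup>w \<alpha>\<close>, so the hypothesis reads \<open>H \<alpha>(w) = \<rho> - \<integral>\<^sub>0\<^sup>w \<alpha>\<close>. Hence \<open>\<alpha>\<close> is continuous, the right side
  has derivative \<open>-\<alpha>(w)\<close>, and multiplied by \<open>exp(w/H)\<close> it is constant.\<close>

lemma tail_eq_of_mean_excess:
  fixes \<nu> :: "real measure"
  assumes P: "prob_space \<nu>" and s: "sets \<nu> = sets borel"
    and H: "H > 0" and \<rho>: "\<rho> \<ge> 0"
    and mean: "(\<integral>\<^sup>+x. ennreal x \<partial>\<nu>) = ennreal \<rho>"
    and excess: "\<And>u. u \<ge> 0 \<Longrightarrow> (\<integral>\<^sup>+x. ennreal (x - u) \<partial>\<nu>) = ennreal H * emeasure \<nu> {u<..}"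
    and u: "u \<ge> 0"
  shows "emeasure \<nu> {u<..} = ennreal (\<rho> / H * exp (- u / H))"
proof -
  interpret prob_space \<nu> by fact
  define \<alpha> where "\<alpha> w = measure \<nu> {w<..}" for w
  have em: "emeasure \<nu> {w<..} = ennreal (\<alpha> w)" for w by (simp add: \<alpha>_def emeasure_eq_measure)
  have a0: "0 \<le> \<alpha> w" "\<alpha> w \<le> 1" for w by (auto simp: \<alpha>_def)
  have am: "antimono \<alpha>"
    unfolding \<alpha>_def by (intro antimonoI finite_measure_mono) (auto simp: s)
  have "mono (\<lambda>w. - \<alpha> w)" using am by (auto simp: mono_def antimono_def)
  then have "(\<lambda>w. - \<alpha> w) \<in> borel_measurable borel" by (rule borel_measurable_mono)
  then have "(\<lambda>w. - (- \<alpha> w)) \<in> borel_measurable borel" by (rule borel_measurable_uminus)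
  then have [measurable]: "\<alpha> \<in> borel_measurable borel" by simp
  have si: "set_integrable lborel {0..w} \<alpha>" for w
    unfolding set_integrable_def
  proof (rule Bochner_Integration.integrable_bound)
    show "integrable lborel (\<lambda>v. indicator {0..w} v *\<^sub>R (1::real))"
      using set_integrable_const_Icc[of 0 w 1] unfolding set_integrable_def .
    show "AE v in lborel. norm (indicator {0..w} v *\<^sub>R \<alpha> v) \<le> norm (indicator {0..w} v *\<^sub>R (1::real))"
      using a0 by (auto simp: indicator_def)
  qed simp
  have io: "\<alpha> integrable_on {0..w}" for w
    using set_borel_integral_eq_integral(1)[OF si] .
  have key: "H * \<alpha> w = \<rho> - integral {0..w} \<alpha>" if w: "w \<ge> 0" for w
  proof -
    have "ennreal \<rho> = (\<integral>\<^sup>+v\<in>{0..}. ennreal (\<alpha> v) \<partial>lborel)"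
      using nn_integral_excess[OF P s, of 0] mean by (simp add: em)
    also have "\<dots> = (\<integral>\<^sup>+v. ennreal (\<alpha> v) * indicator {0..<w} v + ennreal (\<alpha> v) * indicator {w..} v \<partial>lborel)"
      using w by (intro nn_integral_cong) (auto simp: indicator_def)
    also have "\<dots> = (\<integral>\<^sup>+v\<in>{0..<w}. ennreal (\<alpha> v) \<partial>lborel) + (\<integral>\<^sup>+v\<in>{w..}. ennreal (\<alpha> v) \<partial>lborel)"
      by (rule nn_integral_add) auto
    also have "(\<integral>\<^sup>+v\<in>{w..}. ennreal (\<alpha> v) \<partial>lborel) = ennreal (H * \<alpha> w)"
      using nn_integral_excess[OF P s, of w] excess[OF w] H by (simp add: em ennreal_mult a0)
    also have "(\<integral>\<^sup>+v\<in>{0..<w}. ennreal (\<alpha> v) \<partial>lborel) = (\<integral>\<^sup>+v. ennreal (indicator {0..w} v *\<^sub>R \<alpha> v) \<partial>lborel)"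
      by (rule nn_integral_cong_AE, use AE_lborel_singleton[of w] in eventually_elim) (auto simp: indicator_def)
    also have "\<dots> = ennreal (integral {0..w} \<alpha>)"
      using si[of w] a0 unfolding set_integrable_def
      by (subst nn_integral_eq_integral) (auto simp: set_borel_integral_eq_integral(2)[OF si, symmetric] set_lebesgue_integral_def)
    finally have "ennreal \<rho> = ennreal (integral {0..w} \<alpha> + H * \<alpha> w)"
      using H a0 by (subst ennreal_plus) (auto intro!: integral_nonneg io)
    then have "\<rho> = integral {0..w} \<alpha> + H * \<alpha> w"
      using \<rho> H a0 by (subst (asm) ennreal_inj) (auto intro!: integral_nonneg io add_nonneg_nonneg)
    then show ?thesis by simp
  qed
  have al: "\<alpha> w = (\<rho> - integral {0..w} \<alpha>) / H" if "w \<ge> 0" for w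
    using key[OF that] H by (simp add: field_simps)
  have cont: "continuous_on {0..u} \<alpha>"
  proof (rule continuous_on_eq)
    show "continuous_on {0..u} (\<lambda>w. (\<rho> - integral {0..w} \<alpha>) / H)"
      using H by (intro continuous_intros indefinite_integral_continuous_1 io) auto
  qed (use al in auto)
  have "\<exists>c. \<forall>w\<in>{0..u}. (\<rho> - integral {0..w} \<alpha>) * exp (w / H) = c"
  proof (rule has_field_derivative_zero_constant)
    fix w assume w: "w \<in> {0..u}"
    have d: "((\<lambda>w. integral {0..w} \<alpha>) has_real_derivative \<alpha> w) (at w within {0..u})"
      by (rule integral_has_real_derivative[OF cont w])
    show "((\<lambda>w. (\<rho> - integral {0..w} \<alpha>) * exp (w / H)) has_field_derivative 0) (at w within {0..u})"
    proof -
      have e: "((\<lambda>w. exp (w / H)) has_real_derivative exp (w / H) * (1 / H)) (at w within {0..u})"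
        using H by (auto intro!: derivative_eq_intros)
      have "((\<lambda>w. (\<rho> - integral {0..w} \<alpha>) * exp (w / H)) has_real_derivative
          (0 - \<alpha> w) * exp (w / H) + exp (w / H) * (1 / H) * (\<rho> - integral {0..w} \<alpha>)) (at w within {0..u})"
        by (intro DERIV_mult DERIV_diff DERIV_const d e)
      moreover have "\<rho> - integral {0..w} \<alpha> = H * \<alpha> w" using key[of w] w by simp
      ultimately show ?thesis using H by simp
    qed
  qed auto
  then obtain c where c: "\<And>w. w \<in> {0..u} \<Longrightarrow> (\<rho> - integral {0..w} \<alpha>) * exp (w / H) = c" by blast
  have "c = \<rho>" using c[of 0] u by simp
  then have "(\<rho> - integral {0..u} \<alpha>) * exp (u / H) = \<rho>" using c[of u] u by simp
  then have "H * \<alpha> u = \<rho> * exp (- u / H)"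
    unfolding key[OF u] by (simp add: exp_minus field_simps)
  then have "\<alpha> u = \<rho> / H * exp (- u / H)" using H by (simp add: field_simps)
  then show ?thesis by (simp add: em)
qed

text \<open>The tail identifies \<open>\<nu>\<close> on \<open>(0,\<infinity>)\<close> as a multiple of the exponential law of mean \<open>H\<close>; the rest of
  the mass sits at \<open>0\<close>.\<close>

lemma nn_integral_of_mean_excess:
  fixes \<nu> :: "real measure"
  assumes P: "prob_space \<nu>" and s: "sets \<nu> = sets borel" and pos: "AE x in \<nu>. 0 \<le> x"
    and H: "H > 0" and \<rho>: "\<rho> \<ge> 0"
    and mean: "(\<integral>\<^sup>+x. ennreal x \<partial>\<nu>) = ennreal \<rho>"
    and excess: "\<And>u. u \<ge> 0 \<Longrightarrow> (\<integral>\<^sup>+x. ennreal (x - u) \<partial>\<nu>) = ennreal H * emeasure \<nu> {u<..}"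
    and g: "g \<in> borel_measurable borel"
  shows "(\<integral>\<^sup>+x. g x \<partial>\<nu>) = ennreal (1 - \<rho> / H) * g 0 + ennreal (\<rho> / H) * (\<integral>\<^sup>+v. g v \<partial>clock (1 / H))"
proof -
  note s[measurable_cong] g[measurable]
  have sp: "space \<nu> = UNIV" using sets_eq_imp_space_eq[OF s] by simp
  interpret prob_space \<nu> by fact
  note tail = tail_eq_of_mean_excess[OF P s H \<rho> mean excess]
  have H1: "1 / H > 0" using H by simp
  have "ennreal (\<rho> / H) = emeasure \<nu> {0<..}" using tail[of 0] by simp
  then have t0: "measure \<nu> {0<..} = \<rho> / H" using \<rho> H by (simp add: emeasure_eq_measure)
  have at0: "emeasure \<nu> {0} = ennreal (1 - \<rho> / H)"
  proof -
    have "1 = measure \<nu> {0..}"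
    proof (rule sym, subst prob_eq_1)
      show "AE x in \<nu>. x \<in> {0..}" using pos by simp
    qed (simp add: s)
    also have "{0..} = {0::real} \<union> {0<..}" by auto
    also have "measure \<nu> \<dots> = measure \<nu> {0} + measure \<nu> {0<..}"
      by (rule finite_measure_Union) (auto simp: s)
    finally have "measure \<nu> {0} = 1 - \<rho> / H" using t0 by linarith
    then show ?thesis by (simp add: emeasure_eq_measure)
  qed
  interpret C: prob_space "clock (1 / H)" by (rule prob_space_clock[OF H1])
  have eq: "density \<nu> (indicator {0<..}) = scale_measure (ennreal (\<rho> / H)) (clock (1 / H))"
  proof (rule measure_eqI_lessThan)
    fix x :: real
    have e1: "emeasure (density \<nu> (indicator {0<..})) {x<..} = emeasure \<nu> {max 0 x<..}"
    proof -
      have "emeasure (density \<nu> (indicator {0<..})) {x<..} = (\<integral>\<^sup>+v. indicator {0<..} v * indicator {x<..} v \<partial>\<nu>)"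
        by (rule emeasure_density) (auto simp: s)
      also have "\<dots> = (\<integral>\<^sup>+v. indicator {max 0 x<..} v \<partial>\<nu>)" by (intro nn_integral_cong) (auto simp: indicator_def)
      finally show ?thesis by (simp add: s)
    qed
    have e2: "emeasure (clock (1 / H)) {x<..} = ennreal (exp (- max 0 x / H))"
    proof (cases "x \<ge> 0")
      case True then show ?thesis using clock_tail'[OF H1, of x] by simp
    next
      case False
      have "emeasure (clock (1 / H)) {x<..} = 1"
        using AE_clock[OF H1] False by (intro C.emeasure_eq_1_AE) (auto elim!: AE_mp)
      then show ?thesis using False by simp
    qed
    show "emeasure (density \<nu> (indicator {0<..})) {x<..} < \<infinity>"
      unfolding e1 by (simp add: emeasure_eq_measure)
    show "emeasure (density \<nu> (indicator {0<..})) {x<..} = emeasure (scale_measure (ennreal (\<rho> / H)) (clock (1 / H))) {x<..}"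
      unfolding e1 emeasure_scale_measure e2 using tail[of "max 0 x"] \<rho> H by (subst ennreal_mult[symmetric]) auto
  qed (auto simp: s)
  have "(\<integral>\<^sup>+x. g x \<partial>\<nu>) = (\<integral>\<^sup>+x. g 0 * indicator {0} x + indicator {0<..} x * g x \<partial>\<nu>)"
    by (rule nn_integral_cong_AE, use pos in eventually_elim) (auto simp: indicator_def)
  also have "\<dots> = (\<integral>\<^sup>+x. g 0 * indicator {0} x \<partial>\<nu>) + (\<integral>\<^sup>+x. indicator {0<..} x * g x \<partial>\<nu>)"
    by (rule nn_integral_add) auto
  also have "(\<integral>\<^sup>+x. g 0 * indicator {0} x \<partial>\<nu>) = ennreal (1 - \<rho> / H) * g 0"
    by (subst nn_integral_cmult_indicator) (auto simp: s at0 mult.commute)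
  also have "(\<integral>\<^sup>+x. indicator {0<..} x * g x \<partial>\<nu>) = (\<integral>\<^sup>+x. g x \<partial>density \<nu> (indicator {0<..}))"
    by (rule nn_integral_density[symmetric]) auto
  also have "\<dots> = ennreal (\<rho> / H) * (\<integral>\<^sup>+v. g v \<partial>clock (1 / H))"
    unfolding eq by (rule nn_integral_scale_measure) auto
  finally show ?thesis .
qed

section \<open>Averages over shrinking intervals\<close>

abbreviation right_average :: "nat \<Rightarrow> real \<Rightarrow> (real \<Rightarrow> ennreal) \<Rightarrow> ennreal" where
  "right_average n t G \<equiv> ennreal (real (Suc n)) * (\<integral>\<^sup>+s\<in>{t<..t + 1 / real (Suc n)}. G s \<partial>lborel)"

lemma average_const: "right_average n t (\<lambda>_. c) = c"
proof -
  have "(\<integral>\<^sup>+s\<in>{t<..t + 1 / real (Suc n)}. c \<partial>lborel) = c * ennreal (1 / real (Suc n))"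
    by (subst nn_integral_cmult_indicator) auto
  moreover have "ennreal (real (Suc n)) * ennreal (1 / real (Suc n)) = 1"
    by (subst ennreal_mult[symmetric]) auto
  ultimately show ?thesis by (simp add: mult.left_commute del: of_nat_Suc)
qed

lemma average_mono:
  assumes "\<And>s. t < s \<Longrightarrow> s \<le> t + 1 / real (Suc n) \<Longrightarrow> G s \<le> G' s"
  shows "right_average n t G \<le> right_average n t G'"
  by (intro mult_left_mono nn_integral_mono) (use assms in \<open>auto simp: indicator_def\<close>)

lemma average_tendsto:
  fixes G :: "real \<Rightarrow> ennreal"
  assumes lim: "(G \<longlongrightarrow> c) (at_right t)"
  shows "(\<lambda>n. right_average n t G) \<longlonglongrightarrow> c"
proof -
  have ev: "\<forall>\<^sub>F n in sequentially. \<forall>s. t < s \<and> s \<le> t + 1 / real (Suc n) \<longrightarrow> Q s"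
    if ev_Q: "\<forall>\<^sub>F s in at_right t. Q s" for Q
  proof -
    obtain b where b: "b > t" "\<And>s. t < s \<Longrightarrow> s < b \<Longrightarrow> Q s"
      using ev_Q by (auto simp: eventually_at_right_field)
    have "(\<lambda>n. 1 / real (Suc n)) \<longlonglongrightarrow> 0" using lim_1_over_n[THEN LIMSEQ_Suc] .
    then have "\<forall>\<^sub>F n in sequentially. 1 / real (Suc n) < b - t"
      by (rule order_tendstoD) (use b in simp)
    then show ?thesis by eventually_elim (use b in auto)
  qed
  show ?thesis
  proof (rule order_tendstoI)
    fix a assume "a < c"
    then obtain a' where a': "a < a'" "a' < c" using dense by blast
    have "\<forall>\<^sub>F n in sequentially. \<forall>s. t < s \<and> s \<le> t + 1 / real (Suc n) \<longrightarrow> a' < G s"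
      by (rule ev) (use lim a' in \<open>auto dest: order_tendstoD\<close>)
    then show "\<forall>\<^sub>F n in sequentially. a < right_average n t G"
    proof eventually_elim
      case (elim n)
      have "a' \<le> right_average n t G"
        by (subst average_const[where n = n and t = t and c = a', symmetric], rule average_mono) (use elim in \<open>auto intro: less_imp_le\<close>)
      with a' show ?case by (rule_tac less_le_trans)
    qed
  next
    fix a assume "c < a"
    then obtain a' where a': "c < a'" "a' < a" using dense by blast
    have "\<forall>\<^sub>F n in sequentially. \<forall>s. t < s \<and> s \<le> t + 1 / real (Suc n) \<longrightarrow> G s < a'"
      by (rule ev) (use lim a' in \<open>auto dest: order_tendstoD\<close>)
    then show "\<forall>\<^sub>F n in sequentially. right_average n t G < a"
    proof eventually_elim
      case (elim n)
      have "right_average n t G \<le> a'"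
        by (subst average_const[where n = n and t = t and c = a', symmetric], rule average_mono) (use elim in \<open>auto intro: less_imp_le\<close>)
      with a' show ?case by (rule_tac le_less_trans)
    qed
  qed
qed

section \<open>Additivity and support of the local time\<close>

context local_time_at_zero
begin

text \<open>The local time, extended by zero to negative times, so that a window ending at a small time may
  begin before \<open>0\<close>.\<close>

definition Lp :: "real \<Rightarrow> 'w \<Rightarrow> real" where
  "Lp s \<omega> = L (max 0 s) \<omega>"

lemma Lp_eq: "0 \<le> s \<Longrightarrow> Lp s = L s" by (simp add: Lp_def fun_eq_iff)

lemma Lp_nonpos: "\<omega> \<in> \<Omega> \<Longrightarrow> s \<le> 0 \<Longrightarrow> Lp s \<omega> = 0"
  using L_zero by (simp add: Lp_def max_def)

lemma Lp_mono: "\<omega> \<in> \<Omega> \<Longrightarrow> s \<le> t \<Longrightarrow> Lp s \<omega> \<le> Lp t \<omega>"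
  using L_mono[of \<omega>] by (auto simp: Lp_def mono_on_def)

lemma Lp_nonneg: "\<omega> \<in> \<Omega> \<Longrightarrow> 0 \<le> Lp s \<omega>"
  using Lp_mono[of \<omega> "min 0 s" s] Lp_nonpos[of \<omega> "min 0 s"] by simp

lemma Lp_cont: "\<omega> \<in> \<Omega> \<Longrightarrow> continuous_on A (\<lambda>s. Lp s \<omega>)"
  unfolding Lp_def by (rule continuous_on_compose2[OF L_continuous]) (auto intro!: continuous_intros)

lemma L_F: "0 \<le> t \<Longrightarrow> L t \<in> borel_measurable (F t)"
  using L_adapted by (auto simp: adapted_def)

lemma Lp_F: "0 \<le> t \<Longrightarrow> s \<le> t \<Longrightarrow> Lp s \<in> borel_measurable (F t)"
  unfolding Lp_def by (rule measurable_F_F[OF L_F]) auto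

lemma Lp_measurable_S [measurable (raw)]:
  assumes [measurable]: "f \<in> borel_measurable N" "g \<in> N \<rightarrow>\<^sub>M S"
  shows "(\<lambda>z. Lp (f z) (g z)) \<in> borel_measurable N"
proof -
  have "(\<lambda>(s, \<omega>). Lp s \<omega>) \<in> borel_measurable (borel \<Otimes>\<^sub>M S)"
  proof (rule measurable_continuous_process)
    fix s show "Lp s \<in> borel_measurable S"
      by (rule measurable_F_S[OF Lp_F[of "max 0 s"]]) auto
  qed (auto intro: Lp_cont)
  from measurable_compose[OF _ this, of "\<lambda>z. (f z, g z)" N]
  show ?thesis by simp
qed

lemma id_M_S: "(\<lambda>\<omega>. \<omega>) \<in> M \<rightarrow>\<^sub>M S"
  using S_subset_M by (auto simp: measurable_def)

lemma Lp_measurable_M [measurable (raw)]: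
  assumes [measurable]: "f \<in> borel_measurable N" "g \<in> N \<rightarrow>\<^sub>M M"
  shows "(\<lambda>z. Lp (f z) (g z)) \<in> borel_measurable N"
  by (rule Lp_measurable_S[OF assms(1) measurable_compose[OF assms(2) id_M_S]])

text \<open>Additivity of \<open>L\<close> holds outside a null set that depends on the two times. Tonelli's theorem is
  therefore applied first, and additivity is used at one pair of times for each value of the clock.\<close>

lemma clock_Markov:
  assumes q: "q > 0" and y: "y \<ge> 0" and t: "t \<ge> 0" and V: "V \<in> borel_measurable (F t)"
    and [measurable]: "(\<lambda>(l, d). g l d) \<in> borel_measurable (borel \<Otimes>\<^sub>M borel)"
  shows "(\<integral>\<^sup>+\<omega>. V \<omega> * (\<integral>\<^sup>+s. g (Lp t \<omega>) (Lp (t + s) \<omega> - Lp t \<omega>) \<partial>clock q) \<partial>P y)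
    = (\<integral>\<^sup>+\<omega>. V \<omega> * (\<integral>\<^sup>+\<omega>'. (\<integral>\<^sup>+s. g (Lp t \<omega>) (Lp s \<omega>') \<partial>clock q) \<partial>law (X t \<omega>)) \<partial>P y)"
proof -
  note sets_P[OF y, measurable_cong]
  interpret P: prob_space "P y" by (rule prob_space_P[OF y])
  interpret C: prob_space "clock q" by (rule prob_space_clock[OF q])
  interpret pair_sigma_finite "P y" "clock q" ..
  note V' = measurable_F_M[OF V]
  have VP[measurable]: "V \<in> borel_measurable M" using V' .
  have [measurable]: "Lp t \<in> borel_measurable (F t)" by (rule Lp_F) (use t in auto)
  have th[measurable]: "\<theta> t \<in> M \<rightarrow>\<^sub>M S" using measurable_S_M[OF shift_measurable[OF t]] .
  have [measurable]: "V \<in> borel_measurable (F t)" by fact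
  have "(\<integral>\<^sup>+\<omega>. V \<omega> * (\<integral>\<^sup>+s. g (Lp t \<omega>) (Lp (t + s) \<omega> - Lp t \<omega>) \<partial>clock q) \<partial>P y)
    = (\<integral>\<^sup>+\<omega>. (\<integral>\<^sup>+s. V \<omega> * g (Lp t \<omega>) (Lp (t + s) \<omega> - Lp t \<omega>) \<partial>clock q) \<partial>P y)"
  proof (intro nn_integral_cong nn_integral_cmult[symmetric])
    fix \<omega> assume "\<omega> \<in> space (P y)"
    then have w: "\<omega> \<in> \<Omega>" using y by simp
    have [measurable]: "(\<lambda>s. Lp (t + s) \<omega>) \<in> borel_measurable borel"
      by (intro borel_measurable_continuous_onI continuous_on_compose2[OF Lp_cont[OF w, of UNIV]] continuous_intros) auto
    have "(\<lambda>s. g l (Lp (t + s) \<omega> - l)) \<in> borel_measurable borel" for l by measurable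
    then show "(\<lambda>s. g (Lp t \<omega>) (Lp (t + s) \<omega> - Lp t \<omega>)) \<in> borel_measurable (clock q)" by simp
  qed
  also have "\<dots> = (\<integral>\<^sup>+s. (\<integral>\<^sup>+\<omega>. V \<omega> * g (Lp t \<omega>) (Lp (t + s) \<omega> - Lp t \<omega>) \<partial>P y) \<partial>clock q)"
    by (rule Fubini'[symmetric]) measurable
  also have "\<dots> = (\<integral>\<^sup>+s. (\<integral>\<^sup>+\<omega>. V \<omega> * g (Lp t \<omega>) (Lp s (\<theta> t \<omega>)) \<partial>P y) \<partial>clock q)"
  proof (rule nn_integral_cong_AE, use AE_clock[OF q] in eventually_elim)
    fix s :: real assume s: "0 \<le> s"
    show "(\<integral>\<^sup>+\<omega>. V \<omega> * g (Lp t \<omega>) (Lp (t + s) \<omega> - Lp t \<omega>) \<partial>P y) = (\<integral>\<^sup>+\<omega>. V \<omega> * g (Lp t \<omega>) (Lp s (\<theta> t \<omega>)) \<partial>P y)"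
      by (rule nn_integral_cong_AE, use L_additive[OF y s t] in eventually_elim)
        (use s t in \<open>auto simp: Lp_eq\<close>)
  qed
  also have "\<dots> = (\<integral>\<^sup>+\<omega>. (\<integral>\<^sup>+s. V \<omega> * g (Lp t \<omega>) (Lp s (\<theta> t \<omega>)) \<partial>clock q) \<partial>P y)"
    by (rule Fubini') measurable
  also have "\<dots> = (\<integral>\<^sup>+\<omega>. (\<integral>\<^sup>+\<omega>'. (\<integral>\<^sup>+s. V \<omega> * g (Lp t \<omega>) (Lp s \<omega>') \<partial>clock q) \<partial>law (X t \<omega>)) \<partial>P y)"
    by (rule nn_integral_Markov[OF y t, where W = "\<lambda>\<omega> \<omega>'. (\<integral>\<^sup>+s. V \<omega> * g (Lp t \<omega>) (Lp s \<omega>') \<partial>clock q)"]) measurable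
  also have "\<dots> = (\<integral>\<^sup>+\<omega>. V \<omega> * (\<integral>\<^sup>+\<omega>'. (\<integral>\<^sup>+s. g (Lp t \<omega>) (Lp s \<omega>') \<partial>clock q) \<partial>law (X t \<omega>)) \<partial>P y)"
  proof (intro nn_integral_cong)
    fix \<omega>
    have 1: "(\<lambda>s. g l (Lp s \<omega>')) \<in> borel_measurable (clock q)" if "\<omega>' \<in> \<Omega>" for l \<omega>'
    proof -
      have [measurable]: "(\<lambda>s. Lp s \<omega>') \<in> borel_measurable borel"
        by (intro borel_measurable_continuous_onI Lp_cont that)
      show ?thesis by measurable
    qed
    have 2: "(\<lambda>\<omega>'. (\<integral>\<^sup>+s. g l (Lp s \<omega>') \<partial>clock q)) \<in> borel_measurable (law v)" for l v
      by measurable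
    have "(\<integral>\<^sup>+\<omega>'. (\<integral>\<^sup>+s. V \<omega> * g (Lp t \<omega>) (Lp s \<omega>') \<partial>clock q) \<partial>law (X t \<omega>))
        = (\<integral>\<^sup>+\<omega>'. V \<omega> * (\<integral>\<^sup>+s. g (Lp t \<omega>) (Lp s \<omega>') \<partial>clock q) \<partial>law (X t \<omega>))"
      by (intro nn_integral_cong nn_integral_cmult 1) simp
    also have "\<dots> = V \<omega> * (\<integral>\<^sup>+\<omega>'. (\<integral>\<^sup>+s. g (Lp t \<omega>) (Lp s \<omega>') \<partial>clock q) \<partial>law (X t \<omega>))"
      by (rule nn_integral_cmult[OF 2])
    finally show "(\<integral>\<^sup>+\<omega>'. (\<integral>\<^sup>+s. V \<omega> * g (Lp t \<omega>) (Lp s \<omega>') \<partial>clock q) \<partial>law (X t \<omega>))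
        = V \<omega> * (\<integral>\<^sup>+\<omega>'. (\<integral>\<^sup>+s. g (Lp t \<omega>) (Lp s \<omega>') \<partial>clock q) \<partial>law (X t \<omega>))" .
  qed
  finally show ?thesis .
qed

text \<open>If \<open>L\<close> increases between \<open>a\<close> and \<open>b\<close>, then \<open>dL\<close> charges \<open>(a,b]\<close>, and it is carried by zeros of \<open>X\<close>.
  The null set serves all \<open>a\<close> and \<open>b\<close>, so that they can be taken around a random time.\<close>

lemma zeros_where_local_time_increases:
  assumes y: "y \<ge> 0"
  shows "AE \<omega> in P y. \<forall>a b. 0 \<le> a \<longrightarrow> a < b \<longrightarrow> L a \<omega> < L b \<omega> \<longrightarrow> (\<exists>s. a < s \<and> s \<le> b \<and> X s \<omega> = 0)"
  using L_support[OF y] AE_space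
proof eventually_elim
  case (elim \<omega>)
  then have w: "\<omega> \<in> \<Omega>" using y by simp
  show ?case
  proof (intro allI impI)
    fix a b assume ab: "0 \<le> a" "a < b" "L a \<omega> < L b \<omega>"
    have rc: "\<And>s. s \<ge> 0 \<Longrightarrow> continuous (at_right s) (\<lambda>t. L t \<omega>)"
      using L_continuous[OF w] by (auto simp: continuous_on_eq_continuous_within intro: continuous_within_subset)
    have "emeasure (half_line_measure (\<lambda>t. L t \<omega>)) {a<..b} = ennreal (L b \<omega> - L a \<omega>)"
      using emeasure_half_line_measure_Ioc[OF L_mono[OF w] rc, of a b] ab by simp
    then have pos: "emeasure (half_line_measure (\<lambda>t. L t \<omega>)) {a<..b} \<noteq> 0" using ab by simp
    show "\<exists>s. a < s \<and> s \<le> b \<and> X s \<omega> = 0"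
    proof (rule ccontr)
      assume no: "\<not> ?thesis"
      have "AE t in half_line_measure (\<lambda>t. L t \<omega>). t \<notin> {a<..b}"
        using elim(1) by eventually_elim (use no in auto)
      then have "emeasure (half_line_measure (\<lambda>t. L t \<omega>)) {a<..b} = 0"
        by (subst (asm) AE_iff_measurable[of "{a<..b}"]) auto
      with pos show False by simp
    qed
  qed
qed

text \<open>The last time \<open>\<tau>\<close> at which the local time is at most \<open>u\<close>: the right-continuous inverse of \<open>L\<close>.\<close>

lemma level_crossing:
  assumes w: "\<omega> \<in> \<Omega>" and u: "u \<ge> 0" and v: "u < Lp v \<omega>"
  obtains \<tau> where "\<tau> \<ge> 0" "\<And>s. Lp s \<omega> \<le> u \<longleftrightarrow> s \<le> \<tau>" "Lp \<tau> \<omega> = u"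
proof -
  let ?A = "{s. Lp s \<omega> \<le> u}"
  have cl: "closed ?A"
    by (rule closed_Collect_le[OF Lp_cont[OF w]]) auto
  have bd: "bdd_above ?A"
  proof (rule bdd_aboveI[of _ v])
    fix s assume "s \<in> ?A"
    then show "s \<le> v" using v Lp_mono[OF w, of v s] by (cases "s \<le> v") auto
  qed
  have ne: "0 \<in> ?A" using Lp_nonpos[OF w, of 0] u by simp
  define \<tau> where "\<tau> = Sup ?A"
  have "\<tau> \<in> ?A" unfolding \<tau>_def by (rule closed_contains_Sup[OF _ bd cl]) (use ne in auto)
  then have iff: "Lp s \<omega> \<le> u \<longleftrightarrow> s \<le> \<tau>" for s
    using cSup_upper[OF _ bd, of s] Lp_mono[OF w, of s \<tau>] unfolding \<tau>_def mem_Collect_eq by linarith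
  have t0: "\<tau> \<ge> 0" using ne iff[of 0] by simp
  have "u \<le> Lp \<tau> \<omega>"
  proof (rule tendsto_lowerbound)
    show "((\<lambda>s. Lp s \<omega>) \<longlongrightarrow> Lp \<tau> \<omega>) (at_right \<tau>)"
      using Lp_cont[OF w, of UNIV] by (auto simp: continuous_on_def intro: tendsto_within_subset)
    show "\<forall>\<^sub>F s in at_right \<tau>. u \<le> Lp s \<omega>"
      using eventually_at_right_less[of \<tau>]
    proof eventually_elim
      case (elim s)
      then show ?case using iff[of s] by linarith
    qed
  qed auto
  then have "Lp \<tau> \<omega> = u" using iff[of \<tau>] by simp
  with t0 iff show ?thesis by (rule that)
qed

end

section \<open>The law of the local time at an independent exponential time\<close>

locale local_time_potential = local_time_at_zero M P X \<theta> R L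
  for M :: "'w measure" and P X \<theta> R L +
  fixes q H :: real and \<rho> :: "real \<Rightarrow> real"
  assumes q: "q > 0" and H: "H > 0"
    and rho_cont: "continuous_on {0..} \<rho>" and rho_0: "\<rho> 0 = H"
    and rho_nonneg: "\<And>y. 0 \<le> y \<Longrightarrow> 0 \<le> \<rho> y" and rho_le: "\<And>y. 0 \<le> y \<Longrightarrow> \<rho> y \<le> H"
    and R_rho: "\<And>y. 0 \<le> y \<Longrightarrow> R q y 0 = \<rho> y"
begin

lemma rho_measurable [measurable]: "(\<lambda>x. \<rho> (max 0 x)) \<in> borel_measurable borel"
  by (intro borel_measurable_continuous_onI continuous_on_compose2[OF rho_cont] continuous_intros) auto

lemma mean_local_time:
  assumes y: "y \<ge> 0"
  shows "(\<integral>\<^sup>+\<omega>. (\<integral>\<^sup>+v. ennreal (Lp v \<omega>) \<partial>clock q) \<partial>P y) = ennreal (\<rho> y)"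
proof -
  have "(\<integral>\<^sup>+\<omega>. (\<integral>\<^sup>+v. ennreal (Lp v \<omega>) \<partial>clock q) \<partial>P y)
    = (\<integral>\<^sup>+\<omega>. (\<integral>\<^sup>+t\<in>{0..}. ennreal (exp (- q * t)) \<partial>half_line_measure (\<lambda>t. L t \<omega>)) \<partial>P y)"
    unfolding Lp_def
    by (intro nn_integral_cong Laplace_Stieltjes_by_clock[symmetric] q L_mono L_continuous L_zero) (use y in auto)
  then show ?thesis using L_potential[OF y q] R_rho[OF y] by simp
qed

text \<open>The local time gained above level \<open>l\<close> until the clock rings, averaged over the clock but not over
  the path.\<close>

definition excess :: "'w \<Rightarrow> real \<Rightarrow> ennreal" where
  "excess \<omega> l = (\<integral>\<^sup>+v. ennreal (Lp v \<omega> - l) \<partial>clock q)"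

lemma Lp_path_measurable: "\<omega> \<in> \<Omega> \<Longrightarrow> (\<lambda>v. Lp v \<omega>) \<in> borel_measurable borel"
  by (intro borel_measurable_continuous_onI Lp_cont)

lemma excess_measurable [measurable (raw)]:
  assumes [measurable]: "f \<in> N \<rightarrow>\<^sub>M M" "g \<in> borel_measurable N"
  shows "(\<lambda>z. excess (f z) (g z)) \<in> borel_measurable N"
proof -
  interpret prob_space "clock q" by (rule prob_space_clock[OF q])
  show ?thesis unfolding excess_def by measurable
qed

lemma excess_antimono: "l \<le> l' \<Longrightarrow> excess \<omega> l' \<le> excess \<omega> l"
  unfolding excess_def by (intro nn_integral_mono ennreal_leI) auto

lemma excess_shift:
  assumes w: "\<omega> \<in> \<Omega>" and t: "t \<ge> 0"
  shows "excess \<omega> (Lp t \<omega>) = ennreal (exp (- q * t)) * (\<integral>\<^sup>+s. ennreal (Lp (t + s) \<omega> - Lp t \<omega>) \<partial>clock q)"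
proof -
  have [measurable]: "(\<lambda>v. Lp v \<omega>) \<in> borel_measurable borel" by (rule Lp_path_measurable[OF w])
  have "excess \<omega> (Lp t \<omega>) = (\<integral>\<^sup>+v\<in>{t..}. ennreal (Lp v \<omega> - Lp t \<omega>) \<partial>clock q)"
    unfolding excess_def
    by (intro nn_integral_cong) (use Lp_mono[OF w] in \<open>auto simp: indicator_def ennreal_neg\<close>)
  also have "\<dots> = ennreal (exp (- q * t)) * (\<integral>\<^sup>+s. ennreal (Lp (t + s) \<omega> - Lp t \<omega>) \<partial>clock q)"
    by (rule clock_shift) (use q t in auto)
  finally show ?thesis .
qed

text \<open>The excess over the current level \<open>L\<^sub>t\<close> is collected by the path after \<open>t\<close>, and its mean is the
  potential \<open>\<rho>\<close> of the local time, discounted by the chance that the clock has not rung by \<open>t\<close>.\<close>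

lemma excess_Markov:
  assumes y: "y \<ge> 0" and t: "t \<ge> 0" and V: "V \<in> borel_measurable (F t)"
  shows "(\<integral>\<^sup>+\<omega>. V \<omega> * excess \<omega> (Lp t \<omega>) \<partial>P y) = (\<integral>\<^sup>+\<omega>. V \<omega> * ennreal (exp (- q * t) * \<rho> (X t \<omega>)) \<partial>P y)"
proof -
  let ?V = "\<lambda>\<omega>. V \<omega> * ennreal (exp (- q * t))"
  have "(\<integral>\<^sup>+\<omega>. V \<omega> * excess \<omega> (Lp t \<omega>) \<partial>P y)
    = (\<integral>\<^sup>+\<omega>. ?V \<omega> * (\<integral>\<^sup>+s. ennreal (Lp (t + s) \<omega> - Lp t \<omega>) \<partial>clock q) \<partial>P y)"
    by (intro nn_integral_cong) (use y in \<open>simp add: excess_shift t mult.assoc\<close>)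
  also have "\<dots> = (\<integral>\<^sup>+\<omega>. ?V \<omega> * (\<integral>\<^sup>+\<omega>'. (\<integral>\<^sup>+s. ennreal (Lp s \<omega>') \<partial>clock q) \<partial>law (X t \<omega>)) \<partial>P y)"
    by (rule clock_Markov[OF q y t, where g = "\<lambda>l d. ennreal d"]) (use V in measurable)
  also have "\<dots> = (\<integral>\<^sup>+\<omega>. V \<omega> * ennreal (exp (- q * t) * \<rho> (X t \<omega>)) \<partial>P y)"
  proof (intro nn_integral_cong)
    fix \<omega> assume "\<omega> \<in> space (P y)"
    then have X0: "X t \<omega> \<ge> 0" using y t X_nonneg by simp
    interpret prob_space "clock q" by (rule prob_space_clock[OF q])
    have "(\<integral>\<^sup>+\<omega>'. (\<integral>\<^sup>+s. ennreal (Lp s \<omega>') \<partial>clock q) \<partial>law (X t \<omega>)) = ennreal (\<rho> (X t \<omega>))"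
      by (subst nn_integral_law[OF X0]) (auto simp: mean_local_time[OF X0])
    then show "?V \<omega> * (\<integral>\<^sup>+\<omega>'. (\<integral>\<^sup>+s. ennreal (Lp s \<omega>') \<partial>clock q) \<partial>law (X t \<omega>)) = V \<omega> * ennreal (exp (- q * t) * \<rho> (X t \<omega>))"
      using rho_nonneg[OF X0] by (simp add: ennreal_mult mult.assoc)
  qed
  finally show ?thesis .
qed

abbreviation "discounted \<omega> s \<equiv> ennreal (exp (- q * s) * \<rho> (X s \<omega>))"
abbreviation "excess_at \<omega> s \<equiv> excess \<omega> (Lp s \<omega>)"
abbreviation "mass_above u \<omega> \<equiv> emeasure (clock q) {v. u < Lp v \<omega>}"

text \<open>Indicator that \<open>L\<close> passes level \<open>u\<close> in the window of length \<open>1/(n+1)\<close> that ends at \<open>s\<close>. It is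
  determined by the path up to \<open>s\<close>; as a function of \<open>s\<close> it is the indicator of
  \<open>(\<tau>, \<tau> + 1/(n+1)]\<close>, with \<open>\<tau>\<close> the passage time. Integration over \<open>s\<close> thus replaces evaluation at
  the random time \<open>\<tau>\<close> by an average over fixed times.\<close>

definition passage :: "real \<Rightarrow> nat \<Rightarrow> real \<Rightarrow> 'w \<Rightarrow> ennreal" where
  "passage u n s \<omega> = (if Lp (s - 1 / real (Suc n)) \<omega> \<le> u \<and> u < Lp s \<omega> then 1 else 0)"

lemma passage_F: "s \<ge> 0 \<Longrightarrow> passage u n s \<in> borel_measurable (F s)"
proof -
  assume s: "s \<ge> 0"
  have [measurable]: "Lp s \<in> borel_measurable (F s)" "Lp (s - 1 / real (Suc n)) \<in> borel_measurable (F s)"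
    using s by (auto intro!: Lp_F)
  show ?thesis unfolding passage_def by measurable
qed

lemma passage_measurable [measurable (raw)]:
  assumes [measurable]: "f \<in> borel_measurable N" "g \<in> N \<rightarrow>\<^sub>M M"
  shows "(\<lambda>z. passage u n (f z) (g z)) \<in> borel_measurable N"
  unfolding passage_def by measurable

abbreviation "smooth u n G \<omega> \<equiv> ennreal (real (Suc n)) * (\<integral>\<^sup>+s\<in>{0..}. passage u n s \<omega> * G s \<partial>lborel)"

lemma passage_crossing:
  assumes \<tau>: "\<tau> \<ge> 0" "\<And>s. Lp s \<omega> \<le> u \<longleftrightarrow> s \<le> \<tau>"
  shows "smooth u n G \<omega> = right_average n \<tau> G"
proof -
  have "u < Lp s \<omega> \<longleftrightarrow> \<tau> < s" for s using \<tau>(2)[of s] by linarith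
  then have "passage u n s \<omega> * G s * indicator {0..} s = G s * indicator {\<tau><..\<tau> + 1 / real (Suc n)} s" for s
    using \<tau> by (auto simp: passage_def indicator_def)
  then show ?thesis by simp
qed

lemma passage_no_crossing:
  assumes "\<And>v. Lp v \<omega> \<le> u"
  shows "smooth u n G \<omega> = 0"
proof -
  have "passage u n s \<omega> = 0" for s using assms[of s] by (simp add: passage_def)
  then show ?thesis by simp
qed

lemma smooth_le:
  assumes w: "\<omega> \<in> \<Omega>" and u: "u \<ge> 0" and G: "\<And>s. s \<ge> 0 \<Longrightarrow> G s \<le> K"
  shows "smooth u n G \<omega> \<le> K"
proof (cases "\<exists>v. u < Lp v \<omega>")
  case True
  then obtain v where "u < Lp v \<omega>" by blast
  then obtain \<tau> where \<tau>: "\<tau> \<ge> 0" "\<And>s. Lp s \<omega> \<le> u \<longleftrightarrow> s \<le> \<tau>" "Lp \<tau> \<omega> = u" using level_crossing[OF w u] by blast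
  have "smooth u n G \<omega> \<le> right_average n \<tau> (\<lambda>_. K)"
    unfolding passage_crossing[OF \<tau>(1,2)] by (rule average_mono) (use G \<tau> in auto)
  then show ?thesis by (simp only: average_const)
next
  case False
  then have "\<And>v. Lp v \<omega> \<le> u" by (auto simp: not_less)
  then show ?thesis by (simp only: passage_no_crossing zero_le)
qed

lemma excess_tendsto:
  assumes w: "\<omega> \<in> \<Omega>" and fin: "excess \<omega> 0 < \<infinity>"
    and sq: "\<And>i. sq i \<ge> (0::real)" "sq \<longlonglongrightarrow> l"
  shows "(\<lambda>i. excess \<omega> (sq i)) \<longlonglongrightarrow> excess \<omega> l"
  unfolding excess_def
proof (rule nn_integral_dominated_convergence[where w = "\<lambda>v. ennreal (Lp v \<omega> - 0)"])
  have [measurable]: "(\<lambda>v. Lp v \<omega>) \<in> borel_measurable borel" by (rule Lp_path_measurable[OF w])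
  show "(\<lambda>v. ennreal (Lp v \<omega> - sq i)) \<in> borel_measurable (clock q)" for i by measurable
  show "(\<lambda>v. ennreal (Lp v \<omega> - l)) \<in> borel_measurable (clock q)" by measurable
  show "(\<lambda>v. ennreal (Lp v \<omega> - 0)) \<in> borel_measurable (clock q)" by measurable
  show "AE v in clock q. ennreal (Lp v \<omega> - sq i) \<le> ennreal (Lp v \<omega> - 0)" for i
    using sq(1)[of i] by (intro AE_I2 ennreal_leI) auto
  show "(\<integral>\<^sup>+v. ennreal (Lp v \<omega> - 0) \<partial>clock q) < \<infinity>" using fin by (simp add: excess_def)
  show "AE v in clock q. (\<lambda>i. ennreal (Lp v \<omega> - sq i)) \<longlonglongrightarrow> ennreal (Lp v \<omega> - l)"
    by (intro AE_I2 tendsto_ennrealI tendsto_intros sq)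
qed

lemma smooth_excess_tendsto:
  assumes w: "\<omega> \<in> \<Omega>" and u: "u \<ge> 0" and fin: "excess \<omega> 0 < \<infinity>"
  shows "(\<lambda>n. smooth u n (excess_at \<omega>) \<omega>) \<longlonglongrightarrow> excess \<omega> u"
proof (cases "\<exists>v. u < Lp v \<omega>")
  case True
  then obtain v where "u < Lp v \<omega>" by blast
  then obtain \<tau> where \<tau>: "\<tau> \<ge> 0" "\<And>s. Lp s \<omega> \<le> u \<longleftrightarrow> s \<le> \<tau>" "Lp \<tau> \<omega> = u" using level_crossing[OF w u] by blast
  have "((excess_at \<omega>) \<longlongrightarrow> excess \<omega> (Lp \<tau> \<omega>)) (at_right \<tau>)"
    unfolding tendsto_at_iff_sequentially comp_def
  proof (intro allI impI)
    fix sq :: "nat \<Rightarrow> real" assume sq: "\<forall>i. sq i \<in> {\<tau><..} - {\<tau>}" "sq \<longlonglongrightarrow> \<tau>"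
    have "(\<lambda>i. Lp (sq i) \<omega>) \<longlonglongrightarrow> Lp \<tau> \<omega>"
      by (rule continuous_on_tendsto_compose[OF Lp_cont[OF w, of UNIV] sq(2)]) auto
    then show "(\<lambda>i. excess \<omega> (Lp (sq i) \<omega>)) \<longlonglongrightarrow> excess \<omega> (Lp \<tau> \<omega>)"
      by (intro excess_tendsto w fin Lp_nonneg)
  qed
  then show ?thesis
    unfolding passage_crossing[OF \<tau>(1,2)] \<tau>(3) by (rule average_tendsto)
next
  case False
  then have le: "\<And>v. Lp v \<omega> \<le> u" by (auto simp: not_less)
  then have "excess \<omega> u = 0" by (simp add: excess_def ennreal_neg)
  then show ?thesis by (simp only: passage_no_crossing[OF le] tendsto_const)
qed

text \<open>\<open>L\<close> increases immediately after \<open>\<tau>\<close>, so zeros of \<open>X\<close> accumulate at \<open>\<tau>\<close> and \<open>X\<close> vanishes there. The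
  limit \<open>exp(-q\<tau>) \<rho>(0)\<close> is \<open>H\<close> times the chance that the clock rings after \<open>\<tau>\<close>, that is, when the
  local time exceeds \<open>u\<close>.\<close>

lemma smooth_rho_tendsto:
  assumes w: "\<omega> \<in> \<Omega>" and u: "u \<ge> 0"
    and supp: "\<forall>a b. 0 \<le> a \<longrightarrow> a < b \<longrightarrow> L a \<omega> < L b \<omega> \<longrightarrow> (\<exists>s. a < s \<and> s \<le> b \<and> X s \<omega> = 0)"
  shows "(\<lambda>n. smooth u n (discounted \<omega>) \<omega>)
    \<longlonglongrightarrow> ennreal H * mass_above u \<omega>"
proof (cases "\<exists>v. u < Lp v \<omega>")
  case True
  then obtain v where "u < Lp v \<omega>" by blast
  then obtain \<tau> where \<tau>: "\<tau> \<ge> 0" "\<And>s. Lp s \<omega> \<le> u \<longleftrightarrow> s \<le> \<tau>" "Lp \<tau> \<omega> = u" using level_crossing[OF w u] by blast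
  have Xc: "((\<lambda>s. X s \<omega>) \<longlongrightarrow> X \<tau> \<omega>) (at \<tau> within {0..})"
    using X_continuous[OF w] \<tau>(1) by (auto simp: continuous_on_def)
  have ex: "\<exists>s. \<tau> < s \<and> s \<le> \<tau> + 1 / real (Suc n) \<and> X s \<omega> = 0" for n
  proof -
    have "L \<tau> \<omega> < L (\<tau> + 1 / real (Suc n)) \<omega>"
    proof -
      have "\<not> \<tau> + 1 / real (Suc n) \<le> \<tau>" by simp
      then have "u < Lp (\<tau> + 1 / real (Suc n)) \<omega>" using \<tau>(2)[of "\<tau> + 1 / real (Suc n)"] by linarith
      then show ?thesis using \<tau>(1,3) by (simp add: Lp_eq)
    qed
    then show ?thesis using supp \<tau>(1) by simp
  qed
  then obtain sq where sq: "\<And>n. \<tau> < sq n" "\<And>n. sq n \<le> \<tau> + 1 / real (Suc n)" "\<And>n. X (sq n) \<omega> = 0" by metis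
  have "sq \<longlonglongrightarrow> \<tau>"
  proof (rule tendsto_sandwich[of "\<lambda>_. \<tau>" sq sequentially "\<lambda>n. \<tau> + 1 / real (Suc n)" \<tau>])
    have "(\<lambda>n. \<tau> + 1 / real (Suc n)) \<longlonglongrightarrow> \<tau> + 0"
      by (intro tendsto_intros lim_1_over_n[THEN LIMSEQ_Suc])
    then show "(\<lambda>n. \<tau> + 1 / real (Suc n)) \<longlonglongrightarrow> \<tau>" by simp
  qed (use sq less_imp_le[OF sq(1)] in \<open>auto intro!: always_eventually simp del: of_nat_Suc\<close>)
  moreover have "0 \<le> sq n" for n using \<tau>(1) sq(1)[of n] by linarith
  ultimately have "(\<lambda>n. X (sq n) \<omega>) \<longlonglongrightarrow> X \<tau> \<omega>"
    using \<tau>(1) by (intro continuous_on_tendsto_compose[OF X_continuous[OF w]]) auto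
  then have X0: "X \<tau> \<omega> = 0" using sq(3) by (simp add: LIMSEQ_const_iff)
  have "((discounted \<omega>) \<longlongrightarrow> ennreal (exp (- q * \<tau>) * \<rho> (X \<tau> \<omega>))) (at \<tau> within {0..})"
  proof (intro tendsto_ennrealI tendsto_mult)
    show "((\<lambda>s. \<rho> (X s \<omega>)) \<longlongrightarrow> \<rho> (X \<tau> \<omega>)) (at \<tau> within {0..})"
      by (rule continuous_on_tendsto_compose[OF rho_cont Xc])
        (auto simp: X0 eventually_at_filter X_nonneg[OF _ w])
  qed (intro tendsto_intros)
  then have "((discounted \<omega>) \<longlongrightarrow> ennreal (exp (- q * \<tau>) * H)) (at_right \<tau>)"
    unfolding X0 rho_0 by (rule tendsto_within_subset) (use \<tau>(1) in auto)
  moreover have "ennreal H * mass_above u \<omega> = ennreal (exp (- q * \<tau>) * H)"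
  proof -
    have "u < Lp v \<omega> \<longleftrightarrow> \<tau> < v" for v using \<tau>(2)[of v] by linarith
    then have "{v. u < Lp v \<omega>} = {\<tau><..}" by auto
    then show ?thesis using clock_tail'[OF q \<tau>(1)] H by (simp add: ennreal_mult mult.commute)
  qed
  ultimately show ?thesis
    unfolding passage_crossing[OF \<tau>(1,2)] by (simp only:) (rule average_tendsto)
next
  case False
  then have le: "\<And>v. Lp v \<omega> \<le> u" by (auto simp: not_less)
  then have "{v. u < Lp v \<omega>} = {}" by (auto simp: not_less)
  then show ?thesis by (simp only: passage_no_crossing[OF le] tendsto_const emeasure_empty mult_zero_right)
qed

text \<open>The Markov property at each fixed \<open>s\<close> shows that the smoothed excess and the smoothed discounted
  potential have the same mean. The first is dominated by the excess over level \<open>0\<close>, which has mean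
  \<open>\<rho>(y)\<close>, and the second by \<open>H\<close>.\<close>

lemma excess_identity:
  assumes y: "y \<ge> 0" and u: "u \<ge> 0"
  shows "(\<integral>\<^sup>+\<omega>. excess \<omega> u \<partial>P y) = ennreal H * (\<integral>\<^sup>+\<omega>. mass_above u \<omega> \<partial>P y)"
proof -
  note sets_P[OF y, measurable_cong]
  interpret P: prob_space "P y" by (rule prob_space_P[OF y])
  interpret C: prob_space "clock q" by (rule prob_space_clock[OF q])
  interpret PL: pair_sigma_finite "P y" lborel ..
  have Xc: "(\<lambda>(s, \<omega>). X (max 0 s) \<omega>) \<in> borel_measurable (borel \<Otimes>\<^sub>M M)"
  proof (rule measurable_continuous_process)
    show "\<omega> \<in> space M \<Longrightarrow> continuous_on UNIV (\<lambda>s. X (max 0 s) \<omega>)" for \<omega>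
      by (rule continuous_on_compose2[OF X_continuous]) (auto intro!: continuous_intros)
  qed (auto intro: X_measurable)
  let ?I = "\<lambda>n \<omega>. smooth u n (excess_at \<omega>) \<omega>"
  let ?J = "\<lambda>n \<omega>. smooth u n (discounted \<omega>) \<omega>"
  have Jm: "(\<lambda>(\<omega>, s). passage u n s \<omega> * discounted \<omega> s * indicator {0..} s)
      \<in> borel_measurable (P y \<Otimes>\<^sub>M lborel)" for n
  proof -
    have XX[measurable]: "(\<lambda>z. X (max 0 (snd z)) (fst z)) \<in> borel_measurable (P y \<Otimes>\<^sub>M lborel)"
      using measurable_compose[OF _ Xc, of "\<lambda>z. (snd z, fst z)" "P y \<Otimes>\<^sub>M lborel"] by simp

    have "(\<lambda>z. passage u n (snd z) (fst z) * ennreal (exp (- q * snd z) * \<rho> (max 0 (X (max 0 (snd z)) (fst z)))) * indicator {0..} (snd z))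
       \<in> borel_measurable (P y \<Otimes>\<^sub>M lborel)"
      by measurable
    then show ?thesis
      by (rule measurable_cong[THEN iffD1, rotated])
        (use y X_nonneg in \<open>auto simp: indicator_def space_pair_measure max_def\<close>)
  qed
  have Im: "(\<lambda>(\<omega>, s). passage u n s \<omega> * excess_at \<omega> s * indicator {0..} s) \<in> borel_measurable (P y \<Otimes>\<^sub>M lborel)" for n
    by measurable
  have eq: "(\<integral>\<^sup>+\<omega>. ?I n \<omega> \<partial>P y) = (\<integral>\<^sup>+\<omega>. ?J n \<omega> \<partial>P y)" for n
  proof -
    have m1: "(\<lambda>\<omega>. \<integral>\<^sup>+s. passage u n s \<omega> * excess_at \<omega> s * indicator {0..} s \<partial>lborel) \<in> borel_measurable (P y)"
      using lborel.borel_measurable_nn_integral[OF Im[of n]] .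
    have m2: "(\<lambda>\<omega>. \<integral>\<^sup>+s. passage u n s \<omega> * discounted \<omega> s * indicator {0..} s \<partial>lborel) \<in> borel_measurable (P y)"
      using lborel.borel_measurable_nn_integral[OF Jm[of n]] .
    have "(\<integral>\<^sup>+\<omega>. (\<integral>\<^sup>+s\<in>{0..}. passage u n s \<omega> * excess_at \<omega> s \<partial>lborel) \<partial>P y)
      = (\<integral>\<^sup>+s. (\<integral>\<^sup>+\<omega>. passage u n s \<omega> * excess_at \<omega> s * indicator {0..} s \<partial>P y) \<partial>lborel)"
      by (rule PL.Fubini'[symmetric, OF Im])
    also have "\<dots> = (\<integral>\<^sup>+s. (\<integral>\<^sup>+\<omega>. passage u n s \<omega> * discounted \<omega> s * indicator {0..} s \<partial>P y) \<partial>lborel)"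
    proof (rule nn_integral_cong)
      fix s :: real
      show "(\<integral>\<^sup>+\<omega>. passage u n s \<omega> * excess_at \<omega> s * indicator {0..} s \<partial>P y)
         = (\<integral>\<^sup>+\<omega>. passage u n s \<omega> * discounted \<omega> s * indicator {0..} s \<partial>P y)"
        using excess_Markov[OF y, of s "passage u n s"] passage_F[of s u n] by (cases "s \<ge> 0") simp_all
    qed
    also have "\<dots> = (\<integral>\<^sup>+\<omega>. (\<integral>\<^sup>+s\<in>{0..}. passage u n s \<omega> * discounted \<omega> s \<partial>lborel) \<partial>P y)"
      by (rule PL.Fubini'[OF Jm])
    finally show ?thesis
      using m1 m2 by (simp only: nn_integral_cmult)
  qed
  have e0: "(\<integral>\<^sup>+\<omega>. excess \<omega> 0 \<partial>P y) = ennreal (\<rho> y)"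
    using mean_local_time[OF y] by (simp add: excess_def)
  have fin: "AE \<omega> in P y. excess \<omega> 0 < \<infinity>"
    using nn_integral_noteq_infinite[of "\<lambda>\<omega>. excess \<omega> 0" "P y"] e0 by (auto simp: less_top)
  have "(\<lambda>n. \<integral>\<^sup>+\<omega>. ?I n \<omega> \<partial>P y) \<longlonglongrightarrow> (\<integral>\<^sup>+\<omega>. excess \<omega> u \<partial>P y)"
  proof (rule nn_integral_dominated_convergence[where w = "\<lambda>\<omega>. excess \<omega> 0"])
    show "?I n \<in> borel_measurable (P y)" for n
      using lborel.borel_measurable_nn_integral[OF Im[of n]] by measurable
    show "AE \<omega> in P y. ?I n \<omega> \<le> excess \<omega> 0" for n
      by (rule AE_I2, rule smooth_le) (use y u excess_antimono[OF Lp_nonneg] in auto)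
    show "(\<integral>\<^sup>+\<omega>. excess \<omega> 0 \<partial>P y) < \<infinity>" using e0 by simp
    show "AE \<omega> in P y. (\<lambda>n. ?I n \<omega>) \<longlonglongrightarrow> excess \<omega> u"
      using fin AE_space by eventually_elim (rule smooth_excess_tendsto, use y u in auto)
  qed measurable
  moreover have "(\<lambda>n. \<integral>\<^sup>+\<omega>. ?J n \<omega> \<partial>P y) \<longlonglongrightarrow> (\<integral>\<^sup>+\<omega>. ennreal H * mass_above u \<omega> \<partial>P y)"
  proof (rule nn_integral_dominated_convergence[where w = "\<lambda>\<omega>. ennreal H"])
    show "?J n \<in> borel_measurable (P y)" for n
      using lborel.borel_measurable_nn_integral[OF Jm[of n]] by measurable
    show "AE \<omega> in P y. ?J n \<omega> \<le> ennreal H" for n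
    proof (rule AE_I2, rule smooth_le)
      fix \<omega> s assume ws: "\<omega> \<in> space (P y)" "(s::real) \<ge> 0"
      then have X0: "0 \<le> X s \<omega>" using X_nonneg y by simp
      have "exp (- q * s) * \<rho> (X s \<omega>) \<le> 1 * H"
        using rho_nonneg[OF X0] rho_le[OF X0] q ws(2) by (intro mult_mono) auto
      then show "discounted \<omega> s \<le> ennreal H" by (simp add: ennreal_leI)
    qed (use y u in auto)
    show "(\<integral>\<^sup>+\<omega>. ennreal H \<partial>P y) < \<infinity>" using P.emeasure_space_1 y by simp
    show "AE \<omega> in P y. (\<lambda>n. ?J n \<omega>) \<longlonglongrightarrow> ennreal H * mass_above u \<omega>"
      using zeros_where_local_time_increases[OF y] AE_space by eventually_elim (rule smooth_rho_tendsto, use y u in auto)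
    show "(\<lambda>\<omega>. ennreal H * mass_above u \<omega>) \<in> borel_measurable (P y)"
      by measurable
  qed measurable
  ultimately have "(\<integral>\<^sup>+\<omega>. excess \<omega> u \<partial>P y) = (\<integral>\<^sup>+\<omega>. ennreal H * mass_above u \<omega> \<partial>P y)"
    unfolding eq by (rule LIMSEQ_unique)
  also have "\<dots> = ennreal H * (\<integral>\<^sup>+\<omega>. mass_above u \<omega> \<partial>P y)"
    by (rule nn_integral_cmult) measurable
  finally show ?thesis .
qed

text \<open>The atom at \<open>0\<close> has as its mass the probability that \<open>X\<close> gains no local time at \<open>0\<close> before the clock
  rings; otherwise the local time at the clock is exponential with mean \<open>H\<close>.\<close>

lemma law_of_local_time_at_clock:
  assumes y: "y \<ge> 0" and g[measurable]: "g \<in> borel_measurable borel"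
  shows "(\<integral>\<^sup>+\<omega>. (\<integral>\<^sup>+s. g (Lp s \<omega>) \<partial>clock q) \<partial>P y)
    = ennreal (1 - \<rho> y / H) * g 0 + ennreal (\<rho> y / H) * (\<integral>\<^sup>+v. g v \<partial>clock (1 / H))"
proof -
  note sets_P[OF y, measurable_cong]
  interpret P: prob_space "P y" by (rule prob_space_P[OF y])
  interpret C: prob_space "clock q" by (rule prob_space_clock[OF q])
  interpret PC: pair_prob_space "P y" "clock q" ..
  define \<nu> where "\<nu> = distr (P y \<Otimes>\<^sub>M clock q) borel (\<lambda>z. Lp (snd z) (fst z))"
  have m: "(\<lambda>z. Lp (snd z) (fst z)) \<in> borel_measurable (P y \<Otimes>\<^sub>M clock q)" by measurable
  have int: "(\<integral>\<^sup>+x. k x \<partial>\<nu>) = (\<integral>\<^sup>+\<omega>. (\<integral>\<^sup>+s. k (Lp s \<omega>) \<partial>clock q) \<partial>P y)" if [measurable]: "k \<in> borel_measurable borel" for k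
    unfolding \<nu>_def by (subst nn_integral_distr[OF m]) (auto simp: C.nn_integral_fst[symmetric])
  have nP: "prob_space \<nu>" unfolding \<nu>_def by (rule PC.prob_space_distr[OF m])
  have ns: "sets \<nu> = sets borel" by (simp add: \<nu>_def)
  have pos: "AE x in \<nu>. 0 \<le> x"
    unfolding \<nu>_def by (subst AE_distr_iff[OF m]) (auto intro!: AE_I2 Lp_nonneg simp: space_pair_measure y)
  have mean: "(\<integral>\<^sup>+x. ennreal x \<partial>\<nu>) = ennreal (\<rho> y)" by (simp add: int mean_local_time[OF y])
  have exc: "(\<integral>\<^sup>+x. ennreal (x - u) \<partial>\<nu>) = ennreal H * emeasure \<nu> {u<..}" if u: "u \<ge> 0" for u
  proof -
    have "(\<integral>\<^sup>+x. ennreal (x - u) \<partial>\<nu>) = (\<integral>\<^sup>+\<omega>. excess \<omega> u \<partial>P y)" by (simp add: int excess_def)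
    also have "\<dots> = ennreal H * (\<integral>\<^sup>+\<omega>. mass_above u \<omega> \<partial>P y)" by (rule excess_identity[OF y u])
    also have "(\<integral>\<^sup>+\<omega>. mass_above u \<omega> \<partial>P y) = (\<integral>\<^sup>+\<omega>. (\<integral>\<^sup>+v. indicator {u<..} (Lp v \<omega>) \<partial>clock q) \<partial>P y)"
    proof (rule nn_integral_cong)
      fix \<omega> assume "\<omega> \<in> space (P y)"
      then have [measurable]: "(\<lambda>v. Lp v \<omega>) \<in> borel_measurable borel" using y by (intro Lp_path_measurable) simp
      have s: "{v. u < Lp v \<omega>} \<in> sets (clock q)" by measurable
      have "(\<integral>\<^sup>+v. indicator {u<..} (Lp v \<omega>) \<partial>clock q) = (\<integral>\<^sup>+v. indicator {v. u < Lp v \<omega>} v \<partial>clock q)"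
        by (intro nn_integral_cong) (auto simp: indicator_def)
      then show "mass_above u \<omega> = (\<integral>\<^sup>+v. indicator {u<..} (Lp v \<omega>) \<partial>clock q)" using s by simp
    qed
    also have "\<dots> = (\<integral>\<^sup>+x. indicator {u<..} x \<partial>\<nu>)" by (rule int[symmetric]) measurable
    finally show ?thesis by (simp add: ns)
  qed
  show ?thesis
    unfolding int[OF g, symmetric]
    by (rule nn_integral_of_mean_excess[OF nP ns pos H rho_nonneg[OF y] mean exc g])
qed

end

section \<open>The conditional expectations at small rates\<close>

locale penalization = krein_feller_resolvent m \<phi> \<psi> + local_time_at_zero M P X \<theta> "resolvent_density \<phi> \<psi>" L
  for m \<phi> \<psi> and M :: "'w measure" and P X \<theta> L +
  fixes f :: "real \<Rightarrow> real" and x :: real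
  assumes x: "x \<ge> 0"
    and f_nonneg: "\<And>u. u \<ge> 0 \<Longrightarrow> f u \<ge> 0"
    and f_integrable: "set_integrable lborel {0..} f"
begin

lemma local_time_potential_rho: "q > 0 \<Longrightarrow> local_time_potential M P X \<theta> (resolvent_density \<phi> \<psi>) L q (H q) (\<rho> q)"
  by unfold_locales
    (use krein_feller.cont[OF kf_w] rho_0 rho_nonneg rho_le_H H_pos resolvent_density_eq in auto)

text \<open>Only \<open>f\<close> restricted to \<open>[0,\<infinity>)\<close> is known to be measurable; this extension is Borel on the line.\<close>

definition f0 :: "real \<Rightarrow> real" where "f0 u = (if 0 \<le> u then f u else 0)"

lemma f0_eq: "0 \<le> u \<Longrightarrow> f0 u = f u" by (simp add: f0_def)

lemma f0_nonneg: "0 \<le> f0 u" by (simp add: f0_def f_nonneg)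

lemma f0_indicator: "f0 = (\<lambda>u. indicator {0..} u *\<^sub>R f u)"
  by (auto simp: f0_def indicator_def)

lemma f0_integrable: "integrable lborel f0"
  using f_integrable unfolding f0_indicator set_integrable_def .

lemma f0_measurable [measurable]: "f0 \<in> borel_measurable borel"
  using borel_measurable_integrable[OF f0_integrable] by simp

definition tail :: "real \<Rightarrow> real \<Rightarrow> real" where
  "tail c l = (LINT v|lborel. indicator {0..} v * (exp (- c * v) * f0 (l + v)))"

lemma f0_shift_integrable: "integrable lborel (\<lambda>v. f0 (l + v))"
  using lborel_integrable_real_affine[OF f0_integrable, of 1 l] by simp

lemma tail_integrable: "c \<ge> 0 \<Longrightarrow> integrable lborel (\<lambda>v. indicator {0..} v * (exp (- c * v) * f0 (l + v)))"
proof (rule Bochner_Integration.integrable_bound[OF f0_shift_integrable[of l]])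
  assume c: "c \<ge> 0"
  show "AE v in lborel. norm (indicator {0..} v * (exp (- c * v) * f0 (l + v))) \<le> norm (f0 (l + v))"
    using c f0_nonneg by (intro AE_I2) (auto simp: indicator_def abs_mult intro!: mult_left_le_one_le)
qed measurable

lemma tail_nonneg: "0 \<le> tail c l"
  unfolding tail_def by (intro Bochner_Integration.integral_nonneg) (auto simp: f0_nonneg)

lemma tail_le: "c \<ge> 0 \<Longrightarrow> tail c l \<le> (LINT v|lborel. f0 v)"
proof -
  assume c: "c \<ge> 0"
  have "tail c l \<le> (LINT v|lborel. f0 (l + v))"
    unfolding tail_def
    by (rule integral_mono[OF tail_integrable[OF c] f0_shift_integrable])
      (use c f0_nonneg in \<open>auto simp: indicator_def intro!: mult_left_le_one_le\<close>)
  also have "\<dots> = (LINT v|lborel. f0 v)"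
    using lborel_integral_real_affine[of 1 f0 l] by simp
  finally show ?thesis .
qed

lemma tail_measurable [measurable]: "tail c \<in> borel_measurable borel"
  unfolding tail_def by measurable

lemma tail_tendsto:
  assumes c: "\<And>n. c n \<ge> 0" "c \<longlonglongrightarrow> 0"
  shows "(\<lambda>n. tail (c n) l) \<longlonglongrightarrow> tail 0 l"
  unfolding tail_def
proof (rule integral_dominated_convergence[OF _ _ f0_shift_integrable[of l]])
  show "AE v in lborel. norm (indicator {0..} v * (exp (- c n * v) * f0 (l + v))) \<le> f0 (l + v)" for n
    using c f0_nonneg by (intro AE_I2) (auto simp: indicator_def abs_mult intro!: mult_left_le_one_le)
  show "AE v in lborel. (\<lambda>n. indicator {0..} v * (exp (- c n * v) * f0 (l + v)))
      \<longlonglongrightarrow> indicator {0..} v * (exp (- 0 * v) * f0 (l + v))"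
    by (intro AE_I2 tendsto_intros c)
qed measurable

text \<open>\<open>K q y l\<close> is \<open>H(q)\<close> times the mean of \<open>f(l + L)\<close> at an independent clock of rate \<open>q\<close>, for \<open>X\<close> started
  at \<open>y\<close> (see \<open>expectation_K\<close>); \<open>N0\<close> below is its limit as \<open>q\<close> tends to \<open>0\<close>.\<close>

definition K :: "real \<Rightarrow> real \<Rightarrow> real \<Rightarrow> real" where
  "K q y l = h q y * f0 l + \<rho> q y / H q * tail (1 / H q) l"

definition N0 :: "real \<Rightarrow> real \<Rightarrow> real" where
  "N0 y l = h0 m y * f0 l + tail 0 l"

abbreviation "NX t \<omega> \<equiv> N0 (X t \<omega>) (Lp t \<omega>)"
abbreviation "KX q t \<omega> \<equiv> K q (X t \<omega>) (Lp t \<omega>)"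
abbreviation "reward q B \<omega> \<equiv> (\<integral>\<^sup>+r\<in>B. ennreal (f0 (Lp r \<omega>)) \<partial>clock q)"
abbreviation "occupation t \<omega> \<equiv> (\<integral>\<^sup>+r\<in>{0..t}. ennreal (f0 (Lp r \<omega>)) \<partial>lborel)"

lemma K_nonneg: "q > 0 \<Longrightarrow> y \<ge> 0 \<Longrightarrow> 0 \<le> K q y l"
proof -
  assume q: "q > 0" and y: "y \<ge> 0"
  have "0 \<le> h q y * f0 l" by (rule mult_nonneg_nonneg[OF h_nonneg[OF q y] f0_nonneg])
  moreover have "0 \<le> \<rho> q y / H q * tail (1 / H q) l"
    by (rule mult_nonneg_nonneg[OF divide_nonneg_pos[OF rho_nonneg[OF q y] H_pos[OF q]] tail_nonneg])
  ultimately show ?thesis unfolding K_def by (rule add_nonneg_nonneg)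
qed

lemma N0_nonneg: "y \<ge> 0 \<Longrightarrow> 0 \<le> N0 y l"
  unfolding N0_def using h0_nonneg[of y] f0_nonneg tail_nonneg
  by (intro add_nonneg_nonneg mult_nonneg_nonneg) auto

lemma expectation_K:
  assumes q: "q > 0" and y: "y \<ge> 0"
  shows "ennreal (H q) * (\<integral>\<^sup>+\<omega>. (\<integral>\<^sup>+s. ennreal (f0 (l + Lp s \<omega>)) \<partial>clock q) \<partial>P y) = ennreal (K q y l)"
proof -
  interpret lt: local_time_potential M P X \<theta> "resolvent_density \<phi> \<psi>" L q "H q" "\<rho> q" by (rule local_time_potential_rho[OF q])
  have Hq: "H q > 0" by (rule H_pos[OF q])
  have r: "0 \<le> \<rho> q y" "\<rho> q y \<le> H q" using rho_nonneg rho_le_H q y by auto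
  have H1: "1 / H q > 0" using Hq by simp
  have T: "(\<integral>\<^sup>+v. ennreal (f0 (l + v)) \<partial>clock (1 / H q)) = ennreal (tail (1 / H q) l / H q)"
  proof -
    have "(\<integral>\<^sup>+v. ennreal (f0 (l + v)) \<partial>clock (1 / H q))
        = (\<integral>\<^sup>+v\<in>{0..}. ennreal (1 / H q * exp (- (1 / H q) * v)) * ennreal (f0 (l + v)) \<partial>lborel)"
      by (rule nn_integral_clock[OF _ H1]) measurable
    also have "\<dots> = (\<integral>\<^sup>+v. ennreal (1 / H q * (indicator {0..} v * (exp (- (1 / H q) * v) * f0 (l + v)))) \<partial>lborel)"
      using Hq f0_nonneg by (intro nn_integral_cong) (auto simp: indicator_def ennreal_mult'[symmetric])
    also have "\<dots> = ennreal (LINT v|lborel. 1 / H q * (indicator {0..} v * (exp (- (1 / H q) * v) * f0 (l + v))))"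
      using tail_integrable[of "1 / H q" l] Hq f0_nonneg
      by (intro nn_integral_eq_integral integrable_mult_right AE_I2) auto
    finally show ?thesis by (simp add: tail_def)
  qed
  have "(\<integral>\<^sup>+\<omega>. (\<integral>\<^sup>+s. ennreal (f0 (l + Lp s \<omega>)) \<partial>clock q) \<partial>P y)
    = ennreal (1 - \<rho> q y / H q) * ennreal (f0 (l + 0)) + ennreal (\<rho> q y / H q) * (\<integral>\<^sup>+v. ennreal (f0 (l + v)) \<partial>clock (1 / H q))"
    by (rule lt.law_of_local_time_at_clock[OF y, where g = "\<lambda>v. ennreal (f0 (l + v))"]) measurable
  also have "\<dots> = ennreal ((1 - \<rho> q y / H q) * f0 l + \<rho> q y / H q * (tail (1 / H q) l / H q))"
  proof -
    have *: "ennreal a * ennreal b + ennreal c * ennreal d = ennreal (a * b + c * d)"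
      if "a \<ge> 0" "b \<ge> 0" "c \<ge> 0" "d \<ge> 0" for a b c d :: real
      using that by (simp add: ennreal_mult)
    have nn: "0 \<le> 1 - \<rho> q y / H q" "0 \<le> \<rho> q y / H q" "0 \<le> tail (1 / H q) l / H q"
    proof -
      obtain R where R: "R = \<rho> q y" by simp
      show "0 \<le> 1 - \<rho> q y / H q" "0 \<le> \<rho> q y / H q" "0 \<le> tail (1 / H q) l / H q"
        using r Hq tail_nonneg[of "1 / H q" l] unfolding R[symmetric] by simp_all
    qed
    show ?thesis unfolding T add_0_right by (rule *[OF nn(1) f0_nonneg nn(2,3)])
  qed
  finally have "ennreal (H q) * (\<integral>\<^sup>+\<omega>. (\<integral>\<^sup>+s. ennreal (f0 (l + Lp s \<omega>)) \<partial>clock q) \<partial>P y)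
    = ennreal (H q * ((1 - \<rho> q y / H q) * f0 l + \<rho> q y / H q * (tail (1 / H q) l / H q)))"
    using Hq by (simp add: ennreal_mult')
  also have "H q * ((1 - \<rho> q y / H q) * f0 l + \<rho> q y / H q * (tail (1 / H q) l / H q)) = K q y l"
    unfolding K_def using Hq by (simp add: field_simps)
  finally show ?thesis .
qed

text \<open>Memorylessness of the clock and the Markov property at \<open>t\<close>: on the event that the clock exceeds
  \<open>t\<close>, the process restarts from \<open>X\<^sub>t\<close> with local time \<open>L\<^sub>t\<close> already collected.\<close>

lemma expectation_after:
  assumes q: "q > 0" and t: "t \<ge> 0" and V: "V \<in> borel_measurable (F t)"
  shows "ennreal (H q) * (\<integral>\<^sup>+\<omega>. V \<omega> * reward q {t..} \<omega> \<partial>P x)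
    = ennreal (exp (- q * t)) * (\<integral>\<^sup>+\<omega>. V \<omega> * ennreal (KX q t \<omega>) \<partial>P x)"
proof -
  note sets_P[OF x, measurable_cong]
  interpret C: prob_space "clock q" by (rule prob_space_clock[OF q])
  have [measurable]: "V \<in> borel_measurable M" by (rule measurable_F_M[OF V])
  have KL: "ennreal (H q) * (\<integral>\<^sup>+\<omega>'. (\<integral>\<^sup>+s. ennreal (f0 (l + Lp s \<omega>')) \<partial>clock q) \<partial>law y) = ennreal (K q y l)"
    if "y \<ge> 0" for y l
    by (subst nn_integral_law[OF that]) (measurable, rule expectation_K[OF q that])
  have "(\<integral>\<^sup>+\<omega>. V \<omega> * reward q {t..} \<omega> \<partial>P x)
    = (\<integral>\<^sup>+\<omega>. ennreal (exp (- q * t)) * (V \<omega> * (\<integral>\<^sup>+s. ennreal (f0 (Lp t \<omega> + (Lp (t + s) \<omega> - Lp t \<omega>))) \<partial>clock q)) \<partial>P x)"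
  proof (rule nn_integral_cong)
    fix \<omega> assume "\<omega> \<in> space (P x)"
    then have [measurable]: "(\<lambda>v. Lp v \<omega>) \<in> borel_measurable borel"
      using x by (intro borel_measurable_continuous_onI Lp_cont) simp
    have "reward q {t..} \<omega> = ennreal (exp (- q * t)) * (\<integral>\<^sup>+s. ennreal (f0 (Lp (t + s) \<omega>)) \<partial>clock q)"
      by (rule clock_shift[OF _ q t]) measurable
    then show "V \<omega> * reward q {t..} \<omega> =
        ennreal (exp (- q * t)) * (V \<omega> * (\<integral>\<^sup>+s. ennreal (f0 (Lp t \<omega> + (Lp (t + s) \<omega> - Lp t \<omega>))) \<partial>clock q))"
      by (simp add: mult.left_commute)
  qed
  also have "\<dots> = ennreal (exp (- q * t)) * (\<integral>\<^sup>+\<omega>. V \<omega> * (\<integral>\<^sup>+s. ennreal (f0 (Lp t \<omega> + (Lp (t + s) \<omega> - Lp t \<omega>))) \<partial>clock q) \<partial>P x)"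
    by (rule nn_integral_cmult) measurable
  also have "(\<integral>\<^sup>+\<omega>. V \<omega> * (\<integral>\<^sup>+s. ennreal (f0 (Lp t \<omega> + (Lp (t + s) \<omega> - Lp t \<omega>))) \<partial>clock q) \<partial>P x)
    = (\<integral>\<^sup>+\<omega>. V \<omega> * (\<integral>\<^sup>+\<omega>'. (\<integral>\<^sup>+s. ennreal (f0 (Lp t \<omega> + Lp s \<omega>')) \<partial>clock q) \<partial>law (X t \<omega>)) \<partial>P x)"
    by (rule clock_Markov[OF q x t V, where g = "\<lambda>l d. ennreal (f0 (l + d))"]) measurable
  finally have "ennreal (H q) * (\<integral>\<^sup>+\<omega>. V \<omega> * reward q {t..} \<omega> \<partial>P x)
    = ennreal (exp (- q * t)) * (ennreal (H q) * (\<integral>\<^sup>+\<omega>. V \<omega> * (\<integral>\<^sup>+\<omega>'. (\<integral>\<^sup>+s. ennreal (f0 (Lp t \<omega> + Lp s \<omega>')) \<partial>clock q) \<partial>law (X t \<omega>)) \<partial>P x))"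
    by (simp add: mult.left_commute)
  also have "ennreal (H q) * (\<integral>\<^sup>+\<omega>. V \<omega> * (\<integral>\<^sup>+\<omega>'. (\<integral>\<^sup>+s. ennreal (f0 (Lp t \<omega> + Lp s \<omega>')) \<partial>clock q) \<partial>law (X t \<omega>)) \<partial>P x)
     = (\<integral>\<^sup>+\<omega>. ennreal (H q) * (V \<omega> * (\<integral>\<^sup>+\<omega>'. (\<integral>\<^sup>+s. ennreal (f0 (Lp t \<omega> + Lp s \<omega>')) \<partial>clock q) \<partial>law (X t \<omega>))) \<partial>P x)"
  proof (rule nn_integral_cmult[symmetric])
    have [measurable]: "X t \<in> borel_measurable M" by (rule X_measurable[OF t])
    show "(\<lambda>\<omega>. V \<omega> * (\<integral>\<^sup>+\<omega>'. (\<integral>\<^sup>+s. ennreal (f0 (Lp t \<omega> + Lp s \<omega>')) \<partial>clock q) \<partial>law (X t \<omega>))) \<in> borel_measurable (P x)"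
    proof (rule borel_measurable_times_ennreal)
      have [measurable]: "(\<lambda>\<omega>. law (X t \<omega>)) \<in> P x \<rightarrow>\<^sub>M subprob_algebra S" by measurable
      show "(\<lambda>\<omega>. \<integral>\<^sup>+\<omega>'. (\<integral>\<^sup>+s. ennreal (f0 (Lp t \<omega> + Lp s \<omega>')) \<partial>clock q) \<partial>law (X t \<omega>)) \<in> borel_measurable (P x)"
        by (rule nn_integral_measurable_subprob_algebra2[of _ _ S]) measurable
    qed measurable
  qed
  also have "\<dots> = (\<integral>\<^sup>+\<omega>. V \<omega> * ennreal (KX q t \<omega>) \<partial>P x)"
    by (intro nn_integral_cong) (use KL X_nonneg[OF t] x in \<open>simp add: mult.left_commute\<close>)
  finally show ?thesis .
qed

lemma h0_measurable [measurable]: "(\<lambda>y. h0 m (max 0 y)) \<in> borel_measurable borel"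
proof (rule borel_measurable_LIMSEQ_real)
  let ?q = "\<lambda>n. 1 / real (Suc n)"
  fix y :: real
  have "filterlim ?q (at_right 0) sequentially"
    by (rule tendsto_imp_filterlim_at_right) (use lim_1_over_n[THEN LIMSEQ_Suc] in auto)
  then show "(\<lambda>n. h (?q n) (max 0 y)) \<longlonglongrightarrow> h0 m (max 0 y)"
    by (rule filterlim_compose[OF h_tendsto, rotated]) simp
next
  fix n :: nat
  show "(\<lambda>y. h (1 / real (Suc n)) (max 0 y)) \<in> borel_measurable borel"
    by (intro borel_measurable_diff borel_measurable_const krein_feller.u_measurable[OF kf_w]) simp
qed

lemma h0_X_measurable:
  assumes "t \<ge> 0" "X t \<in> borel_measurable G" "space G = \<Omega>"
  shows "(\<lambda>\<omega>. h0 m (X t \<omega>)) \<in> borel_measurable G"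
proof -
  have "(\<lambda>\<omega>. h0 m (max 0 (X t \<omega>))) \<in> borel_measurable G" using assms(2) by measurable
  then show ?thesis
    by (rule measurable_cong[THEN iffD1, rotated]) (use assms X_nonneg in \<open>auto simp: max_def\<close>)
qed

lemma rho_X_measurable:
  assumes "q > 0" "t \<ge> 0" "X t \<in> borel_measurable G" "space G = \<Omega>"
  shows "(\<lambda>\<omega>. \<rho> q (X t \<omega>)) \<in> borel_measurable G"
proof -
  have "(\<lambda>\<omega>. \<rho> q (max 0 (X t \<omega>))) \<in> borel_measurable G"
    using measurable_compose[OF assms(3) krein_feller.u_measurable[OF kf_w[OF assms(1), of "H q"]]] .
  then show ?thesis
    by (rule measurable_cong[THEN iffD1, rotated]) (use assms X_nonneg in \<open>auto simp: max_def\<close>)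
qed

lemma N0_measurable:
  assumes t: "t \<ge> 0" shows "(NX t) \<in> borel_measurable (F t)"
proof -
  have [measurable]: "(\<lambda>\<omega>. h0 m (X t \<omega>)) \<in> borel_measurable (F t)"
    by (rule h0_X_measurable) (use t X_F in auto)
  have [measurable]: "Lp t \<in> borel_measurable (F t)" using t by (intro Lp_F) auto
  show ?thesis unfolding N0_def by measurable
qed

lemma K_measurable:
  assumes q: "q > 0" and t: "t \<ge> 0" shows "(\<lambda>\<omega>. KX q t \<omega>) \<in> borel_measurable (F t)"
proof -
  have [measurable]: "(\<lambda>\<omega>. \<rho> q (X t \<omega>)) \<in> borel_measurable (F t)"
    by (rule rho_X_measurable) (use q t X_F in auto)
  have [measurable]: "Lp t \<in> borel_measurable (F t)" using t by (intro Lp_F) auto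
  show ?thesis unfolding K_def by measurable
qed

lemma measurable_F_P: "g \<in> F t \<rightarrow>\<^sub>M G \<Longrightarrow> g \<in> P x \<rightarrow>\<^sub>M G"
  unfolding measurable_cong_sets[OF sets_P[OF x] refl] by (rule measurable_F_M)

text \<open>The limits at \<open>0+\<close> are taken along sequences of rates, where dominated convergence applies.\<close>

lemma vanishing_rates:
  assumes Q: "\<And>n. Q n > 0" "Q \<longlonglongrightarrow> (0::real)"
  shows rates_K: "y \<ge> 0 \<Longrightarrow> (\<lambda>n. K (Q n) y l) \<longlonglongrightarrow> N0 y l"
    and rates_qH: "(\<lambda>n. Q n * H (Q n)) \<longlonglongrightarrow> pi0 m"
    and rates_dom: "\<forall>\<^sub>F n in sequentially. \<forall>y\<ge>0. h (Q n) y \<le> 2 * h0 m y"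
proof -
  have Q0: "filterlim Q (at_right 0) sequentially"
    by (rule tendsto_imp_filterlim_at_right) (use Q in auto)
  show "(\<lambda>n. Q n * H (Q n)) \<longlonglongrightarrow> pi0 m" by (rule filterlim_compose[OF qH_tendsto Q0])
  show "\<forall>\<^sub>F n in sequentially. \<forall>y\<ge>0. h (Q n) y \<le> 2 * h0 m y"
    using Q0 h_dominated unfolding filterlim_iff by blast
  have Hinf: "filterlim (\<lambda>n. H (Q n)) at_top sequentially" by (rule filterlim_compose[OF H_at_top Q0])
  have inv: "(\<lambda>n. 1 / H (Q n)) \<longlonglongrightarrow> 0"
    using tendsto_inverse_0_at_top[OF Hinf] by (simp add: divide_inverse)
  show "(\<lambda>n. K (Q n) y l) \<longlonglongrightarrow> N0 y l" if y: "y \<ge> 0"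
  proof -
    have "(\<lambda>n. K (Q n) y l) \<longlonglongrightarrow> h0 m y * f0 l + 1 * tail 0 l"
      unfolding K_def
    proof (intro tendsto_add tendsto_mult tendsto_const)
      show "(\<lambda>n. h (Q n) y) \<longlonglongrightarrow> h0 m y" by (rule filterlim_compose[OF h_tendsto[OF y] Q0])
      show "(\<lambda>n. \<rho> (Q n) y / H (Q n)) \<longlonglongrightarrow> 1" by (rule filterlim_compose[OF rho_ratio_tendsto[OF y] Q0])
      show "(\<lambda>n. tail (1 / H (Q n)) l) \<longlonglongrightarrow> tail 0 l"
        using H_pos[OF Q(1)] by (intro tail_tendsto inv) (simp add: less_imp_le)
    qed
    then show ?thesis by (simp add: N0_def)
  qed
qed

lemma K_le:
  assumes q: "q > 0" and y: "y \<ge> 0" and d: "\<And>y. y \<ge> 0 \<Longrightarrow> h q y \<le> 2 * h0 m y"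
  shows "K q y l \<le> 2 * N0 y l + (LINT v|lborel. f0 v)"
proof -
  have "h q y * f0 l \<le> 2 * h0 m y * f0 l" by (intro mult_right_mono d y f0_nonneg)
  moreover have "\<rho> q y / H q \<le> 1" using rho_le_H[OF q y] H_pos[OF q] by simp
  then have "\<rho> q y / H q * tail (1 / H q) l \<le> 1 * (LINT v|lborel. f0 v)"
    using tail_nonneg tail_le[of "1 / H q" l] H_pos[OF q] by (intro mult_mono) auto
  moreover have "0 \<le> tail 0 l" by (rule tail_nonneg)
  ultimately show ?thesis by (simp add: K_def N0_def)
qed

lemma finite_at_clock:
  assumes q: "q > 0"
  shows "(\<integral>\<^sup>+\<omega>. (\<integral>\<^sup>+s. ennreal (f0 (Lp s \<omega>)) \<partial>clock q) \<partial>P x) < \<infinity>"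
proof -
  have "ennreal (H q) * (\<integral>\<^sup>+\<omega>. (\<integral>\<^sup>+s. ennreal (f0 (Lp s \<omega>)) \<partial>clock q) \<partial>P x) = ennreal (K q x 0)"
    using expectation_K[OF q x, of 0] by simp
  then have "ennreal (H q) * (\<integral>\<^sup>+\<omega>. (\<integral>\<^sup>+s. ennreal (f0 (Lp s \<omega>)) \<partial>clock q) \<partial>P x) < \<top>" by simp
  then show ?thesis using H_pos[OF q] by (auto simp: ennreal_mult_less_top)
qed

text \<open>By \<open>expectation_after\<close>, \<open>exp(-qt)\<close> times the mean of \<open>K\<^sub>q(X\<^sub>t,L\<^sub>t)\<close> is the part of \<open>K\<^sub>q(x,0)\<close> that comes from clocks
  exceeding \<open>t\<close>. Hence these means stay bounded as \<open>q\<close> tends to \<open>0\<close>, and Fatou's lemma applies.\<close>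

lemma N0_integrable:
  assumes t: "t \<ge> 0" shows "integrable (P x) (NX t)"
proof (rule integrableI_nonneg)
  let ?Q = "\<lambda>n. 1 / real (Suc n)"
  have Q: "?Q n > 0" for n by simp
  have Q0: "?Q \<longlonglongrightarrow> 0" using lim_1_over_n[THEN LIMSEQ_Suc] .
  show "(NX t) \<in> borel_measurable (P x)" by (rule measurable_F_P[OF N0_measurable[OF t]])
  show "AE \<omega> in P x. 0 \<le> NX t \<omega>"
    using x X_nonneg[OF t] by (intro AE_I2 N0_nonneg) auto
  have bound: "(\<integral>\<^sup>+\<omega>. ennreal (KX q t \<omega>) \<partial>P x) \<le> ennreal (exp (q * t) * K q x 0)" if q: "q > 0" for q
  proof -
    have "ennreal (exp (- q * t)) * (\<integral>\<^sup>+\<omega>. 1 * ennreal (KX q t \<omega>) \<partial>P x)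
      = ennreal (H q) * (\<integral>\<^sup>+\<omega>. 1 * reward q {t..} \<omega> \<partial>P x)"
      by (rule expectation_after[OF q t, symmetric]) simp
    also have "\<dots> \<le> ennreal (H q) * (\<integral>\<^sup>+\<omega>. (\<integral>\<^sup>+r. ennreal (f0 (0 + Lp r \<omega>)) \<partial>clock q) \<partial>P x)"
      by (intro mult_left_mono nn_integral_mono) (auto simp: indicator_def intro!: nn_integral_mono)
    also have "\<dots> = ennreal (K q x 0)" by (rule expectation_K[OF q x])
    finally have "ennreal (exp (q * t)) * (ennreal (exp (- q * t)) * (\<integral>\<^sup>+\<omega>. ennreal (KX q t \<omega>) \<partial>P x))
       \<le> ennreal (exp (q * t)) * ennreal (K q x 0)" by (intro mult_left_mono) simp_all
    moreover have "ennreal (exp (q * t)) * ennreal (exp (- q * t)) = 1"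
      by (subst ennreal_mult[symmetric]) (auto simp flip: exp_add)
    ultimately show ?thesis using K_nonneg[OF q x] by (simp add: ennreal_mult mult.assoc[symmetric])
  qed
  have lim1: "(\<lambda>n. ennreal (KX (?Q n) t \<omega>)) \<longlonglongrightarrow> ennreal (NX t \<omega>)" if "\<omega> \<in> \<Omega>" for \<omega>
    by (intro tendsto_ennrealI rates_K Q Q0 X_nonneg t that)
  have lim2: "(\<lambda>n. ennreal (exp (?Q n * t) * K (?Q n) x 0)) \<longlonglongrightarrow> ennreal (exp (0 * t) * N0 x 0)"
    by (intro tendsto_ennrealI tendsto_intros rates_K Q Q0 x)
  have "(\<integral>\<^sup>+\<omega>. ennreal (NX t \<omega>) \<partial>P x)
     = (\<integral>\<^sup>+\<omega>. liminf (\<lambda>n. ennreal (KX (?Q n) t \<omega>)) \<partial>P x)"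
    by (intro nn_integral_cong lim_imp_Liminf[symmetric] lim1) (use x in auto)
  also have "\<dots> \<le> liminf (\<lambda>n. \<integral>\<^sup>+\<omega>. ennreal (KX (?Q n) t \<omega>) \<partial>P x)"
    by (rule nn_integral_liminf) (intro measurable_compose[OF measurable_F_P[OF K_measurable[OF Q t]]] measurable_ennreal)
  also have "\<dots> \<le> liminf (\<lambda>n. ennreal (exp (?Q n * t) * K (?Q n) x 0))"
    by (intro Liminf_mono always_eventually allI bound Q)
  also have "\<dots> = ennreal (exp (0 * t) * N0 x 0)" by (rule lim_imp_Liminf[OF _ lim2]) simp
  finally show "(\<integral>\<^sup>+\<omega>. ennreal (NX t \<omega>) \<partial>P x) < \<infinity>" by (auto elim: le_less_trans)
qed

definition A0 :: "real \<Rightarrow> 'w \<Rightarrow> real" where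
  "A0 t \<omega> = (LINT r|lborel. indicator {0..t} r * f0 (Lp r \<omega>))"

lemma A0_measurable: "t \<ge> 0 \<Longrightarrow> A0 t \<in> borel_measurable (F t)"
proof -
  assume t: "t \<ge> 0"
  have [measurable]: "(\<lambda>(r, \<omega>). Lp (min r t) \<omega>) \<in> borel_measurable (borel \<Otimes>\<^sub>M F t)"
  proof (rule measurable_continuous_process)
    show "\<omega> \<in> space (F t) \<Longrightarrow> continuous_on UNIV (\<lambda>r. Lp (min r t) \<omega>)" for \<omega>
      by (rule continuous_on_compose2[OF Lp_cont[of _ UNIV]]) (auto intro!: continuous_intros)
  qed (use t in \<open>auto intro!: Lp_F\<close>)
  have eq: "A0 t = (\<lambda>\<omega>. LINT r|lborel. indicator {0..t} r * f0 (Lp (min r t) \<omega>))"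
    unfolding A0_def by (intro ext Bochner_Integration.integral_cong) (auto simp: indicator_def)
  have "(\<lambda>(\<omega>, r). indicator {0..t} r * f0 (Lp (min r t) \<omega>)) \<in> borel_measurable (F t \<Otimes>\<^sub>M lborel)"
  proof -
    have "(\<lambda>z. Lp (min (snd z) t) (fst z)) \<in> borel_measurable (F t \<Otimes>\<^sub>M lborel)"
      using measurable_compose[OF _ \<open>(\<lambda>(r, \<omega>). Lp (min r t) \<omega>) \<in> _\<close>, of "\<lambda>z. (snd z, fst z)" "F t \<Otimes>\<^sub>M lborel"] by simp
    then have "(\<lambda>z. indicator {0..t} (snd z) * f0 (Lp (min (snd z) t) (fst z))) \<in> borel_measurable (F t \<Otimes>\<^sub>M lborel)"
      by measurable
    then show ?thesis by (simp add: case_prod_beta')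
  qed
  then show ?thesis unfolding eq by (rule lborel.borel_measurable_lebesgue_integral)
qed

lemma A0_nonneg: "0 \<le> A0 t \<omega>"
  unfolding A0_def by (intro Bochner_Integration.integral_nonneg) (auto simp: f0_nonneg)

text \<open>On \<open>[0,t]\<close> Lebesgue measure is at most \<open>exp(t)\<close> times the law of a clock of rate \<open>1\<close>.\<close>

lemma occupation_finite:
  assumes t: "t \<ge> 0"
  shows "(\<integral>\<^sup>+\<omega>. occupation t \<omega> \<partial>P x) < \<infinity>"
proof -
  note sets_P[OF x, measurable_cong]
  interpret C: prob_space "clock 1" by (rule prob_space_clock) simp
  have "(\<integral>\<^sup>+\<omega>. occupation t \<omega> \<partial>P x)
     \<le> (\<integral>\<^sup>+\<omega>. ennreal (exp t) * (\<integral>\<^sup>+r. ennreal (f0 (Lp r \<omega>)) \<partial>clock 1) \<partial>P x)"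
  proof (rule nn_integral_mono)
    fix \<omega> assume "\<omega> \<in> space (P x)"
    then have [measurable]: "(\<lambda>v. Lp v \<omega>) \<in> borel_measurable borel"
      using x by (intro borel_measurable_continuous_onI Lp_cont) simp
    have "occupation t \<omega>
      \<le> (\<integral>\<^sup>+r. ennreal (exp t) * (ennreal (1 * exp (- 1 * r)) * ennreal (f0 (Lp r \<omega>)) * indicator {0..} r) \<partial>lborel)"
    proof (rule nn_integral_mono)
      fix r :: real
      show "ennreal (f0 (Lp r \<omega>)) * indicator {0..t} r
        \<le> ennreal (exp t) * (ennreal (1 * exp (- 1 * r)) * ennreal (f0 (Lp r \<omega>)) * indicator {0..} r)"
      proof (cases "r \<in> {0..t}")
        case True
        have "1 * f0 (Lp r \<omega>) \<le> (exp t * exp (- r)) * f0 (Lp r \<omega>)"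
          using True f0_nonneg by (intro mult_right_mono) (auto simp flip: exp_add)
        then show ?thesis using True f0_nonneg by (auto simp: ennreal_mult[symmetric] mult.assoc intro!: ennreal_leI)
      qed (auto simp: indicator_def)
    qed
    also have "\<dots> = ennreal (exp t) * (\<integral>\<^sup>+r. ennreal (1 * exp (- 1 * r)) * ennreal (f0 (Lp r \<omega>)) * indicator {0..} r \<partial>lborel)"
      by (rule nn_integral_cmult) measurable
    also have "(\<integral>\<^sup>+r. ennreal (1 * exp (- 1 * r)) * ennreal (f0 (Lp r \<omega>)) * indicator {0..} r \<partial>lborel) = (\<integral>\<^sup>+r. ennreal (f0 (Lp r \<omega>)) \<partial>clock 1)"
      by (rule nn_integral_clock[symmetric]) auto
    finally show "occupation t \<omega> \<le> ennreal (exp t) * (\<integral>\<^sup>+r. ennreal (f0 (Lp r \<omega>)) \<partial>clock 1)" .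
  qed
  also have "\<dots> = ennreal (exp t) * (\<integral>\<^sup>+\<omega>. (\<integral>\<^sup>+r. ennreal (f0 (Lp r \<omega>)) \<partial>clock 1) \<partial>P x)"
    by (rule nn_integral_cmult) measurable
  also have "\<dots> < \<infinity>" using finite_at_clock[of 1] by (simp add: ennreal_mult_less_top)
  finally show ?thesis .
qed

lemma AE_occupation:
  assumes t: "t \<ge> 0"
  shows "AE \<omega> in P x. integrable lborel (\<lambda>r. indicator {0..t} r * f0 (Lp r \<omega>)) \<and>
      occupation t \<omega> = ennreal (A0 t \<omega>)"
proof -
  note sets_P[OF x, measurable_cong]
  have "AE \<omega> in P x. occupation t \<omega> \<noteq> \<infinity>"
    by (rule nn_integral_noteq_infinite) (use occupation_finite[OF t] in \<open>auto simp: less_top\<close>)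
  then show ?thesis using AE_space
  proof eventually_elim
    case (elim \<omega>)
    have [measurable]: "(\<lambda>v. Lp v \<omega>) \<in> borel_measurable borel"
      using x elim by (intro borel_measurable_continuous_onI Lp_cont) simp
    have e: "occupation t \<omega> = (\<integral>\<^sup>+r. ennreal (indicator {0..t} r * f0 (Lp r \<omega>)) \<partial>lborel)"
      by (intro nn_integral_cong) (auto simp: indicator_def)
    have i: "integrable lborel (\<lambda>r. indicator {0..t} r * f0 (Lp r \<omega>))"
      by (rule integrableI_nonneg) (use elim f0_nonneg in \<open>auto simp: e less_top\<close>)
    then show ?case
      unfolding e A0_def by (intro conjI nn_integral_eq_integral) (auto simp: f0_nonneg)
  qed
qed

lemma A0_integrable: "t \<ge> 0 \<Longrightarrow> integrable (P x) (A0 t)"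
proof (rule integrableI_nonneg)
  assume t: "t \<ge> 0"
  show "A0 t \<in> borel_measurable (P x)" by (rule measurable_F_P[OF A0_measurable[OF t]])
  have "(\<integral>\<^sup>+\<omega>. ennreal (A0 t \<omega>) \<partial>P x) = (\<integral>\<^sup>+\<omega>. occupation t \<omega> \<partial>P x)"
    by (rule nn_integral_cong_AE, use AE_occupation[OF t] in eventually_elim) simp
  then show "(\<integral>\<^sup>+\<omega>. ennreal (A0 t \<omega>) \<partial>P x) < \<infinity>" using occupation_finite[OF t] by simp
qed (simp add: A0_nonneg)

lemma A0_mono:
  assumes "0 \<le> s" "s \<le> t"
  shows "AE \<omega> in P x. A0 s \<omega> \<le> A0 t \<omega>"
proof -
  have t: "0 \<le> t" using assms by simp
  show ?thesis
    using AE_occupation[OF assms(1)] AE_occupation[OF t]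
    by eventually_elim
      (use assms f0_nonneg in \<open>auto simp: A0_def indicator_def intro!: integral_mono\<close>)
qed

definition M0 :: "real \<Rightarrow> 'w \<Rightarrow> real" where
  "M0 t \<omega> = NX t \<omega> + pi0 m * A0 t \<omega>"

lemma N_proc_eq: "t \<ge> 0 \<Longrightarrow> \<omega> \<in> \<Omega> \<Longrightarrow> N_proc m f X L t \<omega> = NX t \<omega>"
proof -
  assume t: "t \<ge> 0" and w: "\<omega> \<in> \<Omega>"
  have L0: "L t \<omega> \<ge> 0" using Lp_nonneg[OF w, of t] Lp_eq[OF t] by simp
  have "(LINT u:{0..}|lborel. f (L t \<omega> + u)) = tail 0 (L t \<omega>)"
    unfolding tail_def set_lebesgue_integral_def
    by (intro Bochner_Integration.integral_cong) (use L0 in \<open>auto simp: indicator_def f0_eq\<close>)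
  then show ?thesis using L0 Lp_eq[OF t] by (simp add: N_proc_def N0_def f0_eq)
qed

lemma M_proc_eq: "t \<ge> 0 \<Longrightarrow> \<omega> \<in> \<Omega> \<Longrightarrow> M_proc m f X L t \<omega> = M0 t \<omega>"
proof -
  assume t: "t \<ge> 0" and w: "\<omega> \<in> \<Omega>"
  have "(LINT u:{0..t}|lborel. f (L u \<omega>)) = A0 t \<omega>"
    unfolding A0_def set_lebesgue_integral_def
    by (intro Bochner_Integration.integral_cong)
      (use Lp_nonneg[OF w] Lp_eq in \<open>auto simp: indicator_def f0_eq dest!: fun_cong[of _ _ \<omega>]\<close>)
  then show ?thesis by (simp add: M_proc_def M0_def N_proc_eq[OF t w])
qed

end

section \<open>The penalization limits and the martingale property\<close>

locale penalization_clock = penalization m \<phi> \<psi> M P X \<theta> L f x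
  for m \<phi> \<psi> and M :: "'w measure" and P X \<theta> L f x +
  fixes e :: "'w \<Rightarrow> real"
  assumes e_exponential: "distributed (P x) lborel e (exponential_density 1)"
    and e_indep: "prob_space.indep_set (P x)
      (sets (process_sigma (space M) X {0..})) (sets (vimage_algebra (space M) e borel))"
begin

lemma e_measurable: "e \<in> borel_measurable (P x)"
  using distributed_measurable[OF e_exponential] by simp

lemma distr_rescaled_clock:
  assumes q: "q > 0"
  shows "distr (P x) borel (\<lambda>\<omega>. e \<omega> / q) = clock q"
proof -
  interpret prob_space "P x" by (rule prob_space_P[OF x])
  have "distributed (P x) lborel (\<lambda>\<omega>. 0 + (1 / q) * e \<omega>) (\<lambda>r. ennreal (exponential_density 1 ((r - 0) / (1 / q))) / ennreal \<bar>1 / q\<bar>)"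
    by (rule distributed_affine[OF e_exponential]) (use q in simp)
  then have "distr (P x) lborel (\<lambda>\<omega>. e \<omega> / q) = density lborel (\<lambda>r. ennreal (exponential_density 1 ((r - 0) / (1 / q))) / ennreal \<bar>1 / q\<bar>)"
    by (simp add: distributed_distr_eq_density)
  also have "\<dots> = clock q"
    unfolding clock_def
  proof (rule density_cong)
    show "AE r in lborel. ennreal (exponential_density 1 ((r - 0) / (1 / q))) / ennreal \<bar>1 / q\<bar> = ennreal (exponential_density q r)"
    proof (rule AE_I2)
      fix r :: real
      have "exponential_density 1 (r * q) / (1 / q) = exponential_density q r"
        using q by (auto simp: exponential_density_def mult_less_0_iff)
      then show "ennreal (exponential_density 1 ((r - 0) / (1 / q))) / ennreal \<bar>1 / q\<bar> = ennreal (exponential_density q r)"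
        using q by (subst divide_ennreal) (auto simp: exponential_density_nonneg)
    qed
  qed measurable
  also have "distr (P x) lborel (\<lambda>\<omega>. e \<omega> / q) = distr (P x) borel (\<lambda>\<omega>. e \<omega> / q)"
    by (rule distr_cong) auto
  finally show ?thesis .
qed

lemma nn_integral_independent_clock:
  assumes q: "q > 0" and W: "(\<lambda>(\<omega>, r). W \<omega> r) \<in> borel_measurable (S \<Otimes>\<^sub>M borel)"
  shows "(\<integral>\<^sup>+\<omega>. W \<omega> (e \<omega> / q) \<partial>P x) = (\<integral>\<^sup>+\<omega>. (\<integral>\<^sup>+r. W \<omega> r \<partial>clock q) \<partial>P x)"
proof -
  interpret P: prob_space "P x" by (rule prob_space_P[OF x])
  interpret C: prob_space "clock q" by (rule prob_space_clock[OF q])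
  let ?e = "\<lambda>\<omega>. e \<omega> / q"
  have em: "?e \<in> borel_measurable (P x)" using e_measurable by measurable
  have SP: "sets S \<subseteq> sets (P x)" using S_subset_M sets_P[OF x] by simp
  have vim: "sets (vimage_algebra \<Omega> e borel) = {e -` B \<inter> \<Omega> | B. B \<in> sets borel}"
    by (rule sets_vimage_algebra2) auto
  have pm: "(\<lambda>\<omega>. (\<omega>, ?e \<omega>)) \<in> P x \<rightarrow>\<^sub>M S \<Otimes>\<^sub>M borel" by (rule measurable_Pair[OF id_P_S[OF x] em])
  have "distr (P x) S (\<lambda>\<omega>. \<omega>) \<Otimes>\<^sub>M clock q = distr (P x) (S \<Otimes>\<^sub>M borel) (\<lambda>\<omega>. (\<omega>, ?e \<omega>))"
  proof (rule pair_measure_eqI)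
    interpret D: prob_space "distr (P x) S (\<lambda>\<omega>. \<omega>)" by (rule P.prob_space_distr[OF id_P_S[OF x]])
    show "sigma_finite_measure (distr (P x) S (\<lambda>\<omega>. \<omega>))" "sigma_finite_measure (clock q)"
      by (fact D.sigma_finite_measure_axioms C.sigma_finite_measure_axioms)+
    show "sets (distr (P x) S (\<lambda>\<omega>. \<omega>) \<Otimes>\<^sub>M clock q) = sets (distr (P x) (S \<Otimes>\<^sub>M borel) (\<lambda>\<omega>. (\<omega>, ?e \<omega>)))"
      by (simp cong: sets_pair_measure_cong)
    fix a B assume "a \<in> sets (distr (P x) S (\<lambda>\<omega>. \<omega>))" "B \<in> sets (clock q)"
    then have a: "a \<in> sets S" and B: "B \<in> sets borel" by auto
    have a\<Omega>: "a \<subseteq> \<Omega>" using sets.sets_into_space[OF a] by simp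
    let ?b = "?e -` B \<inter> \<Omega>"
    have "(\<lambda>r. r / q) -` B \<inter> space borel \<in> sets borel" by (rule measurable_sets[OF _ B]) measurable
    then have B': "(\<lambda>r. r / q) -` B \<in> sets borel" by simp
    have "?b = e -` ((\<lambda>r. r / q) -` B) \<inter> \<Omega>" by auto
    then have b: "?b \<in> sets (vimage_algebra \<Omega> e borel)" unfolding vim using B' by blast
    have "emeasure (distr (P x) S (\<lambda>\<omega>. \<omega>)) a = P.prob a"
      using a\<Omega> x by (subst emeasure_distr[OF id_P_S[OF x] a]) (simp add: Int_absorb2 P.emeasure_eq_measure)
    moreover have "emeasure (clock q) B = P.prob ?b"
      unfolding distr_rescaled_clock[OF q, symmetric] using x
      by (subst emeasure_distr[OF em B]) (simp add: P.emeasure_eq_measure)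
    moreover have "emeasure (distr (P x) (S \<Otimes>\<^sub>M borel) (\<lambda>\<omega>. (\<omega>, ?e \<omega>))) (a \<times> B) = P.prob (a \<inter> ?b)"
    proof -
      have "(\<lambda>\<omega>. (\<omega>, ?e \<omega>)) -` (a \<times> B) \<inter> space (P x) = a \<inter> ?b" using a\<Omega> x by auto
      then show ?thesis using a B by (subst emeasure_distr[OF pm]) (auto simp: P.emeasure_eq_measure)
    qed
    ultimately show "emeasure (distr (P x) S (\<lambda>\<omega>. \<omega>)) a * emeasure (clock q) B
        = emeasure (distr (P x) (S \<Otimes>\<^sub>M borel) (\<lambda>\<omega>. (\<omega>, ?e \<omega>))) (a \<times> B)"
      using P.indep_setD[OF e_indep a b] by (simp add: ennreal_mult)
  qed
  moreover have "(\<integral>\<^sup>+\<omega>. W \<omega> (e \<omega> / q) \<partial>P x) = (\<integral>\<^sup>+z. (\<lambda>(\<omega>, r). W \<omega> r) z \<partial>distr (P x) (S \<Otimes>\<^sub>M borel) (\<lambda>\<omega>. (\<omega>, ?e \<omega>)))"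
    by (subst nn_integral_distr[OF pm]) (use W in auto)
  ultimately have "(\<integral>\<^sup>+\<omega>. W \<omega> (e \<omega> / q) \<partial>P x) = (\<integral>\<^sup>+z. (\<lambda>(\<omega>, r). W \<omega> r) z \<partial>(distr (P x) S (\<lambda>\<omega>. \<omega>) \<Otimes>\<^sub>M clock q))" by simp
  also have "\<dots> = (\<integral>\<^sup>+\<omega>. (\<integral>\<^sup>+r. W \<omega> r \<partial>clock q) \<partial>distr (P x) S (\<lambda>\<omega>. \<omega>))"
    by (subst C.nn_integral_fst[symmetric]) (use W in \<open>auto cong: measurable_cong_sets\<close>)
  also have "\<dots> = (\<integral>\<^sup>+\<omega>. (\<integral>\<^sup>+r. W \<omega> r \<partial>clock q) \<partial>P x)"
  proof (rule nn_integral_distr[OF id_P_S[OF x]])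
    have "(\<lambda>(\<omega>, r). W \<omega> r) \<in> borel_measurable (S \<Otimes>\<^sub>M clock q)"
      using W by (simp cong: measurable_cong_sets)
    then show "(\<lambda>\<omega>. \<integral>\<^sup>+r. W \<omega> r \<partial>clock q) \<in> borel_measurable (distr (P x) S (\<lambda>\<omega>. \<omega>))"
      using C.borel_measurable_nn_integral by simp
  qed
  finally show ?thesis .
qed

abbreviation "at_clock q \<omega> \<equiv> f0 (Lp (e \<omega> / q) \<omega>)"

abbreviation "clocked q Z B \<equiv> H q * (\<integral>\<omega>. Z \<omega> * at_clock q \<omega> * indicator B (e \<omega> / q) \<partial>P x)"

lemma at_clock_measurable [measurable]: "q > 0 \<Longrightarrow> (\<lambda>\<omega>. at_clock q \<omega>) \<in> borel_measurable (P x)"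
proof -
  note sets_P[OF x, measurable_cong] e_measurable[measurable]
  show ?thesis by measurable
qed

lemma at_clock_integrable: "q > 0 \<Longrightarrow> integrable (P x) (\<lambda>\<omega>. at_clock q \<omega>)"
proof (rule integrableI_nonneg)
  assume q: "q > 0"
  show "(\<lambda>\<omega>. at_clock q \<omega>) \<in> borel_measurable (P x)" by (rule at_clock_measurable[OF q])
  have "(\<integral>\<^sup>+\<omega>. ennreal (at_clock q \<omega>) \<partial>P x) = (\<integral>\<^sup>+\<omega>. (\<integral>\<^sup>+r. ennreal (f0 (Lp r \<omega>)) \<partial>clock q) \<partial>P x)"
    by (rule nn_integral_independent_clock[OF q, where W = "\<lambda>\<omega> r. ennreal (f0 (Lp r \<omega>))"]) measurable
  then show "(\<integral>\<^sup>+\<omega>. ennreal (at_clock q \<omega>) \<partial>P x) < \<infinity>" using finite_at_clock[OF q] by simp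
qed (simp add: f0_nonneg)

lemma integral_at_clock:
  assumes q: "q > 0" and B[measurable]: "B \<in> sets borel"
    and Z[measurable]: "Z \<in> borel_measurable S" and Z0: "\<And>\<omega>. \<omega> \<in> \<Omega> \<Longrightarrow> 0 \<le> Z \<omega>"
  shows "clocked q Z B
    = enn2real (ennreal (H q) * (\<integral>\<^sup>+\<omega>. ennreal (Z \<omega>) * reward q B \<omega> \<partial>P x))"
proof -
  note sets_P[OF x, measurable_cong] e_measurable[measurable]
  have [measurable]: "Z \<in> borel_measurable M" by (rule measurable_S_M[OF Z])
  have "(\<integral>\<omega>. Z \<omega> * at_clock q \<omega> * indicator B (e \<omega> / q) \<partial>P x)
    = enn2real (\<integral>\<^sup>+\<omega>. ennreal (Z \<omega> * at_clock q \<omega> * indicator B (e \<omega> / q)) \<partial>P x)"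
    by (rule integral_eq_nn_integral) (measurable, use Z0 f0_nonneg x in \<open>auto intro!: AE_I2\<close>)
  also have "(\<integral>\<^sup>+\<omega>. ennreal (Z \<omega> * at_clock q \<omega> * indicator B (e \<omega> / q)) \<partial>P x)
    = (\<integral>\<^sup>+\<omega>. (\<integral>\<^sup>+r. ennreal (Z \<omega> * f0 (Lp r \<omega>) * indicator B r) \<partial>clock q) \<partial>P x)"
    by (rule nn_integral_independent_clock[OF q, where W = "\<lambda>\<omega> r. ennreal (Z \<omega> * f0 (Lp r \<omega>) * indicator B r)"]) measurable
  also have "\<dots> = (\<integral>\<^sup>+\<omega>. ennreal (Z \<omega>) * reward q B \<omega> \<partial>P x)"
  proof (rule nn_integral_cong)
    fix \<omega> assume "\<omega> \<in> space (P x)"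
    then have w: "\<omega> \<in> \<Omega>" using x by simp
    have [measurable]: "(\<lambda>v. Lp v \<omega>) \<in> borel_measurable borel"
      by (intro borel_measurable_continuous_onI Lp_cont w)
    have "(\<integral>\<^sup>+r. ennreal (Z \<omega> * f0 (Lp r \<omega>) * indicator B r) \<partial>clock q)
      = (\<integral>\<^sup>+r. ennreal (Z \<omega>) * (ennreal (f0 (Lp r \<omega>)) * indicator B r) \<partial>clock q)"
      using Z0[OF w] f0_nonneg by (intro nn_integral_cong) (auto simp: indicator_def ennreal_mult)
    also have "\<dots> = ennreal (Z \<omega>) * reward q B \<omega>"
      by (rule nn_integral_cmult) measurable
    finally show "(\<integral>\<^sup>+r. ennreal (Z \<omega> * f0 (Lp r \<omega>) * indicator B r) \<partial>clock q)
      = ennreal (Z \<omega>) * reward q B \<omega>" .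
  qed
  finally show ?thesis using H_pos[OF q] by (simp add: enn2real_mult)
qed

text \<open>Dominated convergence for \<open>K\<^sub>q(X\<^sub>t,L\<^sub>t)\<close>, with the integrable bound \<open>2 N\<^sub>t + \<integral> f\<close> for small \<open>q\<close>.\<close>

lemma limit_after_nonneg:
  assumes t: "t \<ge> 0" and Z: "Z \<in> borel_measurable (F t)"
    and Z0: "\<And>\<omega>. \<omega> \<in> \<Omega> \<Longrightarrow> 0 \<le> Z \<omega>" and ZC: "\<And>\<omega>. \<omega> \<in> \<Omega> \<Longrightarrow> Z \<omega> \<le> C"
    and Q: "\<And>n. Q n > 0" "Q \<longlonglongrightarrow> 0"
  shows "(\<lambda>n. clocked (Q n) Z {t<..})
    \<longlonglongrightarrow> (\<integral>\<omega>. Z \<omega> * NX t \<omega> \<partial>P x)"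
proof -
  have ZP[measurable]: "Z \<in> borel_measurable (P x)" by (rule measurable_F_P[OF Z])
  note N_meas[measurable] = measurable_F_P[OF N0_measurable[OF t]]
  have eq: "clocked q Z {t<..}
     = (\<integral>\<omega>. Z \<omega> * (exp (- q * t) * KX q t \<omega>) \<partial>P x)" if q: "q > 0" for q
  proof -
    note K_meas[measurable] = measurable_F_P[OF K_measurable[OF q t]]
    have ae: "AE r in clock q. r \<noteq> t"
      by (rule AE_I[where N = "{t}"]) (auto simp: clock_null)
    have "reward q {t<..} \<omega> = reward q {t..} \<omega>" for \<omega>
      by (rule nn_integral_cong_AE, use ae in eventually_elim) (auto simp: indicator_def)
    then have "clocked q Z {t<..}
      = enn2real (ennreal (H q) * (\<integral>\<^sup>+\<omega>. ennreal (Z \<omega>) * reward q {t..} \<omega> \<partial>P x))"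
      by (subst integral_at_clock[OF q _ measurable_F_S[OF Z] Z0]) auto
    also have "\<dots> = enn2real (ennreal (exp (- q * t)) * (\<integral>\<^sup>+\<omega>. ennreal (Z \<omega>) * ennreal (KX q t \<omega>) \<partial>P x))"
      by (subst expectation_after[OF q t]) (use Z in auto)
    also have "ennreal (exp (- q * t)) * (\<integral>\<^sup>+\<omega>. ennreal (Z \<omega>) * ennreal (KX q t \<omega>) \<partial>P x)
       = (\<integral>\<^sup>+\<omega>. ennreal (exp (- q * t)) * (ennreal (Z \<omega>) * ennreal (KX q t \<omega>)) \<partial>P x)"
      by (rule nn_integral_cmult[symmetric]) measurable
    also have "\<dots> = (\<integral>\<^sup>+\<omega>. ennreal (Z \<omega> * (exp (- q * t) * KX q t \<omega>)) \<partial>P x)"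
      using Z0 K_nonneg[OF q X_nonneg[OF t]] x
      by (intro nn_integral_cong) (simp add: ennreal_mult mult.left_commute)
    also have "enn2real \<dots> = (\<integral>\<omega>. Z \<omega> * (exp (- q * t) * KX q t \<omega>) \<partial>P x)"
      using Z0 K_nonneg[OF q X_nonneg[OF t]] x
      by (intro integral_eq_nn_integral[symmetric] AE_I2) (auto intro!: mult_nonneg_nonneg)
    finally show ?thesis .
  qed
  \<comment> \<open>The bound holds for small rates only, so the sequence is started at \<open>n0\<close>.\<close>
  obtain n0 where n0: "\<And>n y. n \<ge> n0 \<Longrightarrow> y \<ge> 0 \<Longrightarrow> h (Q n) y \<le> 2 * h0 m y"
    using rates_dom[OF Q] unfolding eventually_sequentially by blast
  let ?I = "LINT v|lborel. f0 v"
  let ?g = "\<lambda>n \<omega>. Z \<omega> * (exp (- Q (n + n0) * t) * KX (Q (n + n0)) t \<omega>)"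
  have "(\<lambda>n. \<integral>\<omega>. ?g n \<omega> \<partial>P x) \<longlonglongrightarrow> (\<integral>\<omega>. Z \<omega> * NX t \<omega> \<partial>P x)"
  proof (rule integral_dominated_convergence[where w = "\<lambda>\<omega>. C * (2 * NX t \<omega> + ?I)"])
    interpret P: prob_space "P x" by (rule prob_space_P[OF x])
    show "integrable (P x) (\<lambda>\<omega>. C * (2 * NX t \<omega> + ?I))"
      using N0_integrable[OF t] by (intro integrable_mult_right Bochner_Integration.integrable_add) auto
    show "?g n \<in> borel_measurable (P x)" for n
      using measurable_F_P[OF K_measurable[OF Q(1) t]] by measurable
    show "AE \<omega> in P x. norm (?g n \<omega>) \<le> C * (2 * NX t \<omega> + ?I)" for n
    proof (rule AE_I2)
      fix \<omega> assume "\<omega> \<in> space (P x)"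
      then have w: "\<omega> \<in> \<Omega>" using x by simp
      let ?q = "Q (n + n0)"
      have K0: "0 \<le> KX ?q t \<omega>" by (rule K_nonneg[OF Q(1) X_nonneg[OF t w]])
      have K1: "KX ?q t \<omega> \<le> 2 * NX t \<omega> + ?I"
        by (rule K_le[OF Q(1) X_nonneg[OF t w] n0]) auto
      have "exp (- ?q * t) * KX ?q t \<omega> \<le> 1 * (2 * NX t \<omega> + ?I)"
        using K0 K1 Q(1)[of "n + n0"] t by (intro mult_mono) auto
      then have "?g n \<omega> \<le> C * (2 * NX t \<omega> + ?I)"
        using K0 Z0[OF w] ZC[OF w] by (intro mult_mono) auto
      moreover have "0 \<le> ?g n \<omega>" using K0 Z0[OF w] by simp
      ultimately show "norm (?g n \<omega>) \<le> C * (2 * NX t \<omega> + ?I)" by simp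
    qed
    show "AE \<omega> in P x. (\<lambda>n. ?g n \<omega>) \<longlonglongrightarrow> Z \<omega> * NX t \<omega>"
    proof (rule AE_I2)
      fix \<omega> assume "\<omega> \<in> space (P x)"
      then have w: "\<omega> \<in> \<Omega>" using x by simp
      have "(\<lambda>n. Z \<omega> * (exp (- Q n * t) * KX (Q n) t \<omega>)) \<longlonglongrightarrow> Z \<omega> * (exp (- 0 * t) * NX t \<omega>)"
        by (intro tendsto_intros Q rates_K X_nonneg t w)
      then show "(\<lambda>n. ?g n \<omega>) \<longlonglongrightarrow> Z \<omega> * NX t \<omega>"
        by (intro LIMSEQ_ignore_initial_segment[where k = n0, of "\<lambda>n. Z \<omega> * (exp (- Q n * t) * KX (Q n) t \<omega>)"]) simp
    qed
  qed measurable
  then have "(\<lambda>n. \<integral>\<omega>. Z \<omega> * (exp (- Q n * t) * KX (Q n) t \<omega>) \<partial>P x) \<longlonglongrightarrow> (\<integral>\<omega>. Z \<omega> * NX t \<omega> \<partial>P x)"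
    by (rule LIMSEQ_offset)
  then show ?thesis by (simp only: eq[OF Q(1)])
qed

text \<open>On \<open>[0,t]\<close> the density of the clock lies between \<open>q exp(-qt)\<close> and \<open>q\<close>, and \<open>q H(q)\<close> tends to \<open>\<pi>\<^sub>0\<close>.\<close>

lemma limit_before_nonneg:
  assumes t: "t \<ge> 0" and Z: "Z \<in> borel_measurable (F t)"
    and Z0: "\<And>\<omega>. \<omega> \<in> \<Omega> \<Longrightarrow> 0 \<le> Z \<omega>" and ZC: "\<And>\<omega>. \<omega> \<in> \<Omega> \<Longrightarrow> Z \<omega> \<le> C"
    and Q: "\<And>n. Q n > 0" "Q \<longlonglongrightarrow> 0"
  shows "(\<lambda>n. clocked (Q n) Z {..t})
    \<longlonglongrightarrow> pi0 m * (\<integral>\<omega>. Z \<omega> * A0 t \<omega> \<partial>P x)"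
proof -
  have ZP[measurable]: "Z \<in> borel_measurable (P x)" by (rule measurable_F_P[OF Z])
  note A_meas[measurable] = measurable_F_P[OF A0_measurable[OF t]]
  let ?I = "\<integral>\<omega>. Z \<omega> * A0 t \<omega> \<partial>P x"
  have int: "integrable (P x) (\<lambda>\<omega>. Z \<omega> * A0 t \<omega>)"
  proof (rule Bochner_Integration.integrable_bound)
    show "integrable (P x) (\<lambda>\<omega>. C * A0 t \<omega>)" using A0_integrable[OF t] by simp
    show "AE \<omega> in P x. norm (Z \<omega> * A0 t \<omega>) \<le> norm (C * A0 t \<omega>)"
    proof (rule AE_I2)
      fix \<omega> assume "\<omega> \<in> space (P x)"
      then have "\<omega> \<in> \<Omega>" using x by simp
      with Z0[OF this] ZC[OF this] have "\<bar>Z \<omega>\<bar> \<le> \<bar>C\<bar>" by simp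
      then show "norm (Z \<omega> * A0 t \<omega>) \<le> norm (C * A0 t \<omega>)"
        by (simp add: abs_mult mult_right_mono)
    qed
  qed measurable
  have nn: "(\<integral>\<^sup>+\<omega>. ennreal (c * (Z \<omega> * A0 t \<omega>)) \<partial>P x) = ennreal (c * ?I)" if "c \<ge> 0" for c
    using int that Z0 A0_nonneg x
    by (subst nn_integral_eq_integral) (auto intro!: AE_I2 mult_nonneg_nonneg)
  have I0: "0 \<le> ?I" using Z0 A0_nonneg x by (intro Bochner_Integration.integral_nonneg) auto
  have bounds: "q * H q * exp (- q * t) * ?I \<le> clocked q Z {..t}"
      "clocked q Z {..t} \<le> q * H q * ?I" if q: "q > 0" for q
  proof -
    let ?E = "\<integral>\<^sup>+\<omega>. ennreal (Z \<omega>) * reward q {..t} \<omega> \<partial>P x"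
    have path: "ennreal (q * exp (- q * t)) * ennreal (A0 t \<omega>) \<le> reward q {..t} \<omega>
       \<and> reward q {..t} \<omega> \<le> ennreal q * ennreal (A0 t \<omega>)"
      if w: "\<omega> \<in> \<Omega>" and A: "occupation t \<omega> = ennreal (A0 t \<omega>)" for \<omega>
    proof -
      have [measurable]: "(\<lambda>v. Lp v \<omega>) \<in> borel_measurable borel"
        by (intro borel_measurable_continuous_onI Lp_cont w)
      have c: "reward q {..t} \<omega>
        = (\<integral>\<^sup>+r\<in>{0..}. ennreal (q * exp (- q * r)) * (ennreal (f0 (Lp r \<omega>)) * indicator {..t} r) \<partial>lborel)"
        by (rule nn_integral_clock[OF _ q]) measurable
      have "ennreal (q * exp (- q * t)) * ennreal (A0 t \<omega>)
         = (\<integral>\<^sup>+r. ennreal (q * exp (- q * t)) * (ennreal (f0 (Lp r \<omega>)) * indicator {0..t} r) \<partial>lborel)"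
        unfolding A[symmetric] by (rule nn_integral_cmult[symmetric]) measurable
      also have "\<dots> \<le> (\<integral>\<^sup>+r\<in>{0..}. ennreal (q * exp (- q * r)) * (ennreal (f0 (Lp r \<omega>)) * indicator {..t} r) \<partial>lborel)"
        using q by (intro nn_integral_mono) (auto simp: indicator_def intro!: mult_right_mono ennreal_leI)
      finally have 1: "ennreal (q * exp (- q * t)) * ennreal (A0 t \<omega>) \<le> reward q {..t} \<omega>"
        unfolding c .
      have "(\<integral>\<^sup>+r\<in>{0..}. ennreal (q * exp (- q * r)) * (ennreal (f0 (Lp r \<omega>)) * indicator {..t} r) \<partial>lborel)
         \<le> (\<integral>\<^sup>+r. ennreal q * (ennreal (f0 (Lp r \<omega>)) * indicator {0..t} r) \<partial>lborel)"
        using q by (intro nn_integral_mono) (auto simp: indicator_def mult_le_cancel_left1 intro!: mult_right_mono ennreal_leI)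
      also have "\<dots> = ennreal q * ennreal (A0 t \<omega>)"
        unfolding A[symmetric] by (rule nn_integral_cmult) measurable
      finally have 2: "reward q {..t} \<omega> \<le> ennreal q * ennreal (A0 t \<omega>)"
        unfolding c .
      from 1 2 show ?thesis ..
    qed
    have "ennreal (q * exp (- q * t) * ?I) = (\<integral>\<^sup>+\<omega>. ennreal (q * exp (- q * t) * (Z \<omega> * A0 t \<omega>)) \<partial>P x)"
      using q by (subst nn) auto
    also have "\<dots> \<le> ?E"
    proof (rule nn_integral_mono_AE, use AE_occupation[OF t] AE_space in eventually_elim)
      case (elim \<omega>)
      then have w: "\<omega> \<in> \<Omega>" using x by simp
      have "ennreal (q * exp (- q * t) * (Z \<omega> * A0 t \<omega>)) = ennreal (Z \<omega>) * (ennreal (q * exp (- q * t)) * ennreal (A0 t \<omega>))"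
        using q Z0[OF w] A0_nonneg by (simp add: ennreal_mult mult_ac)
      then show ?case using path[OF w] elim by (auto intro!: mult_left_mono)
    qed
    finally have lo: "ennreal (q * exp (- q * t) * ?I) \<le> ?E" .
    have "?E \<le> (\<integral>\<^sup>+\<omega>. ennreal (q * (Z \<omega> * A0 t \<omega>)) \<partial>P x)"
    proof (rule nn_integral_mono_AE, use AE_occupation[OF t] AE_space in eventually_elim)
      case (elim \<omega>)
      then have w: "\<omega> \<in> \<Omega>" using x by simp
      have "ennreal (q * (Z \<omega> * A0 t \<omega>)) = ennreal (Z \<omega>) * (ennreal q * ennreal (A0 t \<omega>))"
        using q Z0[OF w] A0_nonneg by (simp add: ennreal_mult mult_ac)
      then show ?case using path[OF w] elim by (auto intro!: mult_left_mono)
    qed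
    also have "\<dots> = ennreal (q * ?I)" using q by (subst nn) auto
    finally have up: "?E \<le> ennreal (q * ?I)" .
    obtain E' where E': "?E = ennreal E'" "E' \<ge> 0"
      using up by (cases ?E) (auto simp: top_unique)
    have "clocked q Z {..t} = enn2real (ennreal (H q) * ?E)"
      by (rule integral_at_clock[OF q _ measurable_F_S[OF Z] Z0]) auto
    also have "\<dots> = H q * E'"
      unfolding E'(1) using H_pos[OF q] E'(2) by (simp add: ennreal_mult'[symmetric] enn2real_mult)
    finally have eq: "clocked q Z {..t} = H q * E'" .
    have "q * exp (- q * t) * ?I \<le> E'" "E' \<le> q * ?I"
      using lo up E'(2) q I0 unfolding E'(1) by (auto simp: ennreal_le_iff)
    then have "H q * (q * exp (- q * t) * ?I) \<le> H q * E'" "H q * E' \<le> H q * (q * ?I)"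
      using H_pos[OF q] by (auto intro!: mult_left_mono)
    then show "q * H q * exp (- q * t) * ?I \<le> clocked q Z {..t}"
      "clocked q Z {..t} \<le> q * H q * ?I"
      unfolding eq by (simp_all add: mult_ac)
  qed
  show ?thesis
  proof (rule tendsto_sandwich)
    show "\<forall>\<^sub>F n in sequentially. Q n * H (Q n) * exp (- Q n * t) * ?I
       \<le> clocked (Q n) Z {..t}"
      by (intro always_eventually allI bounds Q)
    show "\<forall>\<^sub>F n in sequentially. clocked (Q n) Z {..t}
       \<le> Q n * H (Q n) * ?I"
      by (intro always_eventually allI bounds Q)
    have "(\<lambda>n. Q n * H (Q n) * exp (- Q n * t) * ?I) \<longlonglongrightarrow> pi0 m * exp (- 0 * t) * ?I"
      by (intro tendsto_intros rates_qH Q)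
    then show "(\<lambda>n. Q n * H (Q n) * exp (- Q n * t) * ?I) \<longlonglongrightarrow> pi0 m * ?I" by simp
    show "(\<lambda>n. Q n * H (Q n) * ?I) \<longlonglongrightarrow> pi0 m * ?I"
      by (intro tendsto_intros rates_qH Q)
  qed
qed

lemma bounded_times_integrable:
  fixes Y Z :: "'w \<Rightarrow> real"
  assumes Z: "Z \<in> borel_measurable (P x)" and ZC: "\<And>\<omega>. \<omega> \<in> \<Omega> \<Longrightarrow> \<bar>Z \<omega>\<bar> \<le> C" and Y: "integrable (P x) Y"
  shows "integrable (P x) (\<lambda>\<omega>. Z \<omega> * Y \<omega>)"
proof (rule Bochner_Integration.integrable_bound)
  show "integrable (P x) (\<lambda>\<omega>. C * Y \<omega>)" using Y by simp
  show "AE \<omega> in P x. norm (Z \<omega> * Y \<omega>) \<le> norm (C * Y \<omega>)"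
  proof (rule AE_I2)
    fix \<omega> assume "\<omega> \<in> space (P x)"
    then have "\<bar>Z \<omega>\<bar> \<le> \<bar>C\<bar>" using x ZC[of \<omega>] by simp
    then show "norm (Z \<omega> * Y \<omega>) \<le> norm (C * Y \<omega>)"
      by (simp add: abs_mult mult_right_mono)
  qed
qed (use Z Y in measurable)

text \<open>The limits for nonnegative bounded factors extend to signed ones, \<open>Z = (Z + D) - D\<close>, by linearity.\<close>

lemma limit_signed:
  fixes Z Y' :: "'w \<Rightarrow> real" and Y :: "nat \<Rightarrow> 'w \<Rightarrow> real" and c :: "nat \<Rightarrow> real" and C :: real
  assumes Z: "Z \<in> borel_measurable (F t)" and ZC: "\<And>\<omega>. \<omega> \<in> \<Omega> \<Longrightarrow> \<bar>Z \<omega>\<bar> \<le> C"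
    and Y: "\<And>n. integrable (P x) (Y n)" and Y': "integrable (P x) Y'"
    and lim: "\<And>(Z :: 'w \<Rightarrow> real) (C :: real). Z \<in> borel_measurable (F t) \<Longrightarrow> (\<And>\<omega>. \<omega> \<in> \<Omega> \<Longrightarrow> 0 \<le> Z \<omega>) \<Longrightarrow> (\<And>\<omega>. \<omega> \<in> \<Omega> \<Longrightarrow> Z \<omega> \<le> C)
        \<Longrightarrow> (\<lambda>n. c n * (\<integral>\<omega>. Z \<omega> * Y n \<omega> \<partial>P x)) \<longlonglongrightarrow> (\<integral>\<omega>. Z \<omega> * Y' \<omega> \<partial>P x)"
  shows "(\<lambda>n. c n * (\<integral>\<omega>. Z \<omega> * Y n \<omega> \<partial>P x)) \<longlonglongrightarrow> (\<integral>\<omega>. Z \<omega> * Y' \<omega> \<partial>P x)"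
proof -
  define D where "D = \<bar>C\<bar>"
  have ZP: "Z \<in> borel_measurable (P x)" by (rule measurable_F_P[OF Z])
  have split: "(\<integral>\<omega>. (Z \<omega> + D) * y \<omega> \<partial>P x) - (\<integral>\<omega>. D * y \<omega> \<partial>P x) = (\<integral>\<omega>. Z \<omega> * y \<omega> \<partial>P x)"
    if y: "integrable (P x) y" for y
  proof -
    have "integrable (P x) (\<lambda>\<omega>. Z \<omega> * y \<omega>)" by (rule bounded_times_integrable[OF ZP ZC y])
    then have "(\<integral>\<omega>. Z \<omega> * y \<omega> + D * y \<omega> \<partial>P x) = (\<integral>\<omega>. Z \<omega> * y \<omega> \<partial>P x) + (\<integral>\<omega>. D * y \<omega> \<partial>P x)"
      using y by (intro Bochner_Integration.integral_add) auto
    then show ?thesis by (simp add: distrib_right)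
  qed
  have "(\<lambda>n. c n * (\<integral>\<omega>. (Z \<omega> + D) * Y n \<omega> \<partial>P x)) \<longlonglongrightarrow> (\<integral>\<omega>. (Z \<omega> + D) * Y' \<omega> \<partial>P x)"
  proof (rule lim[where C = "2 * D"])
    fix \<omega> assume "\<omega> \<in> \<Omega>"
    from ZC[OF this] show "0 \<le> Z \<omega> + D" "Z \<omega> + D \<le> 2 * D" by (auto simp: D_def)
  qed (use Z in measurable)
  moreover have "(\<lambda>n. c n * (\<integral>\<omega>. D * Y n \<omega> \<partial>P x)) \<longlonglongrightarrow> (\<integral>\<omega>. D * Y' \<omega> \<partial>P x)"
    by (rule lim[where Z = "\<lambda>_. D" and C = D]) (auto simp: D_def)
  ultimately have "(\<lambda>n. c n * (\<integral>\<omega>. (Z \<omega> + D) * Y n \<omega> \<partial>P x) - c n * (\<integral>\<omega>. D * Y n \<omega> \<partial>P x))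
      \<longlonglongrightarrow> (\<integral>\<omega>. (Z \<omega> + D) * Y' \<omega> \<partial>P x) - (\<integral>\<omega>. D * Y' \<omega> \<partial>P x)"
    by (rule tendsto_diff)
  then show ?thesis by (simp only: right_diff_distrib[symmetric] split[OF Y] split[OF Y'])
qed

lemma M0_integrable: "t \<ge> 0 \<Longrightarrow> integrable (P x) (M0 t)"
  unfolding M0_def[abs_def] by (intro Bochner_Integration.integrable_add integrable_mult_right N0_integrable A0_integrable)

lemma at_clock_restricted_integrable: "q > 0 \<Longrightarrow> B \<in> sets borel \<Longrightarrow> integrable (P x) (\<lambda>\<omega>. at_clock q \<omega> * indicator B (e \<omega> / q))"
proof -
  assume q: "q > 0" and B[measurable]: "B \<in> sets borel"
  note e_measurable[measurable]
  have "integrable (P x) (\<lambda>\<omega>. indicator B (e \<omega> / q) * at_clock q \<omega>)"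
    by (rule bounded_times_integrable[where C = 1, OF _ _ at_clock_integrable[OF q]]) (auto simp: indicator_def)
  then show ?thesis by (simp add: mult.commute)
qed

lemma limit_after:
  assumes t: "t \<ge> 0" and Z: "Z \<in> borel_measurable (F t)" and ZC: "\<And>\<omega>. \<omega> \<in> \<Omega> \<Longrightarrow> \<bar>Z \<omega>\<bar> \<le> C"
    and Q: "\<And>n. Q n > 0" "Q \<longlonglongrightarrow> 0"
  shows "(\<lambda>n. H (Q n) * (\<integral>\<omega>. Z \<omega> * (at_clock (Q n) \<omega> * indicator {t<..} (e \<omega> / Q n)) \<partial>P x))
    \<longlonglongrightarrow> (\<integral>\<omega>. Z \<omega> * NX t \<omega> \<partial>P x)"
proof (rule limit_signed[OF Z ZC at_clock_restricted_integrable[OF Q(1)] N0_integrable[OF t]])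
  fix Z :: "'w \<Rightarrow> real" and C :: real
  assume Z: "Z \<in> borel_measurable (F t)" "\<And>\<omega>. \<omega> \<in> \<Omega> \<Longrightarrow> 0 \<le> Z \<omega>" "\<And>\<omega>. \<omega> \<in> \<Omega> \<Longrightarrow> Z \<omega> \<le> C"
  show "(\<lambda>n. H (Q n) * (\<integral>\<omega>. Z \<omega> * (at_clock (Q n) \<omega> * indicator {t<..} (e \<omega> / Q n)) \<partial>P x))
    \<longlonglongrightarrow> (\<integral>\<omega>. Z \<omega> * NX t \<omega> \<partial>P x)"
    using limit_after_nonneg[OF t Z Q] by (simp only: mult.assoc)
qed auto

lemma limit_at_clock:
  assumes t: "t \<ge> 0" and Z: "Z \<in> borel_measurable (F t)" and ZC: "\<And>\<omega>. \<omega> \<in> \<Omega> \<Longrightarrow> \<bar>Z \<omega>\<bar> \<le> C"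
    and Q: "\<And>n. Q n > 0" "Q \<longlonglongrightarrow> 0"
  shows "(\<lambda>n. H (Q n) * (\<integral>\<omega>. Z \<omega> * at_clock (Q n) \<omega> \<partial>P x)) \<longlonglongrightarrow> (\<integral>\<omega>. Z \<omega> * M0 t \<omega> \<partial>P x)"
proof (rule limit_signed[OF Z ZC at_clock_integrable[OF Q(1)] M0_integrable[OF t]])
  fix Z :: "'w \<Rightarrow> real" and C :: real
  assume Z: "Z \<in> borel_measurable (F t)" and Z0: "\<And>\<omega>. \<omega> \<in> \<Omega> \<Longrightarrow> 0 \<le> Z \<omega>" and ZC: "\<And>\<omega>. \<omega> \<in> \<Omega> \<Longrightarrow> Z \<omega> \<le> (C::real)"
  have ab: "\<And>\<omega>. \<omega> \<in> \<Omega> \<Longrightarrow> \<bar>Z \<omega>\<bar> \<le> C" using Z0 ZC by force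
  have ZP: "Z \<in> borel_measurable (P x)" by (rule measurable_F_P[OF Z])
  have i: "integrable (P x) (\<lambda>\<omega>. Z \<omega> * at_clock q \<omega> * indicator B (e \<omega> / q))" if "q > 0" "B \<in> sets borel" for q B
    using bounded_times_integrable[OF ZP ab at_clock_restricted_integrable[OF that]] by (simp add: mult.assoc)
  have s: "(\<integral>\<omega>. Z \<omega> * at_clock q \<omega> * indicator {t<..} (e \<omega> / q) \<partial>P x) + (\<integral>\<omega>. Z \<omega> * at_clock q \<omega> * indicator {..t} (e \<omega> / q) \<partial>P x)
     = (\<integral>\<omega>. Z \<omega> * at_clock q \<omega> \<partial>P x)" if q: "q > 0" for q
  proof -
    have "(\<integral>\<omega>. Z \<omega> * at_clock q \<omega> * indicator {t<..} (e \<omega> / q) \<partial>P x) + (\<integral>\<omega>. Z \<omega> * at_clock q \<omega> * indicator {..t} (e \<omega> / q) \<partial>P x)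
      = (\<integral>\<omega>. Z \<omega> * at_clock q \<omega> * indicator {t<..} (e \<omega> / q) + Z \<omega> * at_clock q \<omega> * indicator {..t} (e \<omega> / q) \<partial>P x)"
      by (rule Bochner_Integration.integral_add[symmetric]) (use i q in auto)
    also have "\<dots> = (\<integral>\<omega>. Z \<omega> * at_clock q \<omega> \<partial>P x)"
      by (intro Bochner_Integration.integral_cong) (auto simp: indicator_def)
    finally show ?thesis .
  qed
  have "(\<lambda>n. clocked (Q n) Z {t<..}
      + clocked (Q n) Z {..t})
     \<longlonglongrightarrow> (\<integral>\<omega>. Z \<omega> * NX t \<omega> \<partial>P x) + pi0 m * (\<integral>\<omega>. Z \<omega> * A0 t \<omega> \<partial>P x)"
    by (rule tendsto_add[OF limit_after_nonneg[OF t Z Z0 ZC Q] limit_before_nonneg[OF t Z Z0 ZC Q]])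
  also have "(\<lambda>n. clocked (Q n) Z {t<..}
      + clocked (Q n) Z {..t}) = (\<lambda>n. H (Q n) * (\<integral>\<omega>. Z \<omega> * at_clock (Q n) \<omega> \<partial>P x))"
    by (simp only: distrib_left[symmetric] s[OF Q(1)])
  also have "(\<integral>\<omega>. Z \<omega> * NX t \<omega> \<partial>P x) + pi0 m * (\<integral>\<omega>. Z \<omega> * A0 t \<omega> \<partial>P x) = (\<integral>\<omega>. Z \<omega> * M0 t \<omega> \<partial>P x)"
  proof -
    have "(\<integral>\<omega>. Z \<omega> * NX t \<omega> + pi0 m * (Z \<omega> * A0 t \<omega>) \<partial>P x)
      = (\<integral>\<omega>. Z \<omega> * NX t \<omega> \<partial>P x) + (\<integral>\<omega>. pi0 m * (Z \<omega> * A0 t \<omega>) \<partial>P x)"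
      by (intro Bochner_Integration.integral_add integrable_mult_right bounded_times_integrable[OF ZP ab] N0_integrable A0_integrable t)
    then show ?thesis by (simp add: M0_def algebra_simps)
  qed
  finally show "(\<lambda>n. H (Q n) * (\<integral>\<omega>. Z \<omega> * at_clock (Q n) \<omega> \<partial>P x)) \<longlonglongrightarrow> (\<integral>\<omega>. Z \<omega> * M0 t \<omega> \<partial>P x)" .
qed

text \<open>For \<open>A\<close> in \<open>\<F>\<^sub>s\<close> the sequence \<open>H(q) P\<^sub>x[1\<^sub>A f(L(e\<^sub>q))]\<close> converges to the integral of \<open>M\<^sub>s\<close> over \<open>A\<close>, and,
  since \<open>A\<close> also belongs to \<open>\<F>\<^sub>t\<close>, to that of \<open>M\<^sub>t\<close>.\<close>

lemma martingale_property:
  assumes s: "0 \<le> s" and st: "s \<le> t"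
  shows "AE \<omega> in P x. real_cond_exp (P x) (F s) (M0 t) \<omega> = M0 s \<omega>"
proof -
  interpret P: prob_space "P x" by (rule prob_space_P[OF x])
  interpret finite_measure_subalgebra "P x" "F s" by unfold_locales (rule subalgebra_F[OF x])
  have t: "0 \<le> t" using s st by simp
  show ?thesis
  proof (rule real_cond_exp_charact)
    fix A assume A: "A \<in> sets (F s)"
    let ?Q = "\<lambda>n. 1 / real (Suc n)"
    have Q: "?Q n > 0" for n by simp
    have Q0: "?Q \<longlonglongrightarrow> 0" using lim_1_over_n[THEN LIMSEQ_Suc] .
    have At: "A \<in> sets (F t)" using A F_mono[OF st] by auto
    have "(\<lambda>n. H (?Q n) * (\<integral>\<omega>. indicator A \<omega> * at_clock (?Q n) \<omega> \<partial>P x)) \<longlonglongrightarrow> (\<integral>\<omega>. indicator A \<omega> * M0 t \<omega> \<partial>P x)"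
      by (rule limit_at_clock[OF t _ _ Q Q0, where C = 1]) (use At in auto)
    moreover have "(\<lambda>n. H (?Q n) * (\<integral>\<omega>. indicator A \<omega> * at_clock (?Q n) \<omega> \<partial>P x)) \<longlonglongrightarrow> (\<integral>\<omega>. indicator A \<omega> * M0 s \<omega> \<partial>P x)"
      by (rule limit_at_clock[OF s _ _ Q Q0, where C = 1]) (use A in auto)
    ultimately have "(\<integral>\<omega>. indicator A \<omega> * M0 t \<omega> \<partial>P x) = (\<integral>\<omega>. indicator A \<omega> * M0 s \<omega> \<partial>P x)"
      by (rule LIMSEQ_unique)
    then show "(\<integral>\<omega>\<in>A. M0 t \<omega> \<partial>P x) = (\<integral>\<omega>\<in>A. M0 s \<omega> \<partial>P x)" by (simp add: set_lebesgue_integral_def)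
  next
    show "M0 s \<in> borel_measurable (F s)"
      unfolding M0_def[abs_def] using N0_measurable[OF s] A0_measurable[OF s] by measurable
  qed (use M0_integrable s t in auto)
qed

text \<open>Almost surely the increasing part of \<open>M\<close> at time \<open>s\<close> is at most its value at \<open>t\<close>, so \<open>N\<^sub>t\<close> is at most
  \<open>M\<^sub>t\<close> minus the increasing part at \<open>s\<close>; the latter is measurable at time \<open>s\<close>.\<close>

lemma supermartingale_property:
  assumes s: "0 \<le> s" and st: "s \<le> t"
  shows "AE \<omega> in P x. real_cond_exp (P x) (F s) (NX t) \<omega> \<le> NX s \<omega>"
proof -
  interpret P: prob_space "P x" by (rule prob_space_P[OF x])
  interpret finite_measure_subalgebra "P x" "F s" by unfold_locales (rule subalgebra_F[OF x])
  have t: "0 \<le> t" using s st by simp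
  let ?A = "\<lambda>\<omega>. pi0 m * A0 s \<omega>"
  have Ai: "integrable (P x) ?A" using A0_integrable[OF s] by simp
  have Am: "?A \<in> borel_measurable (F s)" using A0_measurable[OF s] by measurable
  have "AE \<omega> in P x. real_cond_exp (P x) (F s) (NX t) \<omega>
      \<le> real_cond_exp (P x) (F s) (\<lambda>\<omega>. M0 t \<omega> - ?A \<omega>) \<omega>"
  proof (rule real_cond_exp_mono)
    show "AE \<omega> in P x. NX t \<omega> \<le> M0 t \<omega> - ?A \<omega>"
      using A0_mono[OF s st] by eventually_elim (simp add: M0_def mult_left_mono pi0_nonneg)
  qed (use N0_integrable M0_integrable Ai t in auto)
  moreover have "AE \<omega> in P x. real_cond_exp (P x) (F s) (\<lambda>\<omega>. M0 t \<omega> - ?A \<omega>) \<omega>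
      = real_cond_exp (P x) (F s) (M0 t) \<omega> - real_cond_exp (P x) (F s) ?A \<omega>"
    by (rule real_cond_exp_diff[OF M0_integrable[OF t] Ai])
  moreover have "AE \<omega> in P x. real_cond_exp (P x) (F s) ?A \<omega> = ?A \<omega>"
    by (rule real_cond_exp_F_meas[OF Ai Am])
  ultimately show ?thesis using martingale_property[OF s st]
    by eventually_elim (simp add: M0_def)
qed

end

theorem theorem1p1:
  fixes m :: "real \<Rightarrow> real" and \<phi> \<psi> :: "real \<Rightarrow> real \<Rightarrow> real"
    and M :: "'w measure" and P :: "real \<Rightarrow> 'w measure"
    and X :: "real \<Rightarrow> 'w \<Rightarrow> real" and \<theta> :: "real \<Rightarrow> 'w \<Rightarrow> 'w"
    and L :: "real \<Rightarrow> 'w \<Rightarrow> real" and e :: "'w \<Rightarrow> real"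
    and f :: "real \<Rightarrow> real" and x :: real
  assumes m: "speed_function m"
    and phi: "\<And>q. q > 0 \<Longrightarrow> krein_feller_solution m q 1 0 (\<phi> q)"
    and psi: "\<And>q. q > 0 \<Longrightarrow> krein_feller_solution m q 0 1 (\<psi> q)"
    and X: "reflecting_diffusion M P X \<theta> m"
    and L: "local_time_at_zero M P X \<theta> (resolvent_density \<phi> \<psi>) L"
    and x: "x \<ge> 0"
    and e_nonneg: "\<And>\<omega>. \<omega> \<in> space M \<Longrightarrow> e \<omega> \<ge> 0"
    and e_exponential: "distributed (P x) lborel e (exponential_density 1)"
    and e_indep: "prob_space.indep_set (P x)
      (sets (process_sigma (space M) X {0..})) (sets (vimage_algebra (space M) e borel))"
    and f_nonneg: "\<And>u. u \<ge> 0 \<Longrightarrow> f u \<ge> 0"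
    and f_integrable: "set_integrable lborel {0..} f"
  shows "supermartingale (P x) (right_filtration (space M) X) (N_proc m f X L) \<and>
    martingale (P x) (right_filtration (space M) X) (M_proc m f X L) \<and>
    (\<forall>q>0. integrable (P x) (\<lambda>\<omega>. f (L (e \<omega> / q) \<omega>))) \<and>
    (\<forall>t>0. \<forall>F :: real \<Rightarrow> 'w \<Rightarrow> real.
      adapted (right_filtration (space M) X) F \<and>
      (\<exists>C. \<forall>s\<ge>0. \<forall>\<omega>\<in>space M. \<bar>F s \<omega>\<bar> \<le> C) \<longrightarrow>
      ((\<lambda>q. H_fun \<phi> \<psi> q *
          (\<integral>\<omega>. F t \<omega> * f (L (e \<omega> / q) \<omega>) * indicator {\<omega>. t < e \<omega> / q} \<omega> \<partial>P x))
        \<longlongrightarrow> (\<integral>\<omega>. F t \<omega> * N_proc m f X L t \<omega> \<partial>P x)) (at_right 0) \<and>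
      ((\<lambda>q. H_fun \<phi> \<psi> q * (\<integral>\<omega>. F t \<omega> * f (L (e \<omega> / q) \<omega>) \<partial>P x))
        \<longlongrightarrow> (\<integral>\<omega>. F t \<omega> * M_proc m f X L t \<omega> \<partial>P x)) (at_right 0))"
proof -
  interpret local_time_at_zero M P X \<theta> "resolvent_density \<phi> \<psi>" L by (rule L)
  interpret penalization_clock m \<phi> \<psi> M P X \<theta> L f x e
    by unfold_locales (fact m phi psi x f_nonneg f_integrable e_exponential e_indep)+
  have spP: "space (P x) = space M" using x by simp
  have Neq: "\<And>t \<omega>. t \<ge> 0 \<Longrightarrow> \<omega> \<in> space M \<Longrightarrow> N_proc m f X L t \<omega> = NX t \<omega>" by (rule N_proc_eq)
  have Meq: "\<And>t \<omega>. t \<ge> 0 \<Longrightarrow> \<omega> \<in> space M \<Longrightarrow> M_proc m f X L t \<omega> = M0 t \<omega>" by (rule M_proc_eq)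
  have at: "f (L (e \<omega> / q) \<omega>) = at_clock q \<omega>" if "q > 0" "\<omega> \<in> space M" for q \<omega>
    using that e_nonneg[OF that(2)] Lp_nonneg[OF that(2), of "e \<omega> / q"] by (simp add: Lp_eq f0_eq)
  have Nm: "N_proc m f X L t \<in> borel_measurable (right_filtration (space M) X t)" if "t \<ge> 0" for t
    by (rule measurable_cong[THEN iffD2, OF _ N0_measurable[OF that]]) (use Neq that in auto)
  have Mm: "M_proc m f X L t \<in> borel_measurable (right_filtration (space M) X t)" if t: "t \<ge> 0" for t
  proof -
    have "M0 t \<in> borel_measurable (right_filtration (space M) X t)"
      unfolding M0_def[abs_def] using N0_measurable[OF t] A0_measurable[OF t] by measurable
    then show ?thesis by (rule measurable_cong[THEN iffD2, rotated]) (use Meq t in auto)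
  qed
  have Ni: "integrable (P x) (N_proc m f X L t)" if t: "t \<ge> 0" for t
    by (rule Bochner_Integration.integrable_cong[THEN iffD2, OF refl _ N0_integrable[OF t]]) (use Neq t spP in auto)
  have Mi: "integrable (P x) (M_proc m f X L t)" if t: "t \<ge> 0" for t
    by (rule Bochner_Integration.integrable_cong[THEN iffD2, OF refl _ M0_integrable[OF t]]) (use Meq t spP in auto)
  have super: "supermartingale (P x) (right_filtration (space M) X) (N_proc m f X L)"
    unfolding supermartingale_def adapted_def
  proof (intro conjI allI impI Nm Ni)
    fix s t :: real assume st: "0 \<le> s \<and> s \<le> t"
    then have s: "0 \<le> s" "s \<le> t" and t: "0 \<le> t" by auto
    interpret P: prob_space "P x" by (rule prob_space_P[OF x])
    interpret finite_measure_subalgebra "P x" "right_filtration (space M) X s" by unfold_locales (rule subalgebra_F[OF x])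
    have "AE \<omega> in P x. real_cond_exp (P x) (right_filtration (space M) X s) (N_proc m f X L t) \<omega>
        = real_cond_exp (P x) (right_filtration (space M) X s) (NX t) \<omega>"
      by (rule real_cond_exp_cong) (use Neq t spP measurable_F_P[OF Nm[OF t]] measurable_F_P[OF N0_measurable[OF t]] in \<open>auto intro!: AE_I2\<close>)
    then show "AE \<omega> in P x. real_cond_exp (P x) (right_filtration (space M) X s) (N_proc m f X L t) \<omega> \<le> N_proc m f X L s \<omega>"
      using supermartingale_property[OF s] AE_space by eventually_elim (use Neq s spP in auto)
  qed
  have mart: "martingale (P x) (right_filtration (space M) X) (M_proc m f X L)"
    unfolding martingale_def adapted_def
  proof (intro conjI allI impI Mm Mi)
    fix s t :: real assume st: "0 \<le> s \<and> s \<le> t"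
    then have s: "0 \<le> s" "s \<le> t" and t: "0 \<le> t" by auto
    interpret P: prob_space "P x" by (rule prob_space_P[OF x])
    interpret finite_measure_subalgebra "P x" "right_filtration (space M) X s" by unfold_locales (rule subalgebra_F[OF x])
    have "AE \<omega> in P x. real_cond_exp (P x) (right_filtration (space M) X s) (M_proc m f X L t) \<omega>
        = real_cond_exp (P x) (right_filtration (space M) X s) (M0 t) \<omega>"
      by (rule real_cond_exp_cong) (use Meq t spP measurable_F_P[OF Mm[OF t]] M0_integrable[OF t] in \<open>auto intro!: AE_I2\<close>)
    then show "AE \<omega> in P x. real_cond_exp (P x) (right_filtration (space M) X s) (M_proc m f X L t) \<omega> = M_proc m f X L s \<omega>"
      using martingale_property[OF s] AE_space by eventually_elim (use Meq s spP in auto)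
  qed
  have int: "\<forall>q>0. integrable (P x) (\<lambda>\<omega>. f (L (e \<omega> / q) \<omega>))"
  proof (intro allI impI)
    fix q :: real assume q: "q > 0"
    show "integrable (P x) (\<lambda>\<omega>. f (L (e \<omega> / q) \<omega>))"
      by (rule Bochner_Integration.integrable_cong[THEN iffD2, OF refl _ at_clock_integrable[OF q]]) (use at q spP in auto)
  qed
  have lims: "((\<lambda>q. H_fun \<phi> \<psi> q *
          (\<integral>\<omega>. F t \<omega> * f (L (e \<omega> / q) \<omega>) * indicator {\<omega>. t < e \<omega> / q} \<omega> \<partial>P x))
        \<longlongrightarrow> (\<integral>\<omega>. F t \<omega> * N_proc m f X L t \<omega> \<partial>P x)) (at_right 0) \<and>
      ((\<lambda>q. H_fun \<phi> \<psi> q * (\<integral>\<omega>. F t \<omega> * f (L (e \<omega> / q) \<omega>) \<partial>P x))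
        \<longlongrightarrow> (\<integral>\<omega>. F t \<omega> * M_proc m f X L t \<omega> \<partial>P x)) (at_right 0)"
    if t: "t > 0" and ad: "adapted (right_filtration (space M) X) F"
      and bd: "\<forall>s\<ge>0. \<forall>\<omega>\<in>space M. \<bar>F s \<omega>\<bar> \<le> C" for t C and F :: "real \<Rightarrow> 'w \<Rightarrow> real"
  proof -
    have t0: "t \<ge> 0" using t by simp
    have Fm: "F t \<in> borel_measurable (right_filtration (space M) X t)" using ad t0 by (auto simp: adapted_def)
    have FC: "\<And>\<omega>. \<omega> \<in> space M \<Longrightarrow> \<bar>F t \<omega>\<bar> \<le> C" using bd t0 by blast
    have r1: "(\<integral>\<omega>. F t \<omega> * N_proc m f X L t \<omega> \<partial>P x) = (\<integral>\<omega>. F t \<omega> * NX t \<omega> \<partial>P x)"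
      by (intro Bochner_Integration.integral_cong) (use Neq t0 spP in auto)
    have r2: "(\<integral>\<omega>. F t \<omega> * M_proc m f X L t \<omega> \<partial>P x) = (\<integral>\<omega>. F t \<omega> * M0 t \<omega> \<partial>P x)"
      by (intro Bochner_Integration.integral_cong) (use Meq t0 spP in auto)
    have l1: "(\<integral>\<omega>. F t \<omega> * f (L (e \<omega> / q) \<omega>) * indicator {\<omega>. t < e \<omega> / q} \<omega> \<partial>P x)
      = (\<integral>\<omega>. F t \<omega> * (at_clock q \<omega> * indicator {t<..} (e \<omega> / q)) \<partial>P x)" if "q > 0" for q
      by (intro Bochner_Integration.integral_cong) (use at that spP in \<open>auto simp: indicator_def\<close>)
    have l2: "(\<integral>\<omega>. F t \<omega> * f (L (e \<omega> / q) \<omega>) \<partial>P x) = (\<integral>\<omega>. F t \<omega> * at_clock q \<omega> \<partial>P x)" if "q > 0" for q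
      by (intro Bochner_Integration.integral_cong) (use at that spP in auto)
    show ?thesis
      unfolding tendsto_at_iff_sequentially comp_def r1 r2
    proof (intro conjI allI impI)
      fix Q :: "nat \<Rightarrow> real" assume "\<forall>i. Q i \<in> {0<..} - {0}" and Q0: "Q \<longlonglongrightarrow> 0"
      then have Q: "\<And>n. Q n > 0" by auto
      show "(\<lambda>n. H_fun \<phi> \<psi> (Q n) * (\<integral>\<omega>. F t \<omega> * f (L (e \<omega> / Q n) \<omega>) * indicator {\<omega>. t < e \<omega> / Q n} \<omega> \<partial>P x))
        \<longlonglongrightarrow> (\<integral>\<omega>. F t \<omega> * NX t \<omega> \<partial>P x)"
        unfolding l1[OF Q] by (rule limit_after[OF t0 Fm FC Q Q0])
      show "(\<lambda>n. H_fun \<phi> \<psi> (Q n) * (\<integral>\<omega>. F t \<omega> * f (L (e \<omega> / Q n) \<omega>) \<partial>P x)) \<longlonglongrightarrow> (\<integral>\<omega>. F t \<omega> * M0 t \<omega> \<partial>P x)"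
        unfolding l2[OF Q] by (rule limit_at_clock[OF t0 Fm FC Q Q0])
    qed
  qed
  show ?thesis using super mart int lims by blast
qed

end
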